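(* Let $d\ge1$ be an integer and $H\in(0,1)$. Suppose that one of the following two conditions holds: (1) $H=1/2$ and $B\in\mathbf{B}^\alpha$ for some $\alpha\in[0,1]$; (2) $H\in(0,1/2)\cup(1/2,1)$, and $B$ is a Bernstein function with $B(0)=0$, with Lévy–Khintchine representation $B(\lambda)=b\lambda+\int_0^\infty(1-e^{-\lambda y})\,\nu(dy)$, whose Lévy measure satisfies $\nu(dy)\ge c\,y^{-1-\alpha}\,dy$ on $(0,\infty)$ for some constants $c>0$ and $\alpha\in(0,1)$. Let $X^{B,H}$ be a $\mathbb{T}^d$-valued subordinated fractional Brownian motion with index $H$ corresponding to $B$. Let $\beta>0$ and let $\tau=\tau(t)>0$ satisfy $c_1t^{-\beta}\le\tau(t)\le c_2t^{-\beta}$ for all $t>0$, for some constants $c_1,c_2>0$. For $t\ge\tau>0$ set $$\mu_{\tau,t}^{B,H}:=\frac{1}{\lfloor t/\tau\rfloor}\sum_{k=1}^{\lfloor t/\tau\rfloor}\delta_{X_{k\tau}^{B,H}}.$$ Then there exist constants $C>0$ and $t_0>1$ such that for all $t\ge t_0$, with $\tau=\tau(t)$, $$\mathbb{E}\big[\mathbb{W}_2(\mu_{\tau,t}^{B,H},\mathfrak{m})\big]\le C\cdot\begin{cases} t^{-1/2}, & d\le2,\\ t^{-\min\{\frac12,\frac{1+\beta}{d}\}}, & 2<d<2+\alpha/H,\\ \max\Big\{\sqrt{\frac{\log t}{t}},\,t^{-\frac{1+\beta}{d}}\Big\}, & d=2+\alpha/H,\\ t^{-\min\left\{\frac{1}{d-\alpha/H},\,\frac{1+\beta}{d}\right\}},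 & d>2+\alpha/H.\end{cases}$$
   Context: $\mathbb{T}^d=\mathbb{R}^d/\mathbb{Z}^d$ is the flat torus with distance $\rho(x,y)=\min_{k\in\mathbb{Z}^d}|x-y-k|$, and $\mathfrak{m}$ is the uniform distribution (normalized Lebesgue measure) on $\mathbb{T}^d$. For Borel probability measures $\mu,\nu$ on $\mathbb{T}^d$, $\mathbb{W}_2(\mu,\nu)=\inf_{\pi}\big(\int_{\mathbb{T}^d\times\mathbb{T}^d}\rho(x,y)^2\,\pi(dx,dy)\big)^{1/2}$, the infimum over all couplings $\pi$ of $\mu$ and $\nu$. $\lfloor a\rfloor$ is the greatest integer $\le a$. A Bernstein function is $B\in C([0,\infty);[0,\infty))\cap C^\infty((0,\infty);[0,\infty))$ with $(-1)^{k-1}\frac{d^k}{d\lambda^k}B(\lambda)\ge 0$ for all $k\in\mathbb{N}$, $\lambda>0$. If $B(0)=0$, it has a unique representation $B(\lambda)=b\lambda+\int_0^\infty(1-e^{-\lambda y})\,\nu(dy)$ with $b\ge0$ and $\nu$ a Lévy measure on $(0,\infty)$ (a Radon measure with $\int_0^\infty\frac{x}{1+x}\nu(dx)<\infty$). Let $\mathbf{B}$ be the set of Bernstein functions with $B(0)=0$ and $B'(0):=\lim_{\lambda\to0^+}B'(\lambda)>0$ (possibly $+\infty$), and for $\alpha\in[0,1]$ let $\mathbf{B}^\alpha=\{B\in\mathbf{B}:\liminf_{\lambda\to\infty}\lambda^{-\alpha}B(\lambda)>0\}$. For $B\in\mathbf{B}$, $S^B=(S^B_t)_{t\ge0}$ is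 the subordinator (increasing process with stationary independent increments, values in $[0,\infty)$, $S_0^B=0$) with $\mathbb{E}e^{-\lambda S_t^B}=e^{-tB(\lambda)}$ for $t,\lambda\ge0$. (A Bernstein function as in condition (2) belongs to $\mathbf{B}$.) For $H\in(0,1)$, the fractional Brownian motion $X^H=(X^H_t)_{t\ge0}$ on $\mathbb{R}^d$ is the centered continuous-time Gaussian process with covariance matrix $\frac12(s^{2H}+t^{2H}-|t-s|^{2H})I_d$; on $\mathbb{T}^d$ one takes its image under the projection $\mathbb{R}^d\to\mathbb{T}^d$. With $S^B$ independent of $X^H$, the subordinated fractional Brownian motion with index $H$ corresponding to $B$ is $X_t^{B,H}:=X^H_{S_t^B}$ (projected to $\mathbb{T}^d$ in the $\mathbb{T}^d$-valued case).
   Formalization: At d=2, α=0, where the rows d≤2 and d=2+α/H overlap with different rates, the third row (with √(log t/t)) is taken; the rate t^{-1/2} fails there, e.g. for H=1/2, B(λ)=1−e^{−λ}. *)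

theory Defs
  imports "HOL-Probability.Probability"
begin

definition int_lattice :: "(real ^ 'n::finite) set" where
  "int_lattice = {k. \<forall>i. k $ i \<in> \<int>}"

lemma int_lattice_zero: "0 \<in> int_lattice"
  by (simp add: int_lattice_def)

lemma int_lattice_add: "a \<in> int_lattice \<Longrightarrow> b \<in> int_lattice \<Longrightarrow> a + b \<in> int_lattice"
  by (simp add: int_lattice_def)

lemma int_lattice_diff: "a \<in> int_lattice \<Longrightarrow> b \<in> int_lattice \<Longrightarrow> a - b \<in> int_lattice"
  by (simp add: int_lattice_def)

lemma int_lattice_uminus: "a \<in> int_lattice \<Longrightarrow> - a \<in> int_lattice"
  by (simp add: int_lattice_def)

definition torus_rel :: "real ^ 'n::finite \<Rightarrow> real ^ 'n \<Rightarrow> bool" where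
  "torus_rel x y \<longleftrightarrow> x - y \<in> int_lattice"

lemma torus_rel_sym: "torus_rel x y \<Longrightarrow> torus_rel y x"
  using int_lattice_uminus[of "x - y"] by (simp add: torus_rel_def)

lemma equivp_torus_rel: "equivp (torus_rel :: real ^ 'n::finite \<Rightarrow> real ^ 'n \<Rightarrow> bool)"
proof (rule equivpI)
  show "reflp (torus_rel :: real ^ 'n \<Rightarrow> _)"
    by (simp add: reflp_def torus_rel_def int_lattice_zero)
  show "symp (torus_rel :: real ^ 'n \<Rightarrow> _)"
    by (rule sympI) (rule torus_rel_sym)
  show "transp (torus_rel :: real ^ 'n \<Rightarrow> _)"
  proof (rule transpI)
    fix x y z :: "real ^ 'n" assume "torus_rel x y" "torus_rel y z"
    then show "torus_rel x z"
      using int_lattice_add[of "x - y" "y - z"] by (simp add: torus_rel_def)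
  qed
qed

quotient_type (overloaded) 'n torus = "real ^ 'n::finite" / torus_rel
  morphisms rep_torus torus_proj
  by (rule equivp_torus_rel)

text \<open>The infimum below is a minimum, because the lattice meets every ball in a finite set.\<close>

definition torus_rho :: "real ^ 'n::finite \<Rightarrow> real ^ 'n \<Rightarrow> real" where
  "torus_rho x y = (INF k\<in>int_lattice. norm (x - y - k))"

lemma torus_rho_le: "k \<in> int_lattice \<Longrightarrow> torus_rho x y \<le> norm (x - y - k)"
  unfolding torus_rho_def by (intro cINF_lower bdd_belowI2[where m = 0]) auto

lemma torus_rho_ge: "(\<And>k. k \<in> int_lattice \<Longrightarrow> c \<le> norm (x - y - k)) \<Longrightarrow> c \<le> torus_rho x y"
  unfolding torus_rho_def using int_lattice_zero by (intro cINF_greatest) auto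

lemma torus_rho_approx:
  assumes "e > 0"
  obtains k where "k \<in> int_lattice" "norm (x - y - k) < torus_rho x y + e"
proof -
  have "\<exists>k\<in>int_lattice. norm (x - y - k) < torus_rho x y + e"
  proof (rule ccontr)
    assume "\<not> ?thesis"
    then have "torus_rho x y + e \<le> torus_rho x y"
      by (intro torus_rho_ge) (meson not_le)
    then show False using assms by linarith
  qed
  then show ?thesis using that by blast
qed

lemma torus_rho_cong_le:
  assumes "torus_rel x x'" "torus_rel y y'"
  shows "torus_rho x y \<le> torus_rho x' y'"
proof (rule torus_rho_ge)
  fix k :: "real ^ 'a" assume k: "k \<in> int_lattice"
  have "k + ((x - x') - (y - y')) \<in> int_lattice"
    using assms k unfolding torus_rel_def by (blast intro: int_lattice_add int_lattice_diff)
  from torus_rho_le[OF this, of x y] show "torus_rho x y \<le> norm (x' - y' - k)"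
    by (simp add: algebra_simps)
qed

lemma torus_rho_cong:
  "torus_rel x x' \<Longrightarrow> torus_rel y y' \<Longrightarrow> torus_rho x y = torus_rho x' y'"
  by (meson antisym torus_rho_cong_le torus_rel_sym)

lemma torus_rho_eq_0_iff: "torus_rho x y = 0 \<longleftrightarrow> torus_rel x y"
proof
  assume 0: "torus_rho x y = 0"
  obtain k where k: "k \<in> int_lattice" "norm (x - y - k) < 1 / 2"
    by (rule torus_rho_approx[of "1 / 2" x y]) (simp_all add: 0)
  have "norm (x - y - k) < e" if e: "e > 0" "e \<le> 1 / 2" for e
  proof -
    obtain l where l: "l \<in> int_lattice" "norm (x - y - l) < e"
      by (rule torus_rho_approx[of e x y]) (simp_all add: 0 e)
    have "k $ i = l $ i" for i
    proof -
      have "\<bar>k $ i - l $ i\<bar> = \<bar>(x - y - l) $ i - (x - y - k) $ i\<bar>" by simp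
      also have "\<dots> \<le> norm (x - y - l) + norm (x - y - k)"
        using component_le_norm_cart[of "x - y - l" i] component_le_norm_cart[of "x - y - k" i]
        by linarith
      also have "\<dots> < 1" using k l e by linarith
      finally have "\<bar>k $ i - l $ i\<bar> < 1" .
      moreover have "k $ i - l $ i \<in> \<int>" using k l by (simp add: int_lattice_def)
      ultimately have "k $ i - l $ i = 0" using Ints_nonzero_abs_less1 by blast
      then show ?thesis by simp
    qed
    then have "k = l" by (simp add: vec_eq_iff)
    then show ?thesis using l by simp
  qed
  then have "\<not> 0 < norm (x - y - k)"
    using less_irrefl[of "norm (x - y - k)"] k(2) by (meson less_imp_le)
  then have "x - y = k" by simp
  then show "torus_rel x y" using k by (simp add: torus_rel_def)
next
  assume "torus_rel x y"
  then have "torus_rho x y \<le> 0"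
    using torus_rho_le[of "x - y" x y] by (simp add: torus_rel_def)
  moreover have "0 \<le> torus_rho x y" by (rule torus_rho_ge) simp
  ultimately show "torus_rho x y = 0" by simp
qed

lemma torus_rho_triangle: "torus_rho x y \<le> torus_rho x z + torus_rho y z"
proof (rule field_le_epsilon)
  fix e :: real assume e: "e > 0"
  obtain k where k: "k \<in> int_lattice" "norm (x - z - k) < torus_rho x z + e / 2"
    by (rule torus_rho_approx[of "e / 2" x z]) (use e in simp_all)
  obtain l where l: "l \<in> int_lattice" "norm (y - z - l) < torus_rho y z + e / 2"
    by (rule torus_rho_approx[of "e / 2" y z]) (use e in simp_all)
  have "torus_rho x y \<le> norm (x - y - (k - l))"
    using k l by (intro torus_rho_le int_lattice_diff)
  also have "x - y - (k - l) = (x - z - k) - (y - z - l)" by (simp add: algebra_simps)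
  also have "norm \<dots> \<le> norm (x - z - k) + norm (y - z - l)" by (rule norm_triangle_ineq4)
  finally show "torus_rho x y \<le> torus_rho x z + torus_rho y z + e" using k l by linarith
qed

instantiation torus :: (finite) metric_space
begin

lift_definition dist_torus :: "'a torus \<Rightarrow> 'a torus \<Rightarrow> real" is torus_rho
  by (rule torus_rho_cong)

definition uniformity_torus :: "('a torus \<times> 'a torus) filter" where
  "uniformity_torus = (INF e\<in>{0 <..}. principal {(x, y). dist x y < e})"

definition open_torus :: "'a torus set \<Rightarrow> bool" where
  "open_torus U \<longleftrightarrow> (\<forall>x\<in>U. \<forall>\<^sub>F (x', y) in uniformity. x' = x \<longrightarrow> y \<in> U)"

instance
proof
  show "(dist x y = 0) = (x = y)" for x y :: "'a torus"
    by transfer (rule torus_rho_eq_0_iff)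
  show "dist x y \<le> dist x z + dist y z" for x y z :: "'a torus"
    by transfer (rule torus_rho_triangle)
qed (rule uniformity_torus_def open_torus_def)+

end

definition torus_uniform :: "('n::finite) torus measure" where
  "torus_uniform =
     distr (uniform_measure lborel {x :: real ^ 'n. \<forall>i. 0 \<le> x $ i \<and> x $ i < 1}) borel torus_proj"

definition couplings ::
  "'a::topological_space measure \<Rightarrow> 'a measure \<Rightarrow> ('a \<times> 'a) measure set" where
  "couplings \<mu> \<nu> =
     {\<pi>. prob_space \<pi> \<and> sets \<pi> = sets borel \<and> distr \<pi> borel fst = \<mu> \<and> distr \<pi> borel snd = \<nu>}"

text \<open>The torus is bounded, so the cost is integrable against every coupling.\<close>

definition W2 :: "('n::finite) torus measure \<Rightarrow> 'n torus measure \<Rightarrow> real" where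
  "W2 \<mu> \<nu> = (INF \<pi>\<in>couplings \<mu> \<nu>. sqrt (\<integral>z. (dist (fst z) (snd z))\<^sup>2 \<partial>\<pi>))"

definition empirical_measure :: "nat \<Rightarrow> (nat \<Rightarrow> 'a::topological_space) \<Rightarrow> 'a measure" where
  "empirical_measure n x =
     measure_of UNIV (sets borel)
       (\<lambda>A. (1 / of_nat n) * (\<Sum>k = 1..n. emeasure (return borel (x k)) A))"

text \<open>Only the values on \<open>[0, \<infinity>)\<close> of a Bernstein function are relevant.\<close>

definition bernstein :: "(real \<Rightarrow> real) \<Rightarrow> bool" where
  "bernstein B \<longleftrightarrow>
     continuous_on {0..} B \<and> (\<forall>x\<ge>0. 0 \<le> B x) \<and>
     (\<forall>k. \<forall>x>0. (deriv ^^ k) B differentiable (at x)) \<and>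
     (\<forall>k\<ge>1. \<forall>x>0. 0 \<le> (- 1) ^ (k - 1) * (deriv ^^ k) B x)"

definition bernstein_B :: "(real \<Rightarrow> real) set" where
  "bernstein_B = {B. bernstein B \<and> B 0 = 0 \<and>
     (\<exists>L::ereal. L > 0 \<and> ((\<lambda>x. ereal (deriv B x)) \<longlongrightarrow> L) (at_right 0))}"

definition bernstein_B_alpha :: "real \<Rightarrow> (real \<Rightarrow> real) set" where
  "bernstein_B_alpha \<alpha> =
     {B \<in> bernstein_B. Liminf at_top (\<lambda>x. ereal (x powr (- \<alpha>) * B x)) > 0}"

definition levy_measure :: "real measure \<Rightarrow> bool" where
  "levy_measure \<nu> \<longleftrightarrow>
     sets \<nu> = sets (restrict_space borel {0<..}) \<and>
     (\<forall>K. compact K \<and> K \<subseteq> {0<..} \<longrightarrow> emeasure \<nu> K < \<infinity>) \<and>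
     (\<integral>\<^sup>+ y. ennreal (y / (1 + y)) \<partial>\<nu>) < \<infinity>"

definition levy_khintchine :: "(real \<Rightarrow> real) \<Rightarrow> real \<Rightarrow> real measure \<Rightarrow> bool" where
  "levy_khintchine B b \<nu> \<longleftrightarrow>
     0 \<le> b \<and> levy_measure \<nu> \<and> (\<forall>x\<ge>0. B x = b * x + (\<integral>y. (1 - exp (- x * y)) \<partial>\<nu>))"

text \<open>Processes are indexed by \<^typ>\<open>real\<close>; only times \<open>t \<ge> 0\<close> are ever used.\<close>

definition subordinator :: "'w measure \<Rightarrow> (real \<Rightarrow> real) \<Rightarrow> (real \<Rightarrow> 'w \<Rightarrow> real) \<Rightarrow> bool" where
  "subordinator M B S \<longleftrightarrow>
     (\<forall>t\<ge>0. S t \<in> borel_measurable M \<and> (\<forall>\<omega>\<in>space M. 0 \<le> S t \<omega>)) \<and>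
     (AE \<omega> in M. S 0 \<omega> = 0) \<and>
     (AE \<omega> in M. \<forall>s t. 0 \<le> s \<and> s \<le> t \<longrightarrow> S s \<omega> \<le> S t \<omega>) \<and>
     (\<forall>s\<ge>0. \<forall>h\<ge>0. distr M borel (\<lambda>\<omega>. S (s + h) \<omega> - S s \<omega>) = distr M borel (S h)) \<and>
     (\<forall>n. \<forall>t :: nat \<Rightarrow> real. 0 \<le> t 0 \<and> (\<forall>i<n. t i < t (Suc i)) \<longrightarrow>
        prob_space.indep_vars M (\<lambda>_. borel) (\<lambda>i \<omega>. S (t (Suc i)) \<omega> - S (t i) \<omega>) {..<n}) \<and>
     (\<forall>t\<ge>0. \<forall>x\<ge>0. (\<integral>\<omega>. exp (- x * S t \<omega>) \<partial>M) = exp (- t * B x))"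

text \<open>Gaussian laws may be degenerate (constants).\<close>

definition gaussian :: "'w measure \<Rightarrow> ('w \<Rightarrow> real) \<Rightarrow> bool" where
  "gaussian M Y \<longleftrightarrow> Y \<in> borel_measurable M \<and>
     (\<exists>m. (AE \<omega> in M. Y \<omega> = m) \<or> (\<exists>\<sigma>>0. distributed M lborel Y (normal_density m \<sigma>)))"

definition gaussian_process ::
  "'w measure \<Rightarrow> (real \<Rightarrow> 'w \<Rightarrow> 'a::euclidean_space) \<Rightarrow> bool" where
  "gaussian_process M X \<longleftrightarrow>
     (\<forall>t\<ge>0. X t \<in> borel_measurable M) \<and>
     (\<forall>T a. finite T \<and> T \<subseteq> {0..} \<longrightarrow> gaussian M (\<lambda>\<omega>. \<Sum>t\<in>T. a t \<bullet> X t \<omega>))"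

text \<open>Path continuity cannot be dropped: for a mere modification \<open>X\<close>, the law of the time-changed
  process \<open>X (S t)\<close> is not determined by the finite-dimensional distributions of \<open>X\<close> and \<open>S\<close>.\<close>

definition fractional_brownian_motion ::
  "'w measure \<Rightarrow> real \<Rightarrow> (real \<Rightarrow> 'w \<Rightarrow> real ^ 'n::finite) \<Rightarrow> bool" where
  "fractional_brownian_motion M H X \<longleftrightarrow>
     gaussian_process M X \<and>
     (AE \<omega> in M. continuous_on {0..} (\<lambda>t. X t \<omega>)) \<and>
     (\<forall>t\<ge>0. \<forall>i. (\<integral>\<omega>. X t \<omega> $ i \<partial>M) = 0) \<and>
     (\<forall>s\<ge>0. \<forall>t\<ge>0. \<forall>i j. (\<integral>\<omega>. X s \<omega> $ i * X t \<omega> $ j \<partial>M) =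
        (if i = j then (s powr (2 * H) + t powr (2 * H) - \<bar>t - s\<bar> powr (2 * H)) / 2 else 0))"

definition process_events ::
  "'w measure \<Rightarrow> (real \<Rightarrow> 'w \<Rightarrow> 'a::topological_space) \<Rightarrow> 'w set set" where
  "process_events M X =
     sigma_sets (space M) {X t -` A \<inter> space M | t A. 0 \<le> t \<and> A \<in> sets borel}"

definition torus_subordinated_fbm ::
  "'w measure \<Rightarrow> real \<Rightarrow> (real \<Rightarrow> real) \<Rightarrow> (real \<Rightarrow> 'w \<Rightarrow> ('n::finite) torus) \<Rightarrow> bool" where
  "torus_subordinated_fbm M H B Y \<longleftrightarrow>
     prob_space M \<and>
     (\<exists>(X :: real \<Rightarrow> 'w \<Rightarrow> real ^ 'n) S.
        fractional_brownian_motion M H X \<and> subordinator M B S \<and>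
        prob_space.indep_set M (process_events M X) (process_events M S) \<and>
        (\<forall>t\<ge>0. \<forall>\<omega>\<in>space M. Y t \<omega> = torus_proj (X (S t \<omega>) \<omega>)))"

text \<open>The conditions \<open>d \<le> 2\<close> and \<open>d = 2 + \<alpha> / H\<close> overlap exactly at \<open>d = 2\<close>, \<open>\<alpha> = 0\<close>. There the
  logarithmic rate is the relevant one: for \<open>B x = 1 - exp (- x)\<close> the process is a random walk run
  at Poisson times, for which the two-dimensional matching rate \<open>sqrt (ln t / t)\<close> is sharp.\<close>

definition W2_rate :: "real \<Rightarrow> real \<Rightarrow> real \<Rightarrow> real \<Rightarrow> real \<Rightarrow> real" where
  "W2_rate d H \<alpha> \<beta> t =
     (if d = 2 + \<alpha> / H then max (sqrt (ln t / t)) (t powr (- ((1 + \<beta>) / d)))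
      else if d \<le> 2 then t powr (- (1 / 2))
      else if d < 2 + \<alpha> / H then t powr (- min (1 / 2) ((1 + \<beta>) / d))
      else t powr (- min (1 / (d - \<alpha> / H)) ((1 + \<beta>) / d)))"

end

theory Submission
  imports Defs
begin

text \<open>
  For a measure \<open>\<mu>\<close> on the torus, the squared distance to the uniform distribution is bounded by
  \<open>1 / M\<^sup>2\<close> plus the sum of \<open>\<bar>\<mu>^(k)\<bar>\<^sup>2 / \<bar>k\<bar>\<^sup>2\<close> over the frequencies \<open>k \<noteq> 0\<close> up to \<open>2 M\<close>, up to a constant:
  smoothing by a nonnegative trigonometric kernel of degree \<open>2 M\<close> displaces mass by \<open>O(1 / M)\<close>, and on a
  fine grid the smoothed density is carried to the uniform one by a Markov chain whose jump
  probabilities are flux over mass, for a flux solving the discrete Poisson equation. The energy of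
  the flux is the above sum; the martingale part of the displacement vanishes with the mesh size.

  By path continuity and independence, the mean square of the \<open>k\<close>-th Fourier coefficient of the
  empirical measure is at most \<open>1 / n\<close> plus \<open>2 / n\<close> times the sum over \<open>j\<close> of the expectations of
  \<open>exp (- 2 \<pi>\<^sup>2 \<bar>k\<bar>\<^sup>2 S(j \<tau>)\<^bsup>2 H\<^esup>)\<close>. The Laplace transform of the subordinator makes this
  \<open>O(1 / n + \<bar>k\<bar>\<^bsup>- \<alpha> / H\<^esup> / (n \<tau>))\<close>. Taking \<open>M\<close> as the inverse of the claimed rate concludes.
\<close>

section \<open>Couplings on the torus\<close>

text \<open>The cutoff \<open>M\<close> balances three errors. Smoothing costs 1 / M^2. With n of
  order t^(1 + \<beta>) and n \<tau> of order t, the frequency sum splits into a part of order M^(d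
  - 2) / n and a part of order M^(d - 2 - \<alpha> / H) / t, where a zero exponent means a logarithm
  and a negative one a bounded sum. Equating them with 1 / M^2 gives the exponents (1 + \<beta>) / d
  and 1 / (d - \<alpha> / H); a bounded second sum gives 1 / 2. The logarithm of the first sum at d
  = 2 is absorbed, because n exceeds t by a factor t^\<beta>. The obstacle is that the smoothed
  density may vanish, so flux over mass has no a priori bound. Along the interpolation the mass is
  bounded below by the share of the uniform density, and a starting share of 1 / M^2 is inserted at
  once, at no greater cost than the smoothing. The whole coupling is finite: a finite chain on a
  finite grid, with constants free of the mesh size, so no limit in the mesh is taken.\<close>

lemma dist_torus_proj: "dist (torus_proj x) (torus_proj y) = torus_rho x y"
  by (simp add: dist_torus.abs_eq)

lemma dist_torus_proj_le: "dist (torus_proj x) (torus_proj y) \<le> norm (x - y)"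
  using torus_rho_le[OF int_lattice_zero, of x y] by (simp add: dist_torus_proj)

lemma torus_proj_eqI: "x - y \<in> int_lattice \<Longrightarrow> torus_proj x = torus_proj y"
  by (simp add: torus.abs_eq_iff torus_rel_def)

lemma continuous_on_torus_proj: "continuous_on S torus_proj"
  unfolding continuous_on_iff
  by (metis dist_norm dist_torus_proj_le le_less_trans)

lemma borel_measurable_torus_proj [measurable]: "torus_proj \<in> borel_measurable borel"
  by (intro borel_measurable_continuous_onI continuous_on_torus_proj)

text \<open>Since \<open>W2\<close> is an infimum, one coupling suffices, and it may live on any
  probability space as a pair of lifts. The majorant \<open>h\<close> is asked for almost everywhere
  only, which suits points that lie in a cell almost surely.\<close>

lemma W2_le:
  fixes x z :: "'b \<Rightarrow> real ^ 'n::finite"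
  assumes "prob_space P" and [measurable]: "x \<in> borel_measurable P" "z \<in> borel_measurable P"
    and \<mu>: "distr P borel (\<lambda>w. torus_proj (x w)) = \<mu>"
    and \<nu>: "distr P borel (\<lambda>w. torus_proj (z w)) = \<nu>"
    and h: "integrable P h" "AE w in P. (dist (torus_proj (x w)) (torus_proj (z w)))\<^sup>2 \<le> h w"
    and c: "(\<integral>w. h w \<partial>P) \<le> c"
  shows "W2 \<mu> \<nu> \<le> sqrt c"
proof -
  \<comment> \<open>The pair of torus points is a continuous image of the pair of lifts, hence Borel
    for the product topology. This avoids comparing the Borel and the product sigma-algebra on pairs
    of torus points.\<close>
  define T :: "(real ^ 'n) \<times> (real ^ 'n) \<Rightarrow> 'n torus \<times> 'n torus"
    where "T = (\<lambda>p. (torus_proj (fst p), torus_proj (snd p)))"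
  have contT: "continuous_on UNIV T"
    unfolding T_def
    by (intro continuous_on_Pair continuous_on_compose2[OF continuous_on_torus_proj[of UNIV]]
          continuous_intros) auto
  then have [measurable]: "T \<in> borel_measurable borel"
    by (rule borel_measurable_continuous_onI)
  define g where "g = (\<lambda>w. T (x w, z w))"
  have [measurable]: "g \<in> borel_measurable P"
    unfolding g_def by measurable
  have contd: "continuous_on UNIV (\<lambda>p. (dist (fst p) (snd p :: 'n torus))\<^sup>2)"
    by (intro continuous_intros)
  then have [measurable]: "(\<lambda>p. (dist (fst p) (snd p :: 'n torus))\<^sup>2) \<in> borel_measurable borel"
    by (rule borel_measurable_continuous_onI)
  have [measurable]: "fst \<in> borel_measurable (borel :: ('n torus \<times> 'n torus) measure)"
    "snd \<in> borel_measurable (borel :: ('n torus \<times> 'n torus) measure)"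
    by (intro borel_measurable_continuous_onI continuous_intros)+
  let ?\<pi> = "distr P borel g"
  interpret P: prob_space P by fact
  have "?\<pi> \<in> couplings \<mu> \<nu>"
  proof -
    have "distr ?\<pi> borel fst = \<mu>" "distr ?\<pi> borel snd = \<nu>"
      using \<mu> \<nu> by (simp_all add: distr_distr comp_def) (simp_all add: g_def T_def)
    moreover have "prob_space ?\<pi>" by (rule P.prob_space_distr) measurable
    ultimately show ?thesis by (simp add: couplings_def)
  qed
  then have "W2 \<mu> \<nu> \<le> sqrt (\<integral>p. (dist (fst p) (snd p))\<^sup>2 \<partial>?\<pi>)"
    unfolding W2_def by (intro cINF_lower bdd_belowI2[where m = 0]) auto
  also have "(\<integral>p. (dist (fst p) (snd p))\<^sup>2 \<partial>?\<pi>)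
      = (\<integral>w. (dist (torus_proj (x w)) (torus_proj (z w)))\<^sup>2 \<partial>P)"
    by (subst integral_distr) (measurable, simp add: g_def T_def)
  also have "\<dots> \<le> (\<integral>w. h w \<partial>P)"
  proof (rule integral_mono_AE[OF _ h])
    have "(\<lambda>w. (\<lambda>p. (dist (fst p) (snd p))\<^sup>2) (g w)) \<in> borel_measurable P" by measurable
    then have "(\<lambda>w. (dist (torus_proj (x w)) (torus_proj (z w)))\<^sup>2) \<in> borel_measurable P"
      by (simp add: g_def T_def)
    then show "integrable P (\<lambda>w. (dist (torus_proj (x w)) (torus_proj (z w)))\<^sup>2)"
      by (rule Bochner_Integration.integrable_bound[OF h(1)]) (use h(2) in eventually_elim, simp)
  qed
  finally show ?thesis using c by (meson order_trans real_sqrt_le_mono)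
qed

text \<open>The coupling is built from a random index, so the averaged point masses are recast as
  the law of a uniformly chosen sample.\<close>

lemma empirical_measure_eq_distr:
  fixes x :: "nat \<Rightarrow> 'a::topological_space"
  assumes "n \<ge> 1"
  shows "empirical_measure n x = distr (measure_pmf (pmf_of_set {1..n})) borel x"
proof -
  let ?D = "distr (measure_pmf (pmf_of_set {1..n})) borel x"
  have eq: "(1 / of_nat n) * (\<Sum>k = 1..n. emeasure (return borel (x k)) A) = emeasure ?D A"
    if A: "A \<in> sets borel" for A
  proof -
    have "emeasure ?D A = emeasure (measure_pmf (pmf_of_set {1..n})) (x -` A)"
      using A by (simp add: emeasure_distr)
    also have "\<dots> = ennreal (real (card ({1..n} \<inter> x -` A)) / real n)"
      using assms by (simp add: emeasure_pmf_of_set)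
    also have "real (card ({1..n} \<inter> x -` A)) = (\<Sum>k=1..n. indicator A (x k))"
      by (simp add: indicator_def sum.If_cases Int_def vimage_def)
    also have "ennreal ((\<Sum>k=1..n. indicator A (x k)) / real n)
       = (1 / of_nat n) * (\<Sum>k=1..n. ennreal (indicator A (x k)))"
      using assms
      by (simp add: divide_ennreal[symmetric] sum_nonneg ennreal_of_nat_eq_real_of_nat
          sum_ennreal[symmetric] ennreal_times_divide mult.commute[of _ "sum _ _"] del: sum_ennreal)
    also have "(\<Sum>k=1..n. ennreal (indicator A (x k))) = (\<Sum>k = 1..n. emeasure (return borel (x k)) A)"
      using A by (intro sum.cong) (auto simp: indicator_def)
    finally show ?thesis by simp
  qed
  have "empirical_measure n x = measure_of UNIV (sets borel) (emeasure ?D)"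
    unfolding empirical_measure_def
    by (rule measure_of_eq) (simp, rule eq, use sets.sigma_sets_eq[of "borel :: 'a measure"] in simp)
  also have "\<dots> = ?D"
    using measure_of_of_measure[of ?D] by simp
  finally show ?thesis .
qed

section \<open>Trigonometric majorants of the torus distance\<close>

lemma Jordan_sin_ge:
  assumes "0 \<le> x" "x \<le> pi / 2"
  shows "2 * x / pi \<le> sin x"
proof -
  have "convex_on {0..pi/2} (\<lambda>x. - sin x)"
    by (rule f''_ge0_imp_convex[where f' = "\<lambda>x. - cos x" and f'' = sin])
      (auto intro!: derivative_eq_intros sin_ge_zero)
  from convex_onD[OF this, of "2 * x / pi" 0 "pi / 2"] assms show ?thesis
    by (simp add: field_simps)
qed

text \<open>The half-angle formula 1 - cos (2 \<pi> x) = 2 sin^2 (\<pi> x) combined with the chord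
  bound for sine. It serves twice: for the transport cost and for the symbol of the discrete
  Laplacian.\<close>

lemma one_minus_cos_ge:
  assumes "\<bar>x\<bar> \<le> 1 / 2"
  shows "8 * x\<^sup>2 \<le> 1 - cos (2 * pi * x)"
proof -
  have "2 * \<bar>x\<bar> \<le> sin (pi * \<bar>x\<bar>)"
    using Jordan_sin_ge[of "pi * \<bar>x\<bar>"] assms by (simp add: field_simps)
  then have "(2 * \<bar>x\<bar>)\<^sup>2 \<le> (sin (pi * \<bar>x\<bar>))\<^sup>2" by (intro power_mono) auto
  also have "(sin (pi * \<bar>x\<bar>))\<^sup>2 = (sin (pi * x))\<^sup>2" by (cases "x \<ge> 0") auto
  finally have "4 * x\<^sup>2 \<le> (sin (pi * x))\<^sup>2" by (simp add: power_mult_distrib)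
  then show ?thesis using cos_double_sin[of "pi * x"] by (simp add: mult.assoc)
qed

text \<open>The majorant is a trigonometric polynomial of degree one, so averaging it against a
  smoothing kernel involves only the coefficients of order 0 and 1. Rounding each coordinate
  difference selects the lattice vector.\<close>

lemma dist_torus_proj_sq_le_cos:
  fixes x y :: "real ^ 'n::finite"
  shows "(dist (torus_proj x) (torus_proj y))\<^sup>2 \<le> (\<Sum>i\<in>UNIV. (1 - cos (2 * pi * (x $ i - y $ i))) / 8)"
proof -
  define k :: "real ^ 'n" where "k = (\<chi> i. of_int (round (x $ i - y $ i)))"
  have "dist (torus_proj x) (torus_proj y) \<le> norm (x - y - k)"
    unfolding dist_torus_proj by (rule torus_rho_le) (simp add: k_def int_lattice_def)
  then have "(dist (torus_proj x) (torus_proj y))\<^sup>2 \<le> (norm (x - y - k))\<^sup>2"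
    by (intro power_mono) auto
  also have "\<dots> = (\<Sum>i\<in>UNIV. (x $ i - y $ i - of_int (round (x $ i - y $ i)))\<^sup>2)"
    by (simp add: norm_vec_def L2_set_def sum_nonneg k_def)
  also have "\<dots> \<le> (\<Sum>i\<in>UNIV. (1 - cos (2 * pi * (x $ i - y $ i))) / 8)"
  proof (rule sum_mono)
    fix i
    let ?z = "x $ i - y $ i"
    have "\<bar>?z - of_int (round ?z)\<bar> \<le> 1 / 2"
      using of_int_round_abs_le[of ?z] by (simp add: abs_minus_commute)
    from one_minus_cos_ge[OF this] have "8 * (?z - of_int (round ?z))\<^sup>2
        \<le> 1 - cos (2 * pi * ?z - of_int (round ?z) * (2 * pi))"
      by (simp add: algebra_simps)
    also have "cos (2 * pi * ?z - of_int (round ?z) * (2 * pi)) = cos (2 * pi * ?z)"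
      using cos_int_2pin[of "round ?z"] sin_int_2pin[of "round ?z"] by (simp add: cos_diff mult.commute)
    finally show "(?z - of_int (round ?z))\<^sup>2 \<le> (1 - cos (2 * pi * ?z)) / 8" by simp
  qed
  finally show ?thesis .
qed

lemma ex_pmf_of_weights:
  assumes "finite A" "\<And>a. a \<in> A \<Longrightarrow> 0 \<le> w a" "sum w A = 1"
  shows "\<exists>p. set_pmf p \<subseteq> A \<and> (\<forall>a\<in>A. pmf p a = (w a :: real))"
proof -
  define v where "v = (\<lambda>a. if a \<in> A then w a else 0)"
  have nn: "\<And>a. 0 \<le> v a" using assms by (simp add: v_def)
  have "(\<integral>\<^sup>+x. ennreal (v x) \<partial>count_space UNIV) = (\<integral>\<^sup>+x. ennreal (v x) * indicator A x \<partial>count_space UNIV)"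
    by (intro nn_integral_cong) (auto simp: v_def)
  also have "\<dots> = (\<Sum>a\<in>A. ennreal (v a))"
    using assms(1) by (simp add: nn_integral_count_space_indicator[symmetric] nn_integral_count_space_finite)
  also have "\<dots> = ennreal (sum v A)" using nn by simp
  also have "sum v A = 1" using assms(3) by (simp add: v_def)
  finally have "(\<integral>\<^sup>+x. ennreal (v x) \<partial>count_space UNIV) = 1" by simp
  then have pmf: "pmf (embed_pmf v) a = v a" for a
    using nn by (intro pmf_embed_pmf) auto
  show ?thesis
    by (rule exI[of _ "embed_pmf v"]) (auto simp: pmf set_pmf_iff, auto simp: v_def split: if_splits)
qed

section \<open>A Markov chain driven by a flux\<close>


definition shift :: "'n \<times> bool \<Rightarrow> ('n \<Rightarrow> int) \<Rightarrow> 'n \<Rightarrow> int" where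
  "shift s g = g(fst s := g (fst s) + (if snd s then 1 else - 1))"

definition grid :: "nat \<Rightarrow> ('n \<Rightarrow> int) set" where
  "grid N = {g. \<forall>i. 0 \<le> g i \<and> g i < int N}"

text \<open>Points of the grid torus are lifted to integer vectors, so that displacements make sense; the
  law of a random point modulo \<open>N\<close> is recorded through its integrals of periodic functions.\<close>

definition periodic :: "nat \<Rightarrow> (('n \<Rightarrow> int) \<Rightarrow> 'b) \<Rightarrow> bool" where
  "periodic N \<psi> \<longleftrightarrow> (\<forall>g i m. \<psi> (g(i := g i + int N * m)) = \<psi> g)"

lemma grid_eq_PiE: "grid N = PiE UNIV (\<lambda>_. {0..<int N})"
  by (auto simp: grid_def PiE_def)

lemma finite_grid: "finite (grid N :: ('n::finite \<Rightarrow> int) set)"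
  unfolding grid_eq_PiE by (intro finite_PiE) auto

lemma card_grid: "card (grid N :: ('n::finite \<Rightarrow> int) set) = N ^ CARD('n)"
  unfolding grid_eq_PiE by (subst card_PiE) auto

lemma periodic_mod:
  fixes \<psi> :: "('n::finite \<Rightarrow> int) \<Rightarrow> 'b"
  assumes "periodic N \<psi>"
  shows "\<psi> (\<lambda>i. g i mod int N) = \<psi> g"
proof -
  \<comment> \<open>\<open>periodic\<close> alters a single coordinate, hence the induction over the
    set \<open>I\<close> of coordinates already reduced.\<close>
  have "\<psi> (\<lambda>i. if i \<in> I then g i mod int N else g i) = \<psi> g" if "finite I" for I
    using that
  proof (induction I)
    case (insert j I)
    let ?h = "\<lambda>i. if i \<in> I then g i mod int N else g i"
    have \<psi>: "\<psi> (?h(j := ?h j + int N * (- (g j div int N)))) = \<psi> ?h"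
      using assms unfolding periodic_def by blast
    have eq: "(\<lambda>i. if i \<in> insert j I then g i mod int N else g i) = ?h(j := ?h j + int N * (- (g j div int N)))"
      using insert(2) by (auto simp: fun_eq_iff minus_div_mult_eq_mod[symmetric] mult.commute)
    show ?case unfolding eq \<psi> by (rule insert.IH)
  qed simp
  from this[OF finite[of UNIV]] show ?thesis by simp
qed

text \<open>Translation invariance on the discrete torus, which takes the place of integration by
  parts. A shift followed by reduction modulo \<open>N\<close> permutes the grid, with the opposite
  shift as inverse.\<close>

lemma sum_grid_shift:
  fixes \<psi> :: "('n::finite \<Rightarrow> int) \<Rightarrow> 'b::comm_monoid_add"
  assumes N: "N > 0" and p: "periodic N \<psi>"
  shows "(\<Sum>g\<in>grid N. \<psi> (shift s g)) = (\<Sum>g\<in>grid N. \<psi> g)"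
proof -
  let ?\<sigma> = "\<lambda>s g i. shift s g i mod int N"
  have inv: "?\<sigma> (i, \<not> b) (?\<sigma> (i, b) g) = g" if "g \<in> grid N" for g :: "'n \<Rightarrow> int" and i b
    using that by (auto simp: shift_def grid_def fun_eq_iff mod_simps)
  obtain i b where s: "s = (i, b)" by force
  have "(\<Sum>g\<in>grid N. \<psi> (?\<sigma> s g)) = (\<Sum>g\<in>grid N. \<psi> g)"
    by (rule sum.reindex_bij_witness[where i = "?\<sigma> (i, \<not> b)" and j = "?\<sigma> s"])
      (use N inv[of _ i b] inv[of _ i "\<not> b"] in \<open>auto simp: s grid_def\<close>)
  then show ?thesis using periodic_mod[OF p] by simp
qed

text \<open>Here \<open>J i x\<close> is the net mass sent from \<open>x\<close> to \<open>x + e\<^sub>i\<close>, so the chain jumps along an edge with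
  probability flux over mass. The term with \<open>\<bar>J i x\<bar>\<close> is the variance of the jumps; it carries one power
  of the mesh size more than the others.\<close>

lemma ex_chain_step:
  fixes \<pi> :: "('a \<times> ('n::finite \<Rightarrow> int)) pmf" and G :: "'a \<Rightarrow> 'n \<Rightarrow> int"
    and \<rho> :: "('n \<Rightarrow> int) \<Rightarrow> real" and J :: "'n \<Rightarrow> ('n \<Rightarrow> int) \<Rightarrow> real"
  assumes N: "N > 0" and fin: "finite (set_pmf \<pi>)"
    and law: "\<And>\<psi>. periodic N \<psi> \<Longrightarrow> (\<integral>p. \<psi> (snd p) \<partial>\<pi>) = (\<Sum>x\<in>grid N. \<rho> x * \<psi> x)"
    and per: "periodic N \<rho>" "\<And>i. periodic N (J i)"
    and r: "r > 0" "\<And>x. r \<le> \<rho> x"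
    and J: "\<And>i x. \<bar>J i x\<bar> \<le> c" "2 * real CARD('n) * c \<le> r"
    and \<theta>: "\<theta> > 0"
  obtains \<pi>' where "finite (set_pmf \<pi>')" "map_pmf fst \<pi>' = map_pmf fst \<pi>"
    "\<And>\<psi>. periodic N \<psi> \<Longrightarrow> (\<integral>p. \<psi> (snd p) \<partial>\<pi>') =
        (\<Sum>x\<in>grid N. (\<rho> x - (\<Sum>i\<in>UNIV. J i x - J i (shift (i, False) x))) * \<psi> x)"
    "(\<integral>p. (\<Sum>i\<in>UNIV. real_of_int (snd p i - G (fst p) i)^2) \<partial>\<pi>')
      \<le> (1 + \<theta>) * (\<integral>p. (\<Sum>i\<in>UNIV. real_of_int (snd p i - G (fst p) i)^2) \<partial>\<pi>)
        + (\<Sum>x\<in>grid N. \<Sum>i\<in>UNIV. (J i x)\<^sup>2) / (\<theta> * r) + (\<Sum>x\<in>grid N. \<Sum>i\<in>UNIV. \<bar>J i x\<bar>)"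
proof -
  have c0: "c \<ge> 0" using J(1) by (meson abs_ge_zero order_trans)
  \<comment> \<open>Traffic on each edge is one-way: the positive part of \<open>J\<close> jumps
    forward from the lower endpoint, the negative part jumps backward from the upper one. A backward
    jump from \<open>x\<close> therefore looks at the edge based at
    \<open>shift (i, False) x\<close>.\<close>
  define q :: "('n \<Rightarrow> int) \<Rightarrow> 'n \<times> bool \<Rightarrow> real" where
    "q x s = (if snd s then max 0 (J (fst s) x) else max 0 (- J (fst s) (shift (fst s, False) x))) / \<rho> x" for x s
  have \<rho>0: "\<rho> x > 0" for x using r by (meson less_le_trans)
  have q0: "0 \<le> q x s" for x s using \<rho>0[of x] by (simp add: q_def)
  have sumq: "(\<Sum>s\<in>UNIV. q x s) \<le> 1" for x
  proof -
    have "q x s \<le> c / r" for s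
      unfolding q_def using r c0 J(1)[of "fst s" x] J(1)[of "fst s" "shift (fst s, False) x"] \<rho>0[of x]
      by (intro frac_le) (auto simp: max_def abs_le_iff)
    then have "(\<Sum>s\<in>UNIV. q x s) \<le> (\<Sum>s\<in>(UNIV :: ('n \<times> bool) set). c / r)" by (intro sum_mono)
    also have "\<dots> \<le> 1" using J(2) r by (simp add: field_simps card_prod)
    finally show ?thesis .
  qed
  \<comment> \<open>\<open>None\<close> stands for staying put and takes the remaining probability,
    nonnegative by \<open>sumq\<close>.\<close>
  define w where "w x = case_option (1 - (\<Sum>s\<in>UNIV. q x s)) (q x)" for x
  have UO: "(\<Sum>s\<in>UNIV. f s) = f None + (\<Sum>s\<in>UNIV. f (Some s))" for f :: "('n \<times> bool) option \<Rightarrow> real"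
    unfolding UNIV_option_conv by (subst sum.insert) (auto simp: sum.reindex)
  have "\<exists>p. \<forall>s. pmf p s = w x s" for x
    using ex_pmf_of_weights[of UNIV "w x"] sumq[of x] q0
    by (auto simp: UO w_def split: option.splits)
  then obtain Kr where Kr: "\<And>x s. pmf (Kr x) s = w x s" by metis
  define mv where "mv = (\<lambda>s g. case s of None \<Rightarrow> g | Some t \<Rightarrow> shift t (g :: 'n \<Rightarrow> int))"
  define \<pi>' where "\<pi>' = bind_pmf \<pi> (\<lambda>p. map_pmf (\<lambda>s. (fst p, mv s (snd p))) (Kr (snd p)))"
  \<comment> \<open>The kernel in generator form; both the new law and the growth of the
    displacement follow from this identity. The label \<open>fst p\<close> never changes.\<close>
  have E: "(\<integral>p. h p \<partial>\<pi>') = (\<integral>p. h p + (\<Sum>s\<in>UNIV. q (snd p) s * (h (fst p, shift s (snd p)) - h p)) \<partial>\<pi>)"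
    for h :: "_ \<Rightarrow> real"
  proof -
    have "(\<integral>p. h p \<partial>\<pi>') = (\<Sum>a\<in>set_pmf \<pi>. pmf \<pi> a *\<^sub>R (\<integral>p. h p \<partial>(map_pmf (\<lambda>s. (fst a, mv s (snd a))) (Kr (snd a)))))"
      unfolding \<pi>'_def using fin by (intro pmf_expectation_bind) auto
    also have "\<dots> = (\<Sum>a\<in>set_pmf \<pi>. pmf \<pi> a *\<^sub>R (h a + (\<Sum>s\<in>UNIV. q (snd a) s * (h (fst a, shift s (snd a)) - h a))))"
    proof (intro sum.cong refl arg_cong2[where f = scaleR])
      fix a
      have "(\<integral>p. h p \<partial>(map_pmf (\<lambda>s. (fst a, mv s (snd a))) (Kr (snd a))))
          = (\<integral>s. h (fst a, mv s (snd a)) \<partial>(Kr (snd a)))" by simp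
      also have "\<dots> = (\<Sum>s\<in>UNIV. h (fst a, mv s (snd a)) * w (snd a) s)"
        by (subst integral_measure_pmf_real[of UNIV]) (auto simp: Kr)
      also have "\<dots> = h a + (\<Sum>s\<in>UNIV. q (snd a) s * (h (fst a, shift s (snd a)) - h a))"
        by (simp add: UO w_def mv_def algebra_simps sum_subtractf sum_distrib_left)
      finally show "(\<integral>p. h p \<partial>(map_pmf (\<lambda>s. (fst a, mv s (snd a))) (Kr (snd a)))) = \<dots>" .
    qed
    also have "\<dots> = (\<integral>p. h p + (\<Sum>s\<in>UNIV. q (snd p) s * (h (fst p, shift s (snd p)) - h p)) \<partial>\<pi>)"
      by (subst integral_measure_pmf_real[OF fin]) (auto simp: mult.commute)
    finally show ?thesis .
  qed
  have sumNB: "(\<Sum>s\<in>UNIV. f s) = (\<Sum>i\<in>UNIV. f (i, True) + f (i, False))" for f :: "'n \<times> bool \<Rightarrow> real"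
  proof -
    have "(\<Sum>s\<in>UNIV. f s) = (\<Sum>i\<in>UNIV. \<Sum>b\<in>UNIV. f (i, b))"
      by (simp add: sum.cartesian_product)
    then show ?thesis by (simp add: UNIV_bool add.commute)
  qed
  have perc: "periodic N (\<lambda>x. f (shift s x))" if "periodic N f" for f :: "_ \<Rightarrow> real" and s
  proof -
    have "shift s (g(j := g j + int N * m)) = (shift s g)(j := shift s g j + int N * m)" for g j m
      by (auto simp: shift_def fun_eq_iff)
    with that show ?thesis by (simp add: periodic_def)
  qed
  have perq: "periodic N (\<lambda>x. q x s)" for s
    using perc[OF per(2), of "fst s" "(fst s, False)"] per unfolding periodic_def q_def by simp
  have \<rho>q: "\<rho> x * q x (i, True) = max 0 (J i x)"
    "\<rho> x * q x (i, False) = max 0 (- J i (shift (i, False) x))" for x i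
    using \<rho>0[of x] by (auto simp: q_def)
  have shinv: "shift (i, False) (shift (i, True) x) = x" "shift (i, True) (shift (i, False) x) = x" for i and x :: "'n \<Rightarrow> int"
    by (auto simp: shift_def)
  show ?thesis
  proof (rule that[of \<pi>'])
    show "finite (set_pmf \<pi>')" using fin by (auto simp: \<pi>'_def)
    show "map_pmf fst \<pi>' = map_pmf fst \<pi>"
      by (simp add: \<pi>'_def map_bind_pmf map_pmf_comp map_pmf_def[symmetric] map_pmf_const bind_return_pmf')
  next
    fix \<psi> :: "('n \<Rightarrow> int) \<Rightarrow> real" assume \<psi>: "periodic N \<psi>"
    show "(\<integral>p. \<psi> (snd p) \<partial>\<pi>') =
        (\<Sum>x\<in>grid N. (\<rho> x - (\<Sum>i\<in>UNIV. J i x - J i (shift (i, False) x))) * \<psi> x)"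
    proof -
      let ?\<chi> = "\<lambda>x. \<psi> x + (\<Sum>s\<in>UNIV. q x s * (\<psi> (shift s x) - \<psi> x))"
      \<comment> \<open>The law of \<open>snd p\<close> under \<open>\<pi>\<close> is known against
        periodic functions only, so the one-step average of \<open>\<psi>\<close> has to be periodic
        as well.\<close>
      have "periodic N ?\<chi>"
        using \<psi> perq perc[OF \<psi>] unfolding periodic_def by (auto intro!: sum.cong)
      then have "(\<integral>p. \<psi> (snd p) \<partial>\<pi>') = (\<Sum>x\<in>grid N. \<rho> x * ?\<chi> x)"
        using law by (simp add: E)
      also have "\<dots> = (\<Sum>x\<in>grid N. \<rho> x * \<psi> x + (\<Sum>i\<in>UNIV. max 0 (J i x) * (\<psi> (shift (i, True) x) - \<psi> x)
          + max 0 (- J i (shift (i, False) x)) * (\<psi> (shift (i, False) x) - \<psi> x)))"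
        by (simp add: distrib_left sumNB sum_distrib_left \<rho>q[symmetric] mult.assoc)
      also have "\<dots> = (\<Sum>x\<in>grid N. \<rho> x * \<psi> x) + (\<Sum>x\<in>grid N. \<Sum>i\<in>UNIV.
          max 0 (J i x) * (\<psi> (shift (i, True) x) - \<psi> x) +
          max 0 (- J i (shift (i, False) x)) * (\<psi> (shift (i, False) x) - \<psi> x))"
        by (rule sum.distrib)
      also have "(\<Sum>x\<in>grid N. \<Sum>i\<in>UNIV. max 0 (J i x) * (\<psi> (shift (i, True) x) - \<psi> x) +
          max 0 (- J i (shift (i, False) x)) * (\<psi> (shift (i, False) x) - \<psi> x))
        = (\<Sum>i\<in>UNIV. \<Sum>x\<in>grid N. max 0 (J i x) * (\<psi> (shift (i, True) x) - \<psi> x) +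
          max 0 (- J i (shift (i, False) x)) * (\<psi> (shift (i, False) x) - \<psi> x))"
        by (rule sum.swap)
      also have "\<dots> = (\<Sum>i\<in>UNIV. (\<Sum>x\<in>grid N. max 0 (J i x) * (\<psi> (shift (i, True) x) - \<psi> x)) +
          (\<Sum>x\<in>grid N. max 0 (- J i (shift (i, False) x)) * (\<psi> (shift (i, False) x) - \<psi> x)))"
        by (simp only: sum.distrib)
      also have "(\<lambda>i. (\<Sum>x\<in>grid N. max 0 (J i x) * (\<psi> (shift (i, True) x) - \<psi> x)) +
          (\<Sum>x\<in>grid N. max 0 (- J i (shift (i, False) x)) * (\<psi> (shift (i, False) x) - \<psi> x)))
         = (\<lambda>i. \<Sum>x\<in>grid N. (J i (shift (i, False) x) - J i x) * \<psi> x)"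
      proof
        fix i
        \<comment> \<open>Backward jumps are reindexed by the lower endpoint of their edge, where
          they meet the forward jumps; the two one-way flows then recombine to
          \<open>J\<close>.\<close>
        have "periodic N (\<lambda>y. max 0 (- J i y) * (\<psi> y - \<psi> (shift (i, True) y)))"
          using per(2)[of i] \<psi> perc[OF \<psi>, of "(i, True)"] unfolding periodic_def by simp
        from sum_grid_shift[OF N this, of "(i, False)"]
        have 1: "(\<Sum>x\<in>grid N. max 0 (- J i (shift (i, False) x)) * (\<psi> (shift (i, False) x) - \<psi> x))
            = (\<Sum>x\<in>grid N. max 0 (- J i x) * (\<psi> x - \<psi> (shift (i, True) x)))"
          by (simp add: shinv)
        have "periodic N (\<lambda>y. J i y * \<psi> (shift (i, True) y))"
          using per(2)[of i] \<psi> perc[OF \<psi>, of "(i, True)"] unfolding periodic_def by simp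
        from sum_grid_shift[OF N this, of "(i, False)"]
        have 2: "(\<Sum>x\<in>grid N. J i (shift (i, False) x) * \<psi> x) = (\<Sum>x\<in>grid N. J i x * \<psi> (shift (i, True) x))"
          by (simp add: shinv)
        have 3: "max 0 (J i x) * (\<psi> (shift (i, True) x) - \<psi> x) + max 0 (- J i x) * (\<psi> x - \<psi> (shift (i, True) x))
          = J i x * \<psi> (shift (i, True) x) - J i x * \<psi> x" for x
          by (auto simp: max_def algebra_simps)
        show "(\<Sum>x\<in>grid N. max 0 (J i x) * (\<psi> (shift (i, True) x) - \<psi> x)) +
          (\<Sum>x\<in>grid N. max 0 (- J i (shift (i, False) x)) * (\<psi> (shift (i, False) x) - \<psi> x))
           = (\<Sum>x\<in>grid N. (J i (shift (i, False) x) - J i x) * \<psi> x)"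
          unfolding 1 sum.distrib[symmetric] 3 left_diff_distrib sum_subtractf 2 ..
      qed
      also have "(\<Sum>x\<in>grid N. \<rho> x * \<psi> x) + (\<Sum>i\<in>UNIV. \<Sum>x\<in>grid N. (J i (shift (i, False) x) - J i x) * \<psi> x)
         = (\<Sum>x\<in>grid N. (\<rho> x - (\<Sum>i\<in>UNIV. J i x - J i (shift (i, False) x))) * \<psi> x)"
        by (subst sum.swap) (simp add: left_diff_distrib sum_distrib_right sum_subtractf)
      finally show ?thesis .
    qed
  next
    define h where "h = (\<lambda>p :: 'a \<times> ('n \<Rightarrow> int). \<Sum>i\<in>UNIV. real_of_int (snd p i - G (fst p) i)^2)"
    let ?\<chi> = "\<lambda>x. \<Sum>i\<in>UNIV. ((q x (i, True))\<^sup>2 + (q x (i, False))\<^sup>2) / \<theta> + (q x (i, True) + q x (i, False))"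
    have per\<chi>: "periodic N ?\<chi>"
      using perq unfolding periodic_def by simp
    \<comment> \<open>A unit step changes one squared difference D^2 by 2 D or - 2 D, plus 1. The
      linear term is the drift; the added 1 becomes the variance of the jumps.\<close>
    have hs: "h (fst p, shift (i, b) (snd p)) - h p = (if b then 2 else -2) * real_of_int (snd p i - G (fst p) i) + 1"
      for p i b
      unfolding h_def
      by (subst (1 2) sum.remove[of UNIV i]) (auto simp: shift_def power2_eq_square algebra_simps)
    have le: "h p + (\<Sum>s\<in>UNIV. q (snd p) s * (h (fst p, shift s (snd p)) - h p))
        \<le> (1 + \<theta>) * h p + ?\<chi> (snd p)" for p
    proof -
      have "(\<Sum>s\<in>UNIV. q (snd p) s * (h (fst p, shift s (snd p)) - h p))
        = (\<Sum>i\<in>UNIV. 2 * real_of_int (snd p i - G (fst p) i) * (q (snd p) (i, True) - q (snd p) (i, False))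
            + (q (snd p) (i, True) + q (snd p) (i, False)))"
        unfolding sumNB hs by (simp add: algebra_simps)
      also have "\<dots> \<le> (\<Sum>i\<in>UNIV. \<theta> * real_of_int (snd p i - G (fst p) i)^2 + 
          (((q (snd p) (i, True))\<^sup>2 + (q (snd p) (i, False))\<^sup>2) / \<theta> + (q (snd p) (i, True) + q (snd p) (i, False))))"
      proof (intro sum_mono)
        fix i
        define D where "D = real_of_int (snd p i - G (fst p) i)"
        define a where "a = q (snd p) (i, True)"
        define b where "b = q (snd p) (i, False)"
        have ab: "a \<ge> 0" "b \<ge> 0" using q0 by (auto simp: a_def b_def)
        \<comment> \<open>Young's inequality with weight \<open>\<theta>\<close>: its D^2 part
          enlarges the factor of the old displacement to 1 + \<theta>.\<close>
        have "2 * D * (a - b) \<le> \<theta> * D\<^sup>2 + (a - b)\<^sup>2 / \<theta>"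
        proof -
          have "0 \<le> (\<theta> * D - (a - b))\<^sup>2 / \<theta>" using \<theta> by simp
          also have "\<dots> = \<theta> * D\<^sup>2 + (a - b)\<^sup>2 / \<theta> - 2 * D * (a - b)"
            using \<theta> by (simp add: power2_eq_square field_simps)
          finally show ?thesis by simp
        qed
        also have "(a - b)\<^sup>2 / \<theta> \<le> (a\<^sup>2 + b\<^sup>2) / \<theta>"
          using \<theta> ab by (intro divide_right_mono) (auto simp: power2_eq_square algebra_simps)
        finally show "2 * real_of_int (snd p i - G (fst p) i) * (q (snd p) (i, True) - q (snd p) (i, False))
            + (q (snd p) (i, True) + q (snd p) (i, False)) \<le> \<theta> * real_of_int (snd p i - G (fst p) i)^2 + 
          (((q (snd p) (i, True))\<^sup>2 + (q (snd p) (i, False))\<^sup>2) / \<theta> + (q (snd p) (i, True) + q (snd p) (i, False)))"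
          by (simp add: D_def a_def b_def)
      qed
      also have "\<dots> = \<theta> * h p + ?\<chi> (snd p)"
        unfolding h_def by (simp add: sum.distrib sum_distrib_left)
      finally show ?thesis by (simp add: algebra_simps)
    qed
    have int: "integrable (measure_pmf \<pi>) f" for f :: "_ \<Rightarrow> real"
      using fin by (rule integrable_measure_pmf_finite)
    have "(\<integral>p. h p \<partial>\<pi>') \<le> (\<integral>p. (1 + \<theta>) * h p + ?\<chi> (snd p) \<partial>\<pi>)"
      unfolding E by (intro integral_mono int le)
    also have "\<dots> = (1 + \<theta>) * (\<integral>p. h p \<partial>\<pi>) + (\<integral>p. ?\<chi> (snd p) \<partial>\<pi>)"
      by (subst Bochner_Integration.integral_add) (auto intro: int)
    also have "(\<integral>p. ?\<chi> (snd p) \<partial>\<pi>) = (\<Sum>x\<in>grid N. \<rho> x * ?\<chi> x)" by (rule law[OF per\<chi>])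
    also have "\<dots> \<le> (\<Sum>x\<in>grid N. \<Sum>i\<in>UNIV. 
       ((max 0 (J i x))\<^sup>2 + (max 0 (- J i (shift (i, False) x)))\<^sup>2) / (\<theta> * r) + 
        (max 0 (J i x) + max 0 (- J i (shift (i, False) x))))"
    proof (intro sum_mono, unfold sum_distrib_left, intro sum_mono)
      fix x i
      \<comment> \<open>Mass times squared speed equals squared flux over mass, and the mass is at
        least \<open>r\<close>.\<close>
      have *: "\<rho> x * (q x s)\<^sup>2 \<le> (\<rho> x * q x s)\<^sup>2 / r" for s
      proof -
        have "r * (q x s)\<^sup>2 \<le> \<rho> x * (q x s)\<^sup>2" using r by (intro mult_right_mono) auto
        then have "\<rho> x * (r * (q x s)\<^sup>2) \<le> \<rho> x * (\<rho> x * (q x s)\<^sup>2)"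
          using \<rho>0[of x] by (intro mult_left_mono) auto
        then show ?thesis using r by (simp add: field_simps power2_eq_square)
      qed
      have "\<rho> x * (((q x (i, True))\<^sup>2 + (q x (i, False))\<^sup>2) / \<theta> + (q x (i, True) + q x (i, False)))
         = (\<rho> x * (q x (i, True))\<^sup>2 + \<rho> x * (q x (i, False))\<^sup>2) / \<theta> + (\<rho> x * q x (i, True) + \<rho> x * q x (i, False))"
        by (simp add: algebra_simps add_divide_distrib)
      also have "\<dots> \<le> ((\<rho> x * q x (i, True))\<^sup>2 / r + (\<rho> x * q x (i, False))\<^sup>2 / r) / \<theta> + (\<rho> x * q x (i, True) + \<rho> x * q x (i, False))"
        using \<theta> by (intro add_right_mono divide_right_mono add_mono *) auto
      also have "\<dots> = ((max 0 (J i x))\<^sup>2 + (max 0 (- J i (shift (i, False) x)))\<^sup>2) / (\<theta> * r) + 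
        (max 0 (J i x) + max 0 (- J i (shift (i, False) x)))"
        unfolding \<rho>q by (simp add: add_divide_distrib mult.commute)
      finally show "\<rho> x * (((q x (i, True))\<^sup>2 + (q x (i, False))\<^sup>2) / \<theta> + (q x (i, True) + q x (i, False)))
        \<le> ((max 0 (J i x))\<^sup>2 + (max 0 (- J i (shift (i, False) x)))\<^sup>2) / (\<theta> * r) + 
        (max 0 (J i x) + max 0 (- J i (shift (i, False) x)))" .
    qed
    also have "\<dots> = (\<Sum>i\<in>UNIV. \<Sum>x\<in>grid N. 
       ((max 0 (J i x))\<^sup>2 + (max 0 (- J i x))\<^sup>2) / (\<theta> * r) + (max 0 (J i x) + max 0 (- J i x)))"
    proof (subst sum.swap, rule sum.cong[OF refl])
      fix i
      have "periodic N (\<lambda>x. (max 0 (- J i x))\<^sup>2 / (\<theta> * r) + max 0 (- J i x))"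
        using per(2)[of i] unfolding periodic_def by simp
      from sum_grid_shift[OF N this, of "(i, False)"]
      show "(\<Sum>x\<in>grid N. ((max 0 (J i x))\<^sup>2 + (max 0 (- J i (shift (i, False) x)))\<^sup>2) / (\<theta> * r) + 
        (max 0 (J i x) + max 0 (- J i (shift (i, False) x)))) = (\<Sum>x\<in>grid N. 
       ((max 0 (J i x))\<^sup>2 + (max 0 (- J i x))\<^sup>2) / (\<theta> * r) + (max 0 (J i x) + max 0 (- J i x)))"
        by (simp add: sum.distrib add_divide_distrib)
    qed
    also have "(\<lambda>i x. ((max 0 (J i x))\<^sup>2 + (max 0 (- J i x))\<^sup>2) / (\<theta> * r) + (max 0 (J i x) + max 0 (- J i x)))
       = (\<lambda>i x. (J i x)\<^sup>2 / (\<theta> * r) + \<bar>J i x\<bar>)"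
      by (auto simp: fun_eq_iff max_def)
    also have "(\<Sum>i\<in>UNIV. \<Sum>x\<in>grid N. (J i x)\<^sup>2 / (\<theta> * r) + \<bar>J i x\<bar>)
      = (\<Sum>x\<in>grid N. \<Sum>i\<in>UNIV. (J i x)\<^sup>2) / (\<theta> * r) + (\<Sum>x\<in>grid N. \<Sum>i\<in>UNIV. \<bar>J i x\<bar>)"
      by (subst sum.swap) (simp add: sum.distrib sum_divide_distrib)
    finally show "(\<integral>p. (\<Sum>i\<in>UNIV. real_of_int (snd p i - G (fst p) i)^2) \<partial>\<pi>')
      \<le> (1 + \<theta>) * (\<integral>p. (\<Sum>i\<in>UNIV. real_of_int (snd p i - G (fst p) i)^2) \<partial>\<pi>)
        + (\<Sum>x\<in>grid N. \<Sum>i\<in>UNIV. (J i x)\<^sup>2) / (\<theta> * r) + (\<Sum>x\<in>grid N. \<Sum>i\<in>UNIV. \<bar>J i x\<bar>)"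
      by (simp add: h_def add.assoc)
  qed
qed

text \<open>The chain interpolates between \<open>f\<close> and the uniform density, with weight \<open>s = (k / K)\<^sup>2\<close> of the
  latter at time \<open>k\<close>. The density is only bounded below by \<open>s * u\<close>, but the quadratic schedule keeps
  the increment of \<open>s\<close> divided by the square root of \<open>s\<close> of order \<open>1 / K\<close>, whence the factor \<open>exp 3\<close>.\<close>

lemma ex_chain:
  fixes \<pi>\<^sub>0 :: "('a \<times> ('n::finite \<Rightarrow> int)) pmf" and G :: "'a \<Rightarrow> 'n \<Rightarrow> int"
    and f :: "('n \<Rightarrow> int) \<Rightarrow> real" and F :: "'n \<Rightarrow> ('n \<Rightarrow> int) \<Rightarrow> real"
    and N k\<^sub>0 K :: nat
  defines "u \<equiv> 1 / real N ^ CARD('n)"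
  assumes N: "N > 0" and fin: "finite (set_pmf \<pi>\<^sub>0)"
    and per: "periodic N f" "\<And>i. periodic N (F i)"
    and f0: "\<And>x. 0 \<le> f x"
    and div: "\<And>x. f x - u = (\<Sum>i\<in>UNIV. F i x - F i (shift (i, False) x))"
    and c: "\<And>i x. \<bar>F i x\<bar> \<le> c" "6 * real CARD('n) * c \<le> real k\<^sub>0 * u"
    and K: "1 \<le> k\<^sub>0" "k\<^sub>0 \<le> K"
    and law: "\<And>\<psi>. periodic N \<psi> \<Longrightarrow> (\<integral>p. \<psi> (snd p) \<partial>\<pi>\<^sub>0) =
        (\<Sum>x\<in>grid N. ((1 - (real k\<^sub>0 / real K)\<^sup>2) * f x + (real k\<^sub>0 / real K)\<^sup>2 * u) * \<psi> x)"
    and start: "\<And>p. p \<in> set_pmf \<pi>\<^sub>0 \<Longrightarrow> snd p = G (fst p)"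
  obtains \<pi> where "finite (set_pmf \<pi>)" "map_pmf fst \<pi> = map_pmf fst \<pi>\<^sub>0"
    "\<And>\<psi>. periodic N \<psi> \<Longrightarrow> (\<integral>p. \<psi> (snd p) \<partial>\<pi>) = (\<Sum>x\<in>grid N. u * \<psi> x)"
    "(\<integral>p. (\<Sum>i\<in>UNIV. real_of_int (snd p i - G (fst p) i)^2) \<partial>\<pi>)
      \<le> exp 3 * ((\<Sum>x\<in>grid N. \<Sum>i\<in>UNIV. (F i x)\<^sup>2) / u + (\<Sum>x\<in>grid N. \<Sum>i\<in>UNIV. \<bar>F i x\<bar>))"
proof -
  define U where "U = (\<Sum>x\<in>grid N. \<Sum>i\<in>UNIV. (F i x)\<^sup>2) / u"
  define W where "W = (\<Sum>x\<in>grid N. \<Sum>i\<in>UNIV. \<bar>F i x\<bar>)"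
  define A where "A \<pi> = (\<integral>p. (\<Sum>i\<in>UNIV. real_of_int (snd p i - G (fst p) i)^2) \<partial>measure_pmf \<pi>)" for \<pi>
  have u: "u > 0" using N by (simp add: u_def)
  have K0: "real K > 0" using K by simp
  have U0: "U \<ge> 0" using u by (simp add: U_def sum_nonneg)
  have W0: "W \<ge> 0" by (simp add: W_def sum_nonneg)
  \<comment> \<open>A single step gives A' \<le> (1 + \<theta>) A + \<theta> U + \<Delta> W with
    \<theta> = 3 / K. Adding \<open>U\<close> to both sides makes the recursion multiplicative, so
    the invariant is a geometric factor times \<open>U\<close> plus the portion of \<open>W\<close>
    spent so far.\<close>
  have "\<exists>\<pi>. finite (set_pmf \<pi>) \<and> map_pmf fst \<pi> = map_pmf fst \<pi>\<^sub>0 \<and>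
      (\<forall>\<psi>. periodic N \<psi> \<longrightarrow> (\<integral>p. \<psi> (snd p) \<partial>\<pi>) =
        (\<Sum>x\<in>grid N. ((1 - (real k / real K)\<^sup>2) * f x + (real k / real K)\<^sup>2 * u) * \<psi> x)) \<and>
      A \<pi> + U \<le> (1 + 3 / real K) ^ (k - k\<^sub>0) * (U + (real k / real K)\<^sup>2 * W)"
    if "k\<^sub>0 \<le> k" "k \<le> K" for k
    using that
  proof (induction k rule: dec_induct)
    case base
    have "A \<pi>\<^sub>0 = (\<integral>p. 0 \<partial>measure_pmf \<pi>\<^sub>0)"
      unfolding A_def by (intro integral_cong_AE) (auto simp: AE_measure_pmf_iff start)
    then show ?case
      using fin law W0 by (intro exI[of _ \<pi>\<^sub>0]) auto
  next
    case (step k)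
    then obtain \<pi> where \<pi>: "finite (set_pmf \<pi>)" "map_pmf fst \<pi> = map_pmf fst \<pi>\<^sub>0"
      "\<And>\<psi>. periodic N \<psi> \<Longrightarrow> (\<integral>p. \<psi> (snd p) \<partial>\<pi>) =
        (\<Sum>x\<in>grid N. ((1 - (real k / real K)\<^sup>2) * f x + (real k / real K)\<^sup>2 * u) * \<psi> x)"
      "A \<pi> + U \<le> (1 + 3 / real K) ^ (k - k\<^sub>0) * (U + (real k / real K)\<^sup>2 * W)" by auto
    have k: "real k \<ge> 1" "real k \<ge> real k\<^sub>0" "real k \<le> real K" using step K by auto
    \<comment> \<open>The increment of (k / K)^2. It is at most 3 k / K^2 because k \<ge> 1, which
      is the source of the weight 3 / K and of \<open>exp 3\<close>.\<close>
    define \<Delta> where "\<Delta> = (2 * real k + 1) / (real K)\<^sup>2"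
    have \<Delta>: "0 \<le> \<Delta>" "\<Delta> \<le> 3 * real k / (real K)\<^sup>2" "(real k / real K)\<^sup>2 + \<Delta> = (real (Suc k) / real K)\<^sup>2"
      using k K0 by (auto simp: \<Delta>_def power2_eq_square field_simps)
    define \<rho> where "\<rho> x = (1 - (real k / real K)\<^sup>2) * f x + (real k / real K)\<^sup>2 * u" for x
    have "(real k / real K)\<^sup>2 \<le> 1"
      using k K0 by (simp add: power_le_one_iff)
    then have \<rho>: "(real k / real K)\<^sup>2 * u \<le> \<rho> x" for x
      using f0 by (auto simp: \<rho>_def)
    have c0: "c \<ge> 0" using c(1) by (meson abs_ge_zero order_trans)
    \<comment> \<open>This makes the jump probabilities sum to at most 1. As the bound on
      \<open>\<Delta>\<close> is linear in \<open>k\<close> and the lower bound on the mass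
      quadratic, it reduces to 6 d c \<le> k u, which may fail for small \<open>k\<close>; hence the
      start at \<open>k\<^sub>0\<close>.\<close>
    have small: "2 * real CARD('n) * (\<Delta> * c) \<le> (real k / real K)\<^sup>2 * u"
    proof -
      have "2 * real CARD('n) * (\<Delta> * c) \<le> 2 * real CARD('n) * (3 * real k / (real K)\<^sup>2 * c)"
        using \<Delta> c0 by (intro mult_left_mono mult_right_mono) auto
      also have "\<dots> = (6 * real CARD('n) * c) * (real k / (real K)\<^sup>2)" by simp
      also have "\<dots> \<le> (real k * u) * (real k / (real K)\<^sup>2)"
        using c(2) k u by (intro mult_right_mono order_trans[OF c(2)]) auto
      finally show ?thesis by (simp add: power2_eq_square mult_ac)
    qed
    have perJ: "periodic N (\<lambda>x. \<Delta> * F i x)" and per\<rho>: "periodic N \<rho>" for i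
      using per unfolding periodic_def \<rho>_def by auto
    have absJ: "\<bar>\<Delta> * F i x\<bar> \<le> \<Delta> * c" for i x
      using c(1)[of i x] \<Delta> by (simp add: abs_mult mult_left_mono)
    have r0: "(real k / real K)\<^sup>2 * u > 0" using u k K0 by simp
    \<comment> \<open>The weight 3 / K dominates \<open>\<Delta>\<close> divided by k / K, so in
      \<open>sq\<close> the energy of one step costs at most 3 / K times \<open>U\<close>.\<close>
    have \<theta>0: "3 / real K > 0" using K0 by simp
    obtain \<pi>' where \<pi>': "finite (set_pmf \<pi>')" "map_pmf fst \<pi>' = map_pmf fst \<pi>"
      "\<And>\<psi>. periodic N \<psi> \<Longrightarrow> (\<integral>p. \<psi> (snd p) \<partial>\<pi>') =
        (\<Sum>x\<in>grid N. (\<rho> x - (\<Sum>i\<in>UNIV. \<Delta> * F i x - \<Delta> * F i (shift (i, False) x))) * \<psi> x)"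
      "A \<pi>' \<le> (1 + 3 / real K) * A \<pi> + (\<Sum>x\<in>grid N. \<Sum>i\<in>UNIV. (\<Delta> * F i x)\<^sup>2) / (3 / real K * ((real k / real K)\<^sup>2 * u))
         + (\<Sum>x\<in>grid N. \<Sum>i\<in>UNIV. \<bar>\<Delta> * F i x\<bar>)"
    proof (rule ex_chain_step[OF N \<pi>(1) \<pi>(3)[folded \<rho>_def] per\<rho> perJ r0 \<rho> absJ small \<theta>0, where G = G])
      fix \<pi>' assume *: "finite (set_pmf \<pi>')" "map_pmf fst \<pi>' = map_pmf fst \<pi>"
        "\<And>\<psi>. periodic N \<psi> \<Longrightarrow> (\<integral>p. \<psi> (snd p) \<partial>\<pi>') =
          (\<Sum>x\<in>grid N. (\<rho> x - (\<Sum>i\<in>UNIV. \<Delta> * F i x - \<Delta> * F i (shift (i, False) x))) * \<psi> x)"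
      assume "(\<integral>p. (\<Sum>i\<in>UNIV. real_of_int (snd p i - G (fst p) i)^2) \<partial>\<pi>')
        \<le> (1 + 3 / real K) * (\<integral>p. (\<Sum>i\<in>UNIV. real_of_int (snd p i - G (fst p) i)^2) \<partial>\<pi>)
          + (\<Sum>x\<in>grid N. \<Sum>i\<in>UNIV. (\<Delta> * F i x)\<^sup>2) / (3 / real K * ((real k / real K)\<^sup>2 * u))
          + (\<Sum>x\<in>grid N. \<Sum>i\<in>UNIV. \<bar>\<Delta> * F i x\<bar>)"
      with * show thesis by (intro that[of \<pi>']) (simp_all add: A_def)
    qed
    have \<rho>': "\<rho> x - (\<Sum>i\<in>UNIV. \<Delta> * F i x - \<Delta> * F i (shift (i, False) x))
        = (1 - (real (Suc k) / real K)\<^sup>2) * f x + (real (Suc k) / real K)\<^sup>2 * u" for x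
    proof -
      have "(\<Sum>i\<in>UNIV. \<Delta> * F i x - \<Delta> * F i (shift (i, False) x)) = \<Delta> * (f x - u)"
        unfolding div by (simp add: sum_distrib_left right_diff_distrib)
      then show ?thesis unfolding \<rho>_def \<Delta>(3)[symmetric] by (simp add: algebra_simps)
    qed
    have sq: "(\<Sum>x\<in>grid N. \<Sum>i\<in>UNIV. (\<Delta> * F i x)\<^sup>2) / (3 / real K * ((real k / real K)\<^sup>2 * u)) \<le> 3 / real K * U"
    proof -
      have "(\<Sum>x\<in>grid N. \<Sum>i\<in>UNIV. (\<Delta> * F i x)\<^sup>2) / (3 / real K * ((real k / real K)\<^sup>2 * u)) = \<Delta>\<^sup>2 / (3 / real K * (real k / real K)\<^sup>2) * U"
        by (simp add: U_def power_mult_distrib[of _ "F _ _"] sum_distrib_left[symmetric] mult_ac)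
      also have "\<dots> \<le> (3 * real k / (real K)\<^sup>2)\<^sup>2 / (3 / real K * (real k / real K)\<^sup>2) * U"
        using \<Delta> U0 K0 by (intro mult_right_mono divide_right_mono power_mono) auto
      also have "(3 * real k / (real K)\<^sup>2)\<^sup>2 / (3 / real K * (real k / real K)\<^sup>2) = 3 / real K"
        using k K0 by (simp add: field_simps power2_eq_square)
      finally show ?thesis .
    qed
    have ab: "(\<Sum>x\<in>grid N. \<Sum>i\<in>UNIV. \<bar>\<Delta> * F i x\<bar>) = \<Delta> * W"
      using \<Delta> by (simp add: W_def abs_mult sum_distrib_left)
    have "A \<pi>' \<le> (1 + 3 / real K) * A \<pi> + 3 / real K * U + \<Delta> * W"
      using \<pi>'(4) sq unfolding ab by linarith
    then have "A \<pi>' + U \<le> (1 + 3 / real K) * (A \<pi> + U) + \<Delta> * W"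
      by (simp add: algebra_simps add_divide_distrib)
    also have "\<dots> \<le> (1 + 3 / real K) * ((1 + 3 / real K) ^ (k - k\<^sub>0) * (U + (real k / real K)\<^sup>2 * W)) + (1 + 3 / real K) ^ (Suc k - k\<^sub>0) * (\<Delta> * W)"
    proof (rule add_mono)
      show "(1 + 3 / real K) * (A \<pi> + U) \<le> (1 + 3 / real K) * ((1 + 3 / real K) ^ (k - k\<^sub>0) * (U + (real k / real K)\<^sup>2 * W))"
        using \<pi>(4) by (rule mult_left_mono) simp
      have "1 * (\<Delta> * W) \<le> (1 + 3 / real K) ^ (Suc k - k\<^sub>0) * (\<Delta> * W)"
        using \<Delta> W0 by (intro mult_right_mono one_le_power) auto
      then show "\<Delta> * W \<le> (1 + 3 / real K) ^ (Suc k - k\<^sub>0) * (\<Delta> * W)" by simp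
    qed
    also have "\<dots> = (1 + 3 / real K) ^ (Suc k - k\<^sub>0) * (U + ((real k / real K)\<^sup>2 + \<Delta>) * W)"
    proof -
      have "Suc k - k\<^sub>0 = Suc (k - k\<^sub>0)" using step by simp
      then show ?thesis by (simp add: algebra_simps add_divide_distrib)
    qed
    finally have "A \<pi>' + U \<le> (1 + 3 / real K) ^ (Suc k - k\<^sub>0) * (U + (real (Suc k) / real K)\<^sup>2 * W)"
      unfolding \<Delta>(3) .
    then show ?case using \<pi>' \<pi>(2) unfolding \<rho>' by (intro exI[of _ \<pi>']) auto
  qed
  from this[OF K(2) order.refl] obtain \<pi> where \<pi>: "finite (set_pmf \<pi>)" "map_pmf fst \<pi> = map_pmf fst \<pi>\<^sub>0"
      "\<And>\<psi>. periodic N \<psi> \<Longrightarrow> (\<integral>p. \<psi> (snd p) \<partial>\<pi>) = (\<Sum>x\<in>grid N. u * \<psi> x)"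
      "A \<pi> + U \<le> (1 + 3 / real K) ^ (K - k\<^sub>0) * (U + W)"
    using K0 by (auto simp: power2_eq_square)
  have "(1 + 3 / real K) ^ (K - k\<^sub>0) \<le> (1 + 3 / real K) ^ K"
    by (intro power_increasing) auto
  also have "\<dots> \<le> exp (3 / real K) ^ K"
    by (intro power_mono exp_ge_add_one_self) auto
  also have "\<dots> = exp 3" using K0 by (simp add: exp_of_nat_mult[symmetric])
  finally have "(1 + 3 / real K) ^ (K - k\<^sub>0) * (U + W) \<le> exp 3 * (U + W)"
    using U0 W0 by (intro mult_right_mono) auto
  then show ?thesis using \<pi> U0 by (intro that[of \<pi>]) (auto simp: A_def U_def W_def)
qed

section \<open>Fourier analysis on the grid\<close>


text \<open>Character of the torus with integer frequency \<open>k\<close>. The argument is a plain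
  function, so that both grid points divided by \<open>N\<close> and vectors through
  \<open>($)\<close> can be inserted.\<close>

definition ek :: "('n::finite \<Rightarrow> int) \<Rightarrow> ('n \<Rightarrow> real) \<Rightarrow> complex" where
  "ek k z = cis (2 * pi * (\<Sum>i\<in>UNIV. of_int (k i) * z i))"

definition freq_box :: "int \<Rightarrow> ('n::finite \<Rightarrow> int) set" where
  "freq_box R = {k. \<forall>i. \<bar>k i\<bar> \<le> R}"

lemma freq_box_eq_PiE: "freq_box R = PiE UNIV (\<lambda>_. {-R..R})"
proof -
  have "\<bar>x\<bar> \<le> R \<longleftrightarrow> x \<in> {-R..R}" for x :: int by auto
  then show ?thesis by (simp add: freq_box_def PiE_def Pi_def)
qed

lemma finite_freq_box: "finite (freq_box R)"
  unfolding freq_box_eq_PiE by (intro finite_PiE) auto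

lemma sum_squares_int_ge_1:
  assumes "k \<noteq> (\<lambda>_. 0)"
  shows "1 \<le> (\<Sum>i\<in>(UNIV :: 'n::finite set). (real_of_int (k i))\<^sup>2)"
proof -
  obtain i where "k i \<noteq> 0" using assms by auto
  then have "1 \<le> \<bar>real_of_int (k i)\<bar>" by linarith
  then have "1 \<le> (real_of_int (k i))\<^sup>2" using one_le_power[of "\<bar>real_of_int (k i)\<bar>" 2] by simp
  also have "\<dots> \<le> (\<Sum>i\<in>UNIV. (real_of_int (k i))\<^sup>2)" by (rule member_le_sum) auto
  finally show ?thesis .
qed

lemma norm_ek [simp]: "norm (ek k z) = 1"
  by (simp add: ek_def)

lemma ek_0 [simp]: "ek (\<lambda>_. 0) z = 1"
  by (simp add: ek_def)

lemma ek_mult_cnj: "ek k z * cnj (ek l z) = ek (\<lambda>i. k i - l i) z"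
  by (simp add: ek_def cis_cnj cis_mult sum_subtractf right_diff_distrib left_diff_distrib)

lemma ek_diff: "ek k (\<lambda>i. y i - z i) = ek k y * cnj (ek k z)"
  by (simp add: ek_def cis_cnj cis_mult sum_subtractf right_diff_distrib left_diff_distrib)

lemma ek_eq_prod: "ek k z = (\<Prod>i\<in>UNIV. cis (2 * pi * of_int (k i) * z i))"
  by (simp add: ek_def cis_conv_exp exp_sum[symmetric] sum_distrib_left mult_ac)

text \<open>A geometric sum over the powers of an N-th root of unity; that root is 1 exactly when
  \<open>N\<close> divides \<open>k\<close>.\<close>

lemma sum_cis_int:
  assumes N: "N > 0"
  shows "(\<Sum>x\<in>{0..<int N}. cis (2 * pi * of_int k * (of_int x / real N))) = (if int N dvd k then of_nat N else 0)"
proof -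
  let ?z = "cis (2 * pi * of_int k / real N)"
  have "(\<Sum>x\<in>{0..<int N}. cis (2 * pi * of_int k * (of_int x / real N))) = (\<Sum>x<N. ?z ^ x)"
    by (rule sum.reindex_bij_witness[where i = int and j = nat]) (auto simp: Complex.DeMoivre mult_ac)
  also have "\<dots> = (if int N dvd k then of_nat N else 0)"
  proof (cases "?z = 1")
    case True
    then have "cos (2 * pi * of_int k / real N) = 1" by (simp add: complex_eq_iff)
    then obtain n :: int where "2 * pi * of_int k / real N = of_int n * 2 * pi"
      using cos_one_2pi_int by blast
    then have "real_of_int k = of_int (n * int N)" using N by (simp add: field_simps)
    then have "k = n * int N" by linarith
    then have "int N dvd k" by simp
    then show ?thesis by (simp only: True) simp
  next
    case False
    have "\<not> int N dvd k"
    proof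
      assume "int N dvd k"
      then obtain m where "k = int N * m" by auto
      then have "2 * pi * of_int k / real N = 2 * pi * of_int m" using N by simp
      then show False using False by simp
    qed
    moreover have "?z ^ N = 1"
      using N cis_multiple_2pi[of "of_int k"] by (simp add: Complex.DeMoivre)
    ultimately show ?thesis using False by (simp add: geometric_sum)
  qed
  finally show ?thesis .
qed

lemma sum_grid_ek:
  fixes k :: "'n::finite \<Rightarrow> int"
  assumes N: "N > 0"
  shows "(\<Sum>g\<in>grid N. ek k (\<lambda>i. of_int (g i) / real N))
    = (if \<forall>i. int N dvd k i then of_nat N ^ CARD('n) else 0)"
proof -
  have "(\<Sum>g\<in>grid N. ek k (\<lambda>i. of_int (g i) / real N)) =
      (\<Prod>i\<in>UNIV. \<Sum>x\<in>{0..<int N}. cis (2 * pi * of_int (k i) * (of_int x / real N)))"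
    unfolding grid_eq_PiE ek_eq_prod by (subst prod_sum_PiE) auto
  also have "\<dots> = (\<Prod>i\<in>(UNIV :: 'n set). if int N dvd k i then of_nat N else 0)"
    by (simp only: sum_cis_int[OF N])
  also have "\<dots> = (if \<forall>i. int N dvd k i then of_nat N ^ CARD('n) else 0)"
    by (auto intro: prod_zero)
  finally show ?thesis .
qed

text \<open>Orthogonality of characters on the grid. Frequencies in the box differ by at most 2 R <
  N in each coordinate, so distinct ones stay distinct modulo \<open>N\<close> and no aliasing
  occurs.\<close>

lemma parseval_grid:
  fixes \<alpha> :: "('n::finite \<Rightarrow> int) \<Rightarrow> complex"
  assumes N: "N > 0" "2 * R < int N" and B: "B \<subseteq> freq_box R"
  shows "(\<Sum>g\<in>grid N. (norm (\<Sum>k\<in>B. \<alpha> k * ek k (\<lambda>i. of_int (g i) / real N)))\<^sup>2)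
    = real N ^ CARD('n) * (\<Sum>k\<in>B. (norm (\<alpha> k))\<^sup>2)"
proof -
  have fin: "finite B" using B finite_freq_box finite_subset by blast
  let ?x = "\<lambda>g i. of_int (g i) / real N"
  have eq: "(\<forall>i. int N dvd k i - l i) \<longleftrightarrow> k = l" if "k \<in> B" "l \<in> B" for k l
  proof
    assume a: "\<forall>i. int N dvd k i - l i"
    show "k = l"
    proof
      fix i
      have "\<bar>k i\<bar> \<le> R" "\<bar>l i\<bar> \<le> R" using that B by (auto simp: freq_box_def)
      then have "\<bar>k i - l i\<bar> < int N" using N by linarith
      then show "k i = l i" using a[rule_format, of i] by (metis dvd_imp_le_int eq_iff_diff_eq_0 abs_of_nat not_le)
    qed
  qed auto
  have "complex_of_real (\<Sum>g\<in>grid N. (norm (\<Sum>k\<in>B. \<alpha> k * ek k (?x g)))\<^sup>2)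
     = (\<Sum>g\<in>grid N. (\<Sum>k\<in>B. \<alpha> k * ek k (?x g)) * cnj (\<Sum>k\<in>B. \<alpha> k * ek k (?x g)))"
    by (simp only: complex_norm_square of_real_sum)
  also have "\<dots> = (\<Sum>g\<in>grid N. \<Sum>k\<in>B. \<Sum>l\<in>B. \<alpha> k * cnj (\<alpha> l) * ek (\<lambda>i. k i - l i) (?x g))"
    by (simp add: sum_product ek_mult_cnj[symmetric] mult_ac)
  also have "\<dots> = (\<Sum>k\<in>B. \<Sum>l\<in>B. \<alpha> k * cnj (\<alpha> l) * (\<Sum>g\<in>grid N. ek (\<lambda>i. k i - l i) (?x g)))"
    by (subst sum.swap, rule sum.cong[OF refl], subst sum.swap) (simp add: sum_distrib_left)
  also have "\<dots> = (\<Sum>k\<in>B. \<Sum>l\<in>B. if l = k then \<alpha> k * cnj (\<alpha> l) * of_nat N ^ CARD('n) else 0)"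
    by (intro sum.cong refl) (auto simp: sum_grid_ek[OF N(1)] eq)
  also have "\<dots> = (\<Sum>k\<in>B. \<alpha> k * cnj (\<alpha> k) * of_nat N ^ CARD('n))"
    using fin by simp
  also have "\<dots> = complex_of_real (real N ^ CARD('n) * (\<Sum>k\<in>B. (norm (\<alpha> k))\<^sup>2))"
    unfolding of_real_mult of_real_sum complex_norm_square by (simp add: sum_distrib_left mult_ac)
  finally show ?thesis by (simp only: of_real_eq_iff)
qed

text \<open>The kernel is the normalized square of a trigonometric sum with triangular coefficients. The
  Fejer kernel would only give \<open>1 - q 1\<close> of order \<open>1 / M\<close>.\<close>

lemma ex_smoothing_kernel:
  assumes M: "M \<ge> 1"
  obtains q :: "int \<Rightarrow> real" and Q :: "real \<Rightarrow> real" where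
    "q 0 = 1" "\<And>k. \<bar>q k\<bar> \<le> 1" "\<And>k. q (- k) = q k" "1 - q 1 \<le> 3 / (real M)\<^sup>2"
    "\<And>z. 0 \<le> Q z"
    "\<And>z. (\<Sum>k\<in>{- 2 * int M..2 * int M}. of_real (q k) * cis (2 * pi * of_int k * z)) = complex_of_real (Q z)"
proof -
  define a :: "int \<Rightarrow> real" where "a j = max 0 (of_int (int M + 1 - \<bar>j\<bar>))" for j
  define I where "I = {- int M..int M}"
  define S where "S = (\<Sum>j\<in>I. (a j)\<^sup>2)"
  have a0: "a j = 0" if "j \<notin> I" for j using that by (auto simp: a_def I_def)
  have am: "a (- j) = a j" for j by (simp add: a_def)
  have Sge: "(real M + 1) ^ 3 / 3 \<le> S"
  proof -
    have "(real m + 1) ^ 3 / 3 \<le> (\<Sum>j\<le>m. (real j + 1)\<^sup>2)" for m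
      by (induction m) (simp_all add: field_simps power2_eq_square power3_eq_cube)
    from this[of M] have "(real M + 1) ^ 3 / 3 \<le> (\<Sum>j\<le>M. (real j + 1)\<^sup>2)" .
    also have "\<dots> = (\<Sum>j\<in>{0..int M}. (a j)\<^sup>2)"
      by (rule sum.reindex_bij_witness[where i = "\<lambda>j. nat (int M - j)" and j = "\<lambda>j. int M - int j"])
        (auto simp: a_def of_nat_diff algebra_simps)
    also have "\<dots> \<le> S" unfolding S_def I_def by (intro sum_mono2) auto
    finally show ?thesis .
  qed
  moreover have "(real M + 1) ^ 3 > 0" by simp
  ultimately have S0: "S > 0" by linarith
  \<comment> \<open>A shift can only push weight out of the window \<open>I\<close>, since
    \<open>a\<close> vanishes outside it. With 2 x y \<le> x^2 + y^2 this yields the bound 1 for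
    \<open>q\<close>.\<close>
  have Sshift: "(\<Sum>j\<in>I. (a (j + k))\<^sup>2) \<le> S" for k
  proof -
    have "(\<Sum>j\<in>I. (a (j + k))\<^sup>2) = (\<Sum>j\<in>(\<lambda>j. j + k) ` I. (a j)\<^sup>2)"
      by (subst sum.reindex) (auto simp: inj_on_def)
    also have "\<dots> \<le> (\<Sum>j\<in>(\<lambda>j. j + k) ` I \<union> I. (a j)\<^sup>2)"
      by (intro sum_mono2) (auto simp: I_def)
    also have "\<dots> = S" unfolding S_def
      by (intro sum.mono_neutral_right) (auto simp: I_def a0[unfolded I_def])
    finally show ?thesis .
  qed
  define q where "q k = (\<Sum>j\<in>I. a j * a (j + k)) / S" for k
  define Q where "Q z = (norm (\<Sum>j\<in>I. of_real (a j) * cis (2 * pi * of_int j * z)))\<^sup>2 / S" for z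
  show ?thesis
  proof (rule that[of q Q])
    show "q 0 = 1" using S0 by (simp add: q_def S_def power2_eq_square)
    show "\<bar>q k\<bar> \<le> 1" for k
    proof -
      have "\<bar>\<Sum>j\<in>I. a j * a (j + k)\<bar> \<le> (\<Sum>j\<in>I. ((a j)\<^sup>2 + (a (j + k))\<^sup>2) / 2)"
      proof (intro order_trans[OF sum_abs] sum_mono)
        fix j
        have "0 \<le> (\<bar>a j\<bar> - \<bar>a (j + k)\<bar>)\<^sup>2" by simp
        then show "\<bar>a j * a (j + k)\<bar> \<le> ((a j)\<^sup>2 + (a (j + k))\<^sup>2) / 2"
          by (simp add: power2_diff abs_mult)
      qed
      also have "\<dots> \<le> S" using Sshift[of k]
        by (simp add: sum_divide_distrib[symmetric] sum.distrib S_def)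
      finally show ?thesis using S0 by (simp add: q_def)
    qed
    show "q (- k) = q k" for k
    proof -
      have am2: "a (- j - k) = a (j + k)" for j
        using am[of "j + k"] by (simp add: algebra_simps)
      have "(\<Sum>j\<in>I. a j * a (j - k)) = (\<Sum>j\<in>I. a (- j) * a (- j - k))"
        by (rule sum.reindex_bij_witness[where i = uminus and j = uminus]) (auto simp: I_def)
      also have "\<dots> = (\<Sum>j\<in>I. a j * a (j + k))"
        by (simp only: am am2)
      finally have "(\<Sum>j\<in>I. a j * a (j - k)) = (\<Sum>j\<in>I. a j * a (j + k))" .
      then show ?thesis by (simp add: q_def)
    qed
    \<comment> \<open>Up to the boundary term, 1 - q 1 is half the sum of squared differences of
      \<open>a\<close>, divided by \<open>S\<close>: the differences are at most 1 at 2 M + 1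
      places, while \<open>S\<close> is of order M^3. The shifted sum of squares misses the square
      of \<open>a (- int M)\<close>, which is 1, hence S - 1.\<close>
    show "1 - q 1 \<le> 3 / (real M)\<^sup>2"
    proof -
      have "(\<Sum>j\<in>I. (a (j + 1))\<^sup>2) = (\<Sum>j\<in>{- int M + 1..int M + 1}. (a j)\<^sup>2)"
        unfolding I_def
        by (rule sum.reindex_bij_witness[where i = "\<lambda>j. j - 1" and j = "\<lambda>j. j + 1"]) auto
      also have "\<dots> = (\<Sum>j\<in>I - {- int M}. (a j)\<^sup>2)"
        by (intro sum.mono_neutral_right) (auto simp: I_def a_def)
      also have "\<dots> = S - 1"
        unfolding S_def by (subst sum_diff1) (auto simp: I_def a_def)
      finally have 1: "(\<Sum>j\<in>I. (a (j + 1))\<^sup>2) = S - 1" .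
      have "(\<Sum>j\<in>I. (a j - a (j + 1))\<^sup>2) \<le> (\<Sum>j\<in>I. 1)"
      proof (intro sum_mono)
        fix j
        have "\<bar>a j - a (j + 1)\<bar> \<le> 1" by (auto simp: a_def)
        then show "(a j - a (j + 1))\<^sup>2 \<le> 1" by (simp add: abs_square_le_1)
      qed
      also have "\<dots> = 2 * real M + 1" by (simp add: I_def)
      also have "(\<Sum>j\<in>I. (a j - a (j + 1))\<^sup>2) = S + (S - 1) - 2 * (\<Sum>j\<in>I. a j * a (j + 1))"
        unfolding 1[symmetric] by (simp add: power2_diff sum.distrib sum_subtractf S_def sum_distrib_left mult.assoc)
      finally have "S - (\<Sum>j\<in>I. a j * a (j + 1)) \<le> real M + 1" by simp
      moreover have "1 - q 1 = (S - (\<Sum>j\<in>I. a j * a (j + 1))) / S"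
        using S0 by (simp add: q_def diff_divide_distrib)
      ultimately have "1 - q 1 \<le> (real M + 1) / S" using S0 by (simp add: divide_right_mono)
      also have "\<dots> \<le> (real M + 1) / ((real M + 1) ^ 3 / 3)"
        using Sge S0 by (intro divide_left_mono) auto
      also have "\<dots> = 3 / (real M + 1)\<^sup>2"
      proof -
        have *: "m / (m ^ 3 / 3) = 3 / m\<^sup>2" if "m > 0" for m :: real
          using that by (simp add: power2_eq_square power3_eq_cube)
        show ?thesis by (rule *) simp
      qed
      also have "\<dots> \<le> 3 / (real M)\<^sup>2" using M by (intro divide_left_mono power_mono) auto
      finally show ?thesis .
    qed
    show "0 \<le> Q z" for z using S0 by (simp add: Q_def)
    show "(\<Sum>k\<in>{- 2 * int M..2 * int M}. of_real (q k) * cis (2 * pi * of_int k * z)) = complex_of_real (Q z)" for z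
    proof -
      let ?e = "\<lambda>j. cis (2 * pi * of_int j * z)"
      have e: "?e l * cnj (?e j) = ?e (l - j)" for l j
        by (simp add: cis_cnj cis_mult algebra_simps)
      have "(\<Sum>k\<in>{- 2 * int M..2 * int M}. of_real (q k) * ?e k)
        = (\<Sum>k\<in>{- 2 * int M..2 * int M}. \<Sum>j\<in>I. of_real (a j * a (j + k)) * ?e k) / of_real S"
        by (simp add: q_def sum_divide_distrib sum_distrib_right)
      also have "(\<Sum>k\<in>{- 2 * int M..2 * int M}. \<Sum>j\<in>I. of_real (a j * a (j + k)) * ?e k)
        = (\<Sum>j\<in>I. \<Sum>k\<in>{- 2 * int M..2 * int M}. of_real (a j * a (j + k)) * ?e k)"
        by (rule sum.swap)
      also have "\<dots> = (\<Sum>j\<in>I. \<Sum>l\<in>I. of_real (a j * a l) * ?e (l - j))"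
      proof (rule sum.cong[OF refl])
        fix j assume j: "j \<in> I"
        have "(\<Sum>k\<in>{- 2 * int M..2 * int M}. of_real (a j * a (j + k)) * ?e k)
           = (\<Sum>l\<in>{j - 2 * int M..j + 2 * int M}. of_real (a j * a l) * ?e (l - j))"
          by (rule sum.reindex_bij_witness[where i = "\<lambda>l. l - j" and j = "\<lambda>k. k + j"]) (auto simp: add.commute)
        also have "\<dots> = (\<Sum>l\<in>I. of_real (a j * a l) * ?e (l - j))"
          using j by (intro sum.mono_neutral_right) (auto simp: I_def a0[unfolded I_def])
        finally show "(\<Sum>k\<in>{- 2 * int M..2 * int M}. of_real (a j * a (j + k)) * ?e k) = \<dots>" .
      qed
      also have "\<dots> = (\<Sum>l\<in>I. of_real (a l) * ?e l) * cnj (\<Sum>j\<in>I. of_real (a j) * ?e j)"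
        unfolding e[symmetric] by (subst sum.swap) (simp add: sum_product mult_ac)
      also have "\<dots> = of_real ((norm (\<Sum>j\<in>I. of_real (a j) * ?e j))\<^sup>2)"
        by (rule complex_norm_square[symmetric])
      finally show ?thesis by (simp add: Q_def)
    qed
  qed
qed

section \<open>Transport of the empirical measure\<close>


definition cell :: "nat \<Rightarrow> (real ^ 'n::finite) set" where
  "cell N = {u. \<forall>i. 0 \<le> u $ i \<and> u $ i < 1 / real N}"

definition grid_pt :: "nat \<Rightarrow> ('n::finite \<Rightarrow> int) \<Rightarrow> real ^ 'n" where
  "grid_pt N g = (\<chi> i. of_int (g i) / real N)"

lemma borel_cell [measurable]: "cell N \<in> sets borel"
proof -
  have "cell N = (\<Inter>i. {u. 0 \<le> u $ i \<and> u $ i < 1 / real N})" by (auto simp: cell_def)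
  also have "\<dots> \<in> sets borel"
    by (intro sets.finite_INT) (auto, measurable)
  finally show ?thesis .
qed

lemma UN_grid_cell:
  fixes E :: "(real ^ 'n::finite) set"
  assumes N: "N > 0"
  shows "(\<Union>g\<in>grid N. (\<lambda>u. u - grid_pt N g) -` cell N \<inter> E) = cell 1 \<inter> E"
proof -
  have "(\<exists>g\<in>grid N. u - grid_pt N g \<in> cell N) \<longleftrightarrow> u \<in> cell 1" for u :: "real ^ 'n"
  proof
    assume "\<exists>g\<in>grid N. u - grid_pt N g \<in> cell N"
    then obtain g where g: "g \<in> grid N" "u - grid_pt N g \<in> cell N" by auto
    have "0 \<le> u $ i \<and> u $ i < 1" for i
    proof -
      have "0 \<le> g i" "g i < int N" using g by (auto simp: grid_def)
      then have "0 \<le> real_of_int (g i)" "real_of_int (g i) + 1 \<le> real N" by linarith+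
      then have "0 \<le> of_int (g i) / real N" "of_int (g i) / real N + 1 / real N \<le> 1"
        using N by (auto simp: field_simps)
      moreover have "0 \<le> u $ i - of_int (g i) / real N" "u $ i - of_int (g i) / real N < 1 / real N"
        using g by (auto simp: cell_def grid_pt_def)
      ultimately show ?thesis by linarith
    qed
    then show "u \<in> cell 1" by (simp add: cell_def)
  next
    assume u: "u \<in> cell 1"
    define g where "g i = \<lfloor>u $ i * real N\<rfloor>" for i
    have "g \<in> grid N"
      using u N by (auto simp: grid_def g_def cell_def floor_less_iff)
    moreover have "0 \<le> u $ i - of_int (g i) / real N \<and> u $ i - of_int (g i) / real N < 1 / real N" for i
    proof -
      have "of_int (g i) \<le> u $ i * real N" "u $ i * real N < of_int (g i) + 1"
        by (auto simp: g_def)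
      then have "of_int (g i) / real N \<le> u $ i" "u $ i < (of_int (g i) + 1) / real N"
        using N by (simp_all add: pos_divide_le_eq pos_less_divide_eq)
      then show ?thesis by (simp add: add_divide_distrib)
    qed
    ultimately show "\<exists>g\<in>grid N. u - grid_pt N g \<in> cell N"
      by (auto simp: cell_def grid_pt_def)
  qed
  then show ?thesis by auto
qed

lemma disjoint_grid_cell:
  assumes N: "N > 0"
  shows "disjoint_family_on (\<lambda>g. (\<lambda>u. u - grid_pt N g) -` cell N \<inter> E) (grid N)"
  unfolding disjoint_family_on_def
proof (intro ballI impI equals0I)
  fix g h u
  assume gh: "g \<noteq> h" and "u \<in> ((\<lambda>u. u - grid_pt N g) -` cell N \<inter> E) \<inter> ((\<lambda>u. u - grid_pt N h) -` cell N \<inter> E)"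
  then have u: "u - grid_pt N g \<in> cell N" "u - grid_pt N h \<in> cell N" by auto
  have "g i = h i" for i
  proof -
    have "0 \<le> u $ i - of_int (g i) / real N" "u $ i - of_int (g i) / real N < 1 / real N"
      "0 \<le> u $ i - of_int (h i) / real N" "u $ i - of_int (h i) / real N < 1 / real N"
      using u by (auto simp: cell_def grid_pt_def)
    then have "of_int (g i) / real N \<le> u $ i" "u $ i < (of_int (g i) + 1) / real N"
      "of_int (h i) / real N \<le> u $ i" "u $ i < (of_int (h i) + 1) / real N"
      by (simp_all add: add_divide_distrib)
    then have "of_int (g i) \<le> u $ i * real N" "u $ i * real N < of_int (g i) + 1"
      "of_int (h i) \<le> u $ i * real N" "u $ i * real N < of_int (h i) + 1"
      using N by (simp_all add: pos_divide_le_eq pos_less_divide_eq)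
    then show ?thesis by linarith
  qed
  then show False using gh by auto
qed

lemma emeasure_lborel_shift:
  fixes c :: "'a::euclidean_space"
  assumes "S \<in> sets borel"
  shows "emeasure lborel ((\<lambda>u. c + u) -` S) = emeasure lborel S"
proof -
  have "emeasure lborel S = emeasure (distr lborel borel ((+) c)) S"
    by (simp add: lborel_distr_plus)
  also have "\<dots> = emeasure lborel ((\<lambda>u. c + u) -` S)"
    using assms by (subst emeasure_distr) auto
  finally show ?thesis by simp
qed

text \<open>The translates of \<open>cell N\<close> by the grid points partition the unit cube, and
  Lebesgue measure is translation invariant.\<close>

lemma sum_grid_cell:
  fixes E :: "(real ^ 'n::finite) set"
  assumes N: "N > 0" and E[measurable]: "E \<in> sets borel"
  shows "(\<Sum>g\<in>grid N. emeasure lborel (cell N \<inter> (\<lambda>u. grid_pt N g + u) -` E)) = emeasure lborel (cell 1 \<inter> E)"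
proof -
  have "(\<Sum>g\<in>grid N. emeasure lborel (cell N \<inter> (\<lambda>u. grid_pt N g + u) -` E)) =
     (\<Sum>g\<in>grid N. emeasure lborel ((\<lambda>u. u - grid_pt N g) -` cell N \<inter> E))"
  proof (rule sum.cong[OF refl])
    fix g :: "'n \<Rightarrow> int"
    have [measurable]: "(\<lambda>u. u - grid_pt N g) -` cell N \<in> sets borel"
      using measurable_sets_borel[OF _ borel_cell, of "\<lambda>u. u - grid_pt N g"] by simp
    have "emeasure lborel ((\<lambda>u. u - grid_pt N g) -` cell N \<inter> E)
       = emeasure lborel ((\<lambda>u. grid_pt N g + u) -` ((\<lambda>u. u - grid_pt N g) -` cell N \<inter> E))"
      by (rule emeasure_lborel_shift[symmetric]) measurable
    also have "(\<lambda>u. grid_pt N g + u) -` ((\<lambda>u. u - grid_pt N g) -` cell N \<inter> E)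
       = cell N \<inter> (\<lambda>u. grid_pt N g + u) -` E" by auto
    finally show "emeasure lborel (cell N \<inter> (\<lambda>u. grid_pt N g + u) -` E)
       = emeasure lborel ((\<lambda>u. u - grid_pt N g) -` cell N \<inter> E)" by simp
  qed
  also have "\<dots> = emeasure lborel (\<Union>g\<in>grid N. (\<lambda>u. u - grid_pt N g) -` cell N \<inter> E)"
  proof (rule sum_emeasure[OF _ disjoint_grid_cell[OF N] finite_grid])
    have "(\<lambda>u. u - grid_pt N g) -` cell N \<in> sets borel" for g :: "'n \<Rightarrow> int"
      using measurable_sets_borel[OF _ borel_cell, of "\<lambda>u. u - grid_pt N g"] by simp
    then show "(\<lambda>g. (\<lambda>u. u - grid_pt N g) -` cell N \<inter> E) ` grid N \<subseteq> sets lborel" using E by auto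
  qed
  finally show ?thesis unfolding UN_grid_cell[OF N] .
qed

text \<open>Positivity and finiteness make the cube admissible for \<open>uniform_measure\<close>;
  the volume itself cancels by normalization.\<close>

lemma emeasure_cell_1: "emeasure lborel (cell 1 :: (real ^ 'n::finite) set) \<noteq> 0"
  "emeasure lborel (cell 1 :: (real ^ 'n::finite) set) \<noteq> \<infinity>"
proof -
  let ?Z = "0 :: real ^ 'n" and ?O = "\<chi> i. 1 :: real ^ 'n"
  have Z: "?Z = (\<chi> i. 0)" by (simp add: vec_eq_iff)
  have "box ?Z (\<chi> i. 1) \<noteq> {}"
    unfolding box_ne_empty Basis_vec_def by (auto simp: inner_axis)
  then have "emeasure lborel (box ?Z (\<chi> i. 1)) \<noteq> 0"
    by (simp add: emeasure_lborel_box_eq box_ne_empty prod_ennreal[symmetric] less_imp_le)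
       (auto simp: box_ne_empty Basis_vec_def inner_axis)
  moreover have "emeasure lborel (box ?Z (\<chi> i. 1)) \<le> emeasure lborel (cell 1 :: (real ^ 'n) set)"
    by (intro emeasure_mono) (auto simp: mem_box_cart cell_def less_imp_le)
  ultimately show "emeasure lborel (cell 1 :: (real ^ 'n) set) \<noteq> 0" by auto
  have "emeasure lborel (cell 1 :: (real ^ 'n) set) \<le> emeasure lborel (cbox ?Z (\<chi> i. 1))"
    by (intro emeasure_mono) (auto simp: mem_box_cart cell_def less_imp_le)
  also have "\<dots> < \<infinity>" by (rule emeasure_lborel_cbox_finite)
  finally show "emeasure lborel (cell 1 :: (real ^ 'n) set) \<noteq> \<infinity>" by simp
qed

lemma emeasure_cell:
  assumes N: "N > 0"
  shows "of_nat N ^ CARD('n) * emeasure lborel (cell N :: (real ^ 'n::finite) set) = emeasure lborel (cell 1 :: (real ^ 'n) set)"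
  using sum_grid_cell[OF N, of "UNIV :: (real ^ 'n) set"] by (simp add: card_grid)

text \<open>The position \<open>snd p\<close> is an unreduced integer vector whose law is known
  modulo \<open>N\<close> only. Averaging the indicator of a torus set over the offset in a cell
  gives a periodic function of the position, so \<open>law\<close> applies, and the tiling identity
  reassembles the cube.\<close>

lemma distr_grid_cell:
  fixes \<pi> :: "('a \<times> ('n::finite \<Rightarrow> int)) pmf"
  assumes N: "N > 0"
    and law: "\<And>\<psi>. periodic N \<psi> \<Longrightarrow> (\<integral>p. \<psi> (snd p) \<partial>\<pi>) = (\<Sum>x\<in>grid N. 1 / real N ^ CARD('n) * \<psi> x)"
  shows "prob_space (uniform_measure lborel (cell N :: (real ^ 'n) set))"
    "distr (measure_pmf \<pi> \<Otimes>\<^sub>M uniform_measure lborel (cell N)) borel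
      (\<lambda>w. torus_proj (grid_pt N (snd (fst w)) + snd w)) = (torus_uniform :: 'n torus measure)"
proof -
  let ?c = "emeasure lborel (cell N :: (real ^ 'n) set)" and ?c1 = "emeasure lborel (cell 1 :: (real ^ 'n) set)"
  let ?U = "uniform_measure lborel (cell N :: (real ^ 'n) set)"
  note c = emeasure_cell[OF N, where 'n = 'n] emeasure_cell_1[where 'n = 'n]
  have c0: "?c \<noteq> 0" "?c \<noteq> \<infinity>" using c N by (auto simp: ennreal_mult_eq_top_iff)
  then show ps: "prob_space ?U" by (intro prob_space_uniform_measure) auto
  interpret U: prob_space ?U by (rule ps)
  have z[measurable]: "(\<lambda>w. grid_pt N (snd (fst w)) + snd w) \<in> borel_measurable (measure_pmf \<pi> \<Otimes>\<^sub>M ?U)"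
  proof (rule borel_measurable_add)
    show "(\<lambda>w. grid_pt N (snd (fst w))) \<in> borel_measurable (measure_pmf \<pi> \<Otimes>\<^sub>M ?U)"
      by (rule measurable_compose[OF measurable_fst]) simp
    show "snd \<in> borel_measurable (measure_pmf \<pi> \<Otimes>\<^sub>M ?U)"
      using measurable_compose[OF measurable_snd, of "\<lambda>x. x" ?U borel "measure_pmf \<pi>"] by simp
  qed
  show "distr (measure_pmf \<pi> \<Otimes>\<^sub>M ?U) borel (\<lambda>w. torus_proj (grid_pt N (snd (fst w)) + snd w)) = torus_uniform" (is "?L = _")
  proof (rule measure_eqI)
    fix A assume "A \<in> sets ?L"
    then have A[measurable]: "A \<in> sets borel" by simp
    define E where "E = (torus_proj -` A :: (real ^ 'n) set)"
    have E[measurable]: "E \<in> sets borel"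
      using measurable_sets_borel[OF borel_measurable_torus_proj A] by (simp add: E_def)
    have shE[measurable]: "(\<lambda>u. grid_pt N g + u) -` E \<in> sets borel" for g
      using measurable_sets_borel[OF _ E, of "\<lambda>u. grid_pt N g + u"] by simp
    define \<psi> where "\<psi> g = measure ?U ((\<lambda>u. grid_pt N g + u) -` E)" for g
    have \<psi>: "ennreal (\<psi> g) = emeasure lborel (cell N \<inter> (\<lambda>u. grid_pt N g + u) -` E) / ?c" for g
      unfolding \<psi>_def U.emeasure_eq_measure[symmetric] by (subst emeasure_uniform_measure) auto
    have per: "periodic N \<psi>"
    proof -
      have "(\<lambda>u. grid_pt N (g(i := g i + int N * m)) + u) -` E = (\<lambda>u. grid_pt N g + u) -` E" for g i m
      proof -
        have "grid_pt N (g(i := g i + int N * m)) + u - (grid_pt N g + u) \<in> int_lattice" for u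
          using N by (auto simp: int_lattice_def grid_pt_def add_divide_distrib)
        then have "torus_proj (grid_pt N (g(i := g i + int N * m)) + u) = torus_proj (grid_pt N g + u)" for u
          by (rule torus_proj_eqI)
        then show ?thesis by (auto simp: E_def)
      qed
      then show ?thesis by (simp add: periodic_def \<psi>_def)
    qed
    have "emeasure ?L A = emeasure (measure_pmf \<pi> \<Otimes>\<^sub>M ?U) ((\<lambda>w. grid_pt N (snd (fst w)) + snd w) -` E \<inter> space (measure_pmf \<pi> \<Otimes>\<^sub>M ?U))"
      by (subst emeasure_distr) (auto simp: E_def vimage_def)
    also have "\<dots> = (\<integral>\<^sup>+p. emeasure ?U (Pair p -` ((\<lambda>w. grid_pt N (snd (fst w)) + snd w) -` E \<inter> space (measure_pmf \<pi> \<Otimes>\<^sub>M ?U))) \<partial>\<pi>)"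
      by (intro U.emeasure_pair_measure_alt measurable_sets[OF z E])
    also have "\<dots> = (\<integral>\<^sup>+p. ennreal (\<psi> (snd p)) \<partial>\<pi>)"
      by (intro nn_integral_cong) (simp add: \<psi>_def U.emeasure_eq_measure vimage_def space_pair_measure)
    also have "\<dots> = ennreal (\<integral>p. \<psi> (snd p) \<partial>\<pi>)"
      by (intro nn_integral_eq_integral measure_pmf.integrable_const_bound[where B = 1])
         (auto simp: \<psi>_def)
    also have "\<dots> = (\<Sum>g\<in>grid N. ennreal (1 / real N ^ CARD('n)) * ennreal (\<psi> g))"
      unfolding law[OF per]
      by (simp add: ennreal_mult'[symmetric] \<psi>_def)
    also have "\<dots> = (\<Sum>g\<in>grid N. emeasure lborel (cell N \<inter> (\<lambda>u. grid_pt N g + u) -` E)) * (ennreal (1 / real N ^ CARD('n)) / ?c)"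
      unfolding \<psi> sum_distrib_right
      by (intro sum.cong refl) (simp add: ennreal_times_divide mult_ac)
    also have "ennreal (1 / real N ^ CARD('n)) / ?c = 1 / ?c1"
    proof -
      obtain r where r: "?c = ennreal r" "r > 0"
        using c0 by (cases ?c) (auto simp: less_le)
      have "?c1 = ennreal (real N ^ CARD('n) * r)"
        unfolding c(1)[symmetric] using r by (simp add: ennreal_mult' ennreal_power ennreal_of_nat_eq_real_of_nat)
      with r N show ?thesis
        by (simp add: divide_ennreal ennreal_1[symmetric] del: ennreal_1)
    qed
    also have "(\<Sum>g\<in>grid N. emeasure lborel (cell N \<inter> (\<lambda>u. grid_pt N g + u) -` E)) = emeasure lborel (cell 1 \<inter> E)"
      by (rule sum_grid_cell[OF N E])
    also have "emeasure lborel (cell 1 \<inter> E) * (1 / ?c1) = emeasure (uniform_measure lborel (cell 1)) E"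
      by (subst emeasure_uniform_measure) (auto simp: ennreal_times_divide)
    also have "\<dots> = emeasure torus_uniform A"
      unfolding torus_uniform_def
      by (subst emeasure_distr) (auto simp: E_def cell_def)
    finally show "emeasure ?L A = emeasure torus_uniform A" .
  qed (simp add: torus_uniform_def)
qed

lemma ek_grid_pt_periodic:
  assumes "N > 0"
  shows "ek k (($) (grid_pt N (g(i := g i + int N * l)))) = ek k (($) (grid_pt N g))"
proof -
  have "(\<Sum>j\<in>UNIV. of_int (k j) * grid_pt N (g(i := g i + int N * l)) $ j)
     = (\<Sum>j\<in>UNIV. of_int (k j) * grid_pt N g $ j + (if j = i then of_int (k i * l) else 0))"
    using assms by (intro sum.cong) (auto simp: grid_pt_def field_simps)
  also have "\<dots> = (\<Sum>j\<in>UNIV. of_int (k j) * grid_pt N g $ j) + of_int (k i * l)"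
    by (simp add: sum.distrib)
  finally show ?thesis
    by (simp add: ek_def distrib_left cis_mult[symmetric] del: of_int_mult)
qed

text \<open>The flux solves the discrete Poisson equation: the multiplier \<open>m i k\<close> belongs to the backward
  difference in direction \<open>i\<close>, and \<open>v\<close> is its normalized conjugate, so that the sum of
  \<open>v i k * m i k\<close> over \<open>i\<close> equals \<open>1\<close>.\<close>

lemma flux_exists:
  fixes \<alpha> :: "('n::finite \<Rightarrow> int) \<Rightarrow> complex" and f :: "('n \<Rightarrow> int) \<Rightarrow> real" and N :: nat
  defines "u \<equiv> 1 / real N ^ CARD('n)"
  assumes N: "2 * R < int N" and R: "R \<ge> 0"
    and \<alpha>: "\<alpha> (\<lambda>_. 0) = 1" "\<And>k. norm (\<alpha> k) \<le> 1"
    and f: "\<And>g. complex_of_real (f g) = of_real u * (\<Sum>k\<in>freq_box R. \<alpha> k * ek k (($) (grid_pt N g)))"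
  obtains F :: "'n \<Rightarrow> ('n \<Rightarrow> int) \<Rightarrow> real" where
    "\<And>i. periodic N (F i)"
    "\<And>g. f g - u = (\<Sum>i\<in>UNIV. F i g - F i (shift (i, False) g))"
    "\<And>i g. \<bar>F i g\<bar> \<le> u * (real (card (freq_box R :: ('n \<Rightarrow> int) set)) * real N / 4)"
    "(\<Sum>g\<in>grid N. \<Sum>i\<in>UNIV. (F i g)\<^sup>2) / u \<le>
      (real N)\<^sup>2 / 16 * (\<Sum>k\<in>freq_box R - {\<lambda>_. 0}. (norm (\<alpha> k))\<^sup>2 / (\<Sum>i\<in>UNIV. (of_int (k i))\<^sup>2))"
proof -
  have N0: "N > 0" using N R by auto
  have u: "u > 0" using N0 by (simp add: u_def)
  define B where "B = (freq_box R - {\<lambda>_. 0} :: ('n \<Rightarrow> int) set)"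
  define m where "m i k = 1 - cis (- (2 * pi * of_int (k i) / real N))" for i and k :: "'n \<Rightarrow> int"
  define v where "v i k = cnj (m i k) / of_real (\<Sum>l\<in>UNIV. (norm (m l k))\<^sup>2)" for i k
  define n2 where "n2 k = (\<Sum>i\<in>UNIV. (real_of_int (k i))\<^sup>2)" for k :: "'n \<Rightarrow> int"
  \<comment> \<open>Every coefficient is divided by the symbol of the discrete Laplacian. Taking
    real parts is harmless, because \<open>f\<close> is real and the difference operators have real
    coefficients.\<close>
  define F where "F i g = u * Re (\<Sum>k\<in>B. \<alpha> k * v i k * ek k (($) (grid_pt N g)))" for i g
  \<comment> \<open>In the box the ratio of frequency to \<open>N\<close> is at most 1 / 2, the
    range of the cosine estimate. The discrete Laplacian thus dominates a multiple of the continuous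
    one, and the 16 reappears in the energy bound.\<close>
  have m_ge: "16 * (of_int (k i))\<^sup>2 / (real N)\<^sup>2 \<le> (norm (m i k))\<^sup>2" if "k \<in> B" for i k
  proof -
    let ?x = "real_of_int (k i) / real N"
    have "\<bar>k i\<bar> \<le> R" using that by (auto simp: B_def freq_box_def)
    then have "2 * \<bar>k i\<bar> < int N" using N by linarith
    then have "2 * \<bar>real_of_int (k i)\<bar> \<le> real N" by linarith
    then have "\<bar>?x\<bar> \<le> 1 / 2" using N0 by (simp add: field_simps)
    from one_minus_cos_ge[OF this] have "16 * ?x\<^sup>2 \<le> 2 - 2 * cos (2 * pi * ?x)" by simp
    also have "\<dots> = (norm (m i k))\<^sup>2"
    proof -
      have "(norm (1 - cis (- t)))\<^sup>2 = (1 - cos t)\<^sup>2 + (sin t)\<^sup>2" for t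
        by (simp add: cmod_power2)
      also have "(1 - cos t)\<^sup>2 + (sin t)\<^sup>2 = 2 - 2 * cos t" for t :: real
        using sin_cos_squared_add[of t] by (simp add: power2_diff)
      finally show ?thesis by (simp add: m_def)
    qed
    finally show ?thesis by (simp add: power_divide)
  qed
  have n2_ge: "n2 k \<ge> 1" if "k \<in> B" for k
    using that sum_squares_int_ge_1[of k] by (simp add: B_def n2_def)
  define S where "S k = (\<Sum>l\<in>UNIV. (norm (m l k))\<^sup>2)" for k
  have S_ge: "16 * n2 k / (real N)\<^sup>2 \<le> S k" if "k \<in> B" for k
  proof -
    have "(\<Sum>i\<in>UNIV. 16 * (of_int (k i))\<^sup>2 / (real N)\<^sup>2) \<le> S k"
      unfolding S_def by (intro sum_mono m_ge that)
    then show ?thesis by (simp add: n2_def sum_divide_distrib sum_distrib_left)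
  qed
  have S0: "S k > 0" if "k \<in> B" for k
  proof -
    have "0 < 16 * n2 k / (real N)\<^sup>2" using n2_ge[OF that] N0 by simp
    then show ?thesis using S_ge[OF that] by linarith
  qed
  have v2: "(\<Sum>i\<in>UNIV. (norm (v i k))\<^sup>2) \<le> (real N)\<^sup>2 / (16 * n2 k)" if "k \<in> B" for k
  proof -
    have "(\<Sum>i\<in>UNIV. (norm (v i k))\<^sup>2) = S k / (S k)\<^sup>2"
      by (simp add: v_def S_def[symmetric] norm_divide power_divide sum_divide_distrib[symmetric] del: of_real_sum)
    also have "\<dots> = 1 / S k" using S0[OF that] by (simp add: power2_eq_square)
    also have "\<dots> \<le> 1 / (16 * n2 k / (real N)\<^sup>2)"
      using S_ge[OF that] n2_ge[OF that] N0 S0[OF that] by (intro divide_left_mono) auto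
    finally show ?thesis by simp
  qed
  have v_le: "norm (v i k) \<le> real N / 4" if "k \<in> B" for i k
  proof -
    have "(norm (v i k))\<^sup>2 \<le> (\<Sum>i\<in>UNIV. (norm (v i k))\<^sup>2)" by (rule member_le_sum) auto
    also have "\<dots> \<le> (real N)\<^sup>2 / (16 * n2 k)" by (rule v2[OF that])
    also have "\<dots> \<le> (real N)\<^sup>2 / 16" using n2_ge[OF that] by (intro divide_left_mono) auto
    also have "\<dots> = (real N / 4)\<^sup>2" by (simp add: power_divide)
    finally show ?thesis by (rule power2_le_imp_le) simp
  qed
  have summand_le: "norm (\<alpha> k * v i k * ek k z) \<le> real N / 4" if "k \<in> B" for i k z
    using mult_mono[OF \<alpha>(2)[of k] v_le[OF that, of i]] by (simp add: norm_mult)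
  show ?thesis
  proof (rule that[of F])
    show "periodic N (F i)" for i by (simp add: periodic_def F_def ek_grid_pt_periodic[OF N0])
    \<comment> \<open>This is crude in the number of frequencies. The supremum serves to fix the
      number of chain steps and the fineness of the mesh, and both drop out of the final
      bound.\<close>
    show "\<bar>F i g\<bar> \<le> u * (real (card (freq_box R :: ('n \<Rightarrow> int) set)) * real N / 4)" for i g
    proof -
      have "\<bar>Re (\<Sum>k\<in>B. \<alpha> k * v i k * ek k (($) (grid_pt N g)))\<bar> \<le> (\<Sum>k\<in>B. real N / 4)"
        by (rule order_trans[OF abs_Re_le_cmod]) (intro order_trans[OF norm_sum] sum_mono summand_le)
      also have "\<dots> = real (card B) * (real N / 4)" by simp
      also have "\<dots> \<le> real (card (freq_box R :: ('n \<Rightarrow> int) set)) * (real N / 4)"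
        unfolding B_def by (intro mult_right_mono of_nat_mono card_mono finite_freq_box) auto
      finally show ?thesis using u by (simp add: F_def abs_mult)
    qed
    show "f g - u = (\<Sum>i\<in>UNIV. F i g - F i (shift (i, False) g))" for g
    proof -
      have sh: "ek k (($) (grid_pt N (shift (i, False) g))) = ek k (($) (grid_pt N g)) * (1 - m i k)" for k :: "'n \<Rightarrow> int" and i
      proof -
        have "(\<Sum>j\<in>UNIV. of_int (k j) * grid_pt N (shift (i, False) g) $ j)
           = (\<Sum>j\<in>UNIV. of_int (k j) * grid_pt N g $ j - (if j = i then of_int (k i) / real N else 0))"
          by (intro sum.cong) (auto simp: grid_pt_def shift_def diff_divide_distrib algebra_simps)
        also have "\<dots> = (\<Sum>j\<in>UNIV. of_int (k j) * grid_pt N g $ j) - of_int (k i) / real N"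
          by (simp add: sum_subtractf)
        finally show ?thesis by (simp add: ek_def right_diff_distrib m_def cis_mult)
      qed
      have "(\<Sum>i\<in>UNIV. F i g - F i (shift (i, False) g))
          = u * Re (\<Sum>i\<in>UNIV. \<Sum>k\<in>B. \<alpha> k * ek k (($) (grid_pt N g)) * (v i k * m i k))"
      proof -
        have "F i g - F i (shift (i, False) g) = u * Re (\<Sum>k\<in>B. \<alpha> k * ek k (($) (grid_pt N g)) * (v i k * m i k))" for i
        proof -
          have "(\<Sum>k\<in>B. \<alpha> k * v i k * ek k (($) (grid_pt N g))) - (\<Sum>k\<in>B. \<alpha> k * v i k * (ek k (($) (grid_pt N g)) * (1 - m i k)))
             = (\<Sum>k\<in>B. \<alpha> k * ek k (($) (grid_pt N g)) * (v i k * m i k))"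
            unfolding sum_subtractf[symmetric] by (intro sum.cong) (auto simp: algebra_simps)
          from arg_cong[OF this, of "\<lambda>z. u * Re z"] show ?thesis
            by (simp only: F_def sh right_diff_distrib minus_complex.sel)
        qed
        then show ?thesis by (simp only: sum_distrib_left Re_sum)
      qed
      also have "(\<Sum>i\<in>UNIV. \<Sum>k\<in>B. \<alpha> k * ek k (($) (grid_pt N g)) * (v i k * m i k))
          = (\<Sum>k\<in>B. \<alpha> k * ek k (($) (grid_pt N g)) * (\<Sum>i\<in>UNIV. v i k * m i k))"
        by (subst sum.swap) (simp add: sum_distrib_left)
      also have "\<dots> = (\<Sum>k\<in>B. \<alpha> k * ek k (($) (grid_pt N g)))"
      proof (rule sum.cong[OF refl])
        fix k assume k: "k \<in> B"
        have "v i k * m i k = of_real ((norm (m i k))\<^sup>2) / of_real (S k)" for i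
          unfolding complex_norm_square by (simp add: v_def S_def mult.commute)
        then have "(\<Sum>i\<in>UNIV. v i k * m i k) = of_real (S k) / of_real (S k)"
          by (simp add: S_def sum_divide_distrib[symmetric])
        then show "\<alpha> k * ek k (($) (grid_pt N g)) * (\<Sum>i\<in>UNIV. v i k * m i k) = \<alpha> k * ek k (($) (grid_pt N g))"
          using S0[OF k] by simp
      qed
      finally have "(\<Sum>i\<in>UNIV. F i g - F i (shift (i, False) g)) = u * Re (\<Sum>k\<in>B. \<alpha> k * ek k (($) (grid_pt N g)))" .
      moreover have "(\<Sum>k\<in>freq_box R. \<alpha> k * ek k (($) (grid_pt N g))) = 1 + (\<Sum>k\<in>B. \<alpha> k * ek k (($) (grid_pt N g)))"
        unfolding B_def using R by (subst sum.remove[OF finite_freq_box, of "\<lambda>_. 0"]) (auto simp: \<alpha> freq_box_def)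
      ultimately show ?thesis
        using arg_cong[OF f[of g], of Re] by (simp add: distrib_left del: Re_sum)
    qed
    have "(\<Sum>g\<in>grid N. \<Sum>i\<in>UNIV. (F i g)\<^sup>2) \<le> (\<Sum>g\<in>grid N. \<Sum>i\<in>UNIV. u\<^sup>2 * (norm (\<Sum>k\<in>B. \<alpha> k * v i k * ek k (($) (grid_pt N g))))\<^sup>2)"
      unfolding F_def power_mult_distrib
      by (intro sum_mono mult_left_mono) (auto intro!: abs_le_square_iff[THEN iffD1] simp: abs_Re_le_cmod simp del: Re_sum)
    also have "\<dots> = (\<Sum>i\<in>UNIV. u\<^sup>2 * (\<Sum>g\<in>grid N. (norm (\<Sum>k\<in>B. \<alpha> k * v i k * ek k (($) (grid_pt N g))))\<^sup>2))"
      by (subst sum.swap) (simp add: sum_distrib_left)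
    also have "\<dots> = (\<Sum>i\<in>UNIV. u\<^sup>2 * (real N ^ CARD('n) * (\<Sum>k\<in>B. (norm (\<alpha> k * v i k))\<^sup>2)))"
    proof (intro sum.cong refl arg_cong2[where f = "(*)"])
      fix i
      have "($) (grid_pt N g) = (\<lambda>i. of_int (g i) / real N)" for g :: "'n \<Rightarrow> int"
        by (simp add: grid_pt_def fun_eq_iff)
      then show "(\<Sum>g\<in>grid N. (norm (\<Sum>k\<in>B. \<alpha> k * v i k * ek k (($) (grid_pt N g))))\<^sup>2)
          = real N ^ CARD('n) * (\<Sum>k\<in>B. (norm (\<alpha> k * v i k))\<^sup>2)"
        using parseval_grid[OF N0 N, of B "\<lambda>k. \<alpha> k * v i k"] by (simp add: B_def)
    qed
    also have "\<dots> = (\<Sum>i\<in>UNIV. u * (\<Sum>k\<in>B. (norm (\<alpha> k * v i k))\<^sup>2))"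
      using N0 by (simp add: u_def power2_eq_square)
    also have "\<dots> = u * (\<Sum>k\<in>B. (norm (\<alpha> k))\<^sup>2 * (\<Sum>i\<in>UNIV. (norm (v i k))\<^sup>2))"
      unfolding sum_distrib_left by (subst sum.swap) (simp add: norm_mult power_mult_distrib)
    finally have "(\<Sum>g\<in>grid N. \<Sum>i\<in>UNIV. (F i g)\<^sup>2) / u \<le> (\<Sum>k\<in>B. (norm (\<alpha> k))\<^sup>2 * (\<Sum>i\<in>UNIV. (norm (v i k))\<^sup>2))"
      using u by (simp add: field_simps)
    also have "\<dots> \<le> (\<Sum>k\<in>B. (norm (\<alpha> k))\<^sup>2 * ((real N)\<^sup>2 / (16 * n2 k)))"
      by (intro sum_mono mult_left_mono v2) auto
    also have "\<dots> = (real N)\<^sup>2 / 16 * (\<Sum>k\<in>B. (norm (\<alpha> k))\<^sup>2 / n2 k)"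
      unfolding sum_distrib_left by (intro sum.cong) auto
    finally show "(\<Sum>g\<in>grid N. \<Sum>i\<in>UNIV. (F i g)\<^sup>2) / u \<le>
      (real N)\<^sup>2 / 16 * (\<Sum>k\<in>freq_box R - {\<lambda>_. 0}. (norm (\<alpha> k))\<^sup>2 / (\<Sum>i\<in>UNIV. (of_int (k i))\<^sup>2))"
      by (simp add: B_def n2_def)
  qed
qed

text \<open>Sums over the grid integrate trigonometric polynomials of degree below \<open>N\<close>
  exactly, and the product here has degree at most 2 M + 1. Only the coefficient at - l survives,
  whatever the shift \<open>y\<close>; l = 0 gives the mass of the kernel and l = 1 its cosine
  moment.\<close>

lemma sum_trig_poly_grid:
  fixes q :: "int \<Rightarrow> real" and Q :: "real \<Rightarrow> real"
  assumes Q: "\<And>z. (\<Sum>k\<in>{- 2 * int M..2 * int M}. of_real (q k) * cis (2 * pi * of_int k * z)) = complex_of_real (Q z)"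
    and q: "\<And>k. q (- k) = q k" and N: "2 * int M + 1 < int N" and l: "0 \<le> l" "l \<le> 2 * int M" "l \<le> 1"
  shows "(\<Sum>x\<in>{0..<int N}. of_real (Q (of_int x / real N - y)) * cis (2 * pi * of_int l * (of_int x / real N - y)))
    = complex_of_real (real N * q l)"
proof -
  let ?K = "{- 2 * int M..2 * int M}"
  have N0: "N > 0" using N by simp
  have e: "cis (2 * pi * of_int k * (t - y)) * cis (2 * pi * of_int l * (t - y))
     = cis (- (2 * pi * of_int (k + l) * y)) * cis (2 * pi * of_int (k + l) * t)" for k t
    by (simp add: cis_mult algebra_simps)
  have "(\<Sum>x\<in>{0..<int N}. of_real (Q (of_int x / real N - y)) * cis (2 * pi * of_int l * (of_int x / real N - y)))
    = (\<Sum>x\<in>{0..<int N}. \<Sum>k\<in>?K. of_real (q k) * cis (- (2 * pi * of_int (k + l) * y)) * cis (2 * pi * of_int (k + l) * (of_int x / real N)))"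
    unfolding Q[symmetric] sum_distrib_right by (simp only: mult.assoc[where 'a = complex] e)
  also have "\<dots> = (\<Sum>k\<in>?K. of_real (q k) * cis (- (2 * pi * of_int (k + l) * y)) *
       (\<Sum>x\<in>{0..<int N}. cis (2 * pi * of_int (k + l) * (of_int x / real N))))"
    by (subst sum.swap) (simp only: sum_distrib_left)
  also have "\<dots> = (\<Sum>k\<in>?K. if k = - l then of_real (q k) * of_nat N else 0)"
  proof (rule sum.cong[OF refl])
    fix k assume k: "k \<in> ?K"
    have "int N dvd k + l \<longleftrightarrow> k = - l"
    proof
      assume "int N dvd k + l"
      moreover have "\<bar>k + l\<bar> < int N" using k l N by auto
      ultimately have "k + l = 0" using dvd_imp_le_int by force
      then show "k = - l" by simp
    qed auto
    then show "of_real (q k) * cis (- (2 * pi * of_int (k + l) * y)) *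
       (\<Sum>x\<in>{0..<int N}. cis (2 * pi * of_int (k + l) * (of_int x / real N))) = (if k = - l then of_real (q k) * of_nat N else 0)"
      unfolding sum_cis_int[OF N0] by auto
  qed
  also have "\<dots> = complex_of_real (real N * q l)"
    using l by (simp add: q mult.commute)
  finally show ?thesis .
qed

lemma norm_grid_pt_diff:
  assumes "N > 0"
  shows "(norm (grid_pt N g - grid_pt N h))\<^sup>2 = (\<Sum>i\<in>UNIV. (of_int (h i - g i))\<^sup>2) / (real N)\<^sup>2"
proof -
  have "(norm (grid_pt N g - grid_pt N h))\<^sup>2 = (\<Sum>i\<in>UNIV. (of_int (g i) / real N - of_int (h i) / real N)\<^sup>2)"
    by (simp add: norm_vec_def L2_set_def sum_nonneg grid_pt_def)
  also have "\<dots> = (\<Sum>i\<in>UNIV. (of_int (h i - g i))\<^sup>2 / (real N)\<^sup>2)"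
    by (intro sum.cong) (simp_all add: diff_divide_distrib[symmetric] power_divide power2_commute[of "of_int (g _)"])
  finally show ?thesis by (simp add: sum_divide_distrib)
qed

lemma norm_cell_le:
  fixes u :: "real ^ 'n::finite"
  assumes "u \<in> cell N"
  shows "norm u \<le> real CARD('n) / real N"
proof -
  have "norm u \<le> (\<Sum>i\<in>UNIV. \<bar>u $ i\<bar>)" by (rule norm_le_l1_cart)
  also have "\<dots> \<le> (\<Sum>i\<in>(UNIV :: 'n set). 1 / real N)"
    using assms by (intro sum_mono) (auto simp: cell_def less_imp_le)
  finally show ?thesis by simp
qed

text \<open>The displacement has three parts: from the sample to a random grid point, along the
  chain, and from its end to a uniform point of the cell. They contribute d, exp 3 and 1 to the
  constant; the outer 3 comes from (a + b + c)^2 \<le> 3 (a^2 + b^2 + c^2).\<close>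

lemma W2_empirical_le:
  fixes x :: "nat \<Rightarrow> real ^ 'n::finite"
  assumes n: "n \<ge> 1" and M: "M \<ge> 1"
  shows "W2 (empirical_measure n (\<lambda>j. torus_proj (x j))) torus_uniform \<le>
    sqrt (3 * (real CARD('n) + exp 3 + 1) * (1 / (real M)\<^sup>2 +
      (\<Sum>k\<in>freq_box (2 * int M) - {\<lambda>_. 0}.
        (norm (1 / of_nat n * (\<Sum>j = 1..n. ek k (($) (x j)))))\<^sup>2 / (\<Sum>i\<in>UNIV. (of_int (k i))\<^sup>2))))"
proof -
  define d where "d = real CARD('n)"
  define R where "R = 2 * int M"
  define cb where "cb = real (card (freq_box R :: ('n \<Rightarrow> int) set))"
  define c where "c k = 1 / of_nat n * (\<Sum>j = 1..n. ek k (($) (x j)))" for k :: "'n \<Rightarrow> int"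
  define \<Sigma> where "\<Sigma> = (\<Sum>k\<in>freq_box R - {\<lambda>_. 0}. (norm (c k))\<^sup>2 / (\<Sum>i\<in>UNIV. (of_int (k i))\<^sup>2))"
  have \<Sigma>0: "\<Sigma> \<ge> 0" unfolding \<Sigma>_def by (intro sum_nonneg divide_nonneg_nonneg) auto
  have d1: "d \<ge> 1" unfolding d_def using one_le_card_finite[where 'a = 'n] by linarith
  have n0: "real n > 0" using n by simp
  obtain q Q where q: "q 0 = 1" "\<And>k. \<bar>q k\<bar> \<le> 1" "\<And>k. q (- k) = q k" "1 - q 1 \<le> 3 / (real M)\<^sup>2"
    and Q0: "\<And>z. 0 \<le> Q z"
    and Q: "\<And>z. (\<Sum>k\<in>{- 2 * int M..2 * int M}. of_real (q k) * cis (2 * pi * of_int k * z)) = complex_of_real (Q z)"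
    by (rule ex_smoothing_kernel[OF M]) (rule that; assumption)
  \<comment> \<open>The mesh is chosen after \<open>M\<close>. The first term pushes the jump
    variance below 1 / M^2, the second bounds the displacement inside a cell by 1 / M, and the last
    ones exclude aliasing among frequencies up to 2 M.\<close>
  obtain N0 :: nat where N0: "real N0 \<ge> d * cb * (real M)\<^sup>2 + d * real M + 4 * real M + 2"
    using real_arch_simple by blast
  define N where "N = N0"
  have cb0: "cb \<ge> 0" by (simp add: cb_def)
  have N: "real N \<ge> d * cb * (real M)\<^sup>2" "real N \<ge> d * real M" "real N \<ge> 4 * real M + 2"
    using N0 cb0 d1 by (auto simp: N_def intro: order_trans[rotated])
  have Npos: "N > 0" using N(3) by (auto intro!: Nat.gr0I)
  have NR: "2 * R < int N" "2 * int M + 1 < int N" using N(3) by (auto simp: R_def)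
  define u where "u = 1 / real N ^ CARD('n)"
  have u0: "u > 0" using Npos by (simp add: u_def)
  define f where "f g = (\<Sum>j = 1..n. u * (\<Prod>i\<in>UNIV. Q (of_int (g i) / real N - x j $ i))) / real n" for g
  \<comment> \<open>Fourier coefficients of the smoothed density; the conjugate appears because the
    kernel is evaluated at grid point minus sample.\<close>
  define \<alpha> where "\<alpha> k = of_real (\<Prod>i\<in>UNIV. q (k i)) * cnj (c k)" for k :: "'n \<Rightarrow> int"
  have cnorm: "norm (c k) \<le> 1" for k
  proof -
    have "norm (\<Sum>j = 1..n. ek k (($) (x j))) \<le> real n"
      using norm_sum[of "\<lambda>j. ek k (($) (x j))" "{1..n}"] by simp
    then show ?thesis using n0 by (simp add: c_def norm_mult norm_divide)
  qed
  have \<alpha>c: "norm (\<alpha> k) \<le> norm (c k)" for k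
  proof -
    have "\<bar>\<Prod>i\<in>UNIV. q (k i)\<bar> \<le> 1" unfolding abs_prod by (intro prod_le_1) (auto simp: q)
    from mult_right_mono[OF this norm_ge_zero[of "c k"]] show ?thesis
      by (simp add: \<alpha>_def norm_mult abs_prod del: of_real_prod)
  qed
  have \<alpha>0: "\<alpha> (\<lambda>_. 0) = 1" using n by (simp add: \<alpha>_def c_def q)
  have fourier: "complex_of_real (f g) = of_real u * (\<Sum>k\<in>freq_box R. \<alpha> k * ek k (($) (grid_pt N g)))" for g
  proof -
    have prodQ: "complex_of_real (\<Prod>i\<in>UNIV. Q (z i)) = (\<Sum>k\<in>freq_box R. of_real (\<Prod>i\<in>UNIV. q (k i)) * ek k z)" for z :: "'n \<Rightarrow> real"
      unfolding of_real_prod Q[symmetric] freq_box_eq_PiE R_def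
      by (subst prod_sum_PiE) (auto simp: ek_eq_prod prod.distrib)
    have "complex_of_real (f g) = of_real u * (\<Sum>j = 1..n. complex_of_real (\<Prod>i\<in>UNIV. Q (grid_pt N g $ i - x j $ i))) / of_nat n"
      by (simp add: f_def sum_distrib_left grid_pt_def)
    also have "(\<Sum>j = 1..n. complex_of_real (\<Prod>i\<in>UNIV. Q (grid_pt N g $ i - x j $ i)))
       = (\<Sum>k\<in>freq_box R. \<Sum>j = 1..n. of_real (\<Prod>i\<in>UNIV. q (k i)) * (ek k (($) (grid_pt N g)) * cnj (ek k (($) (x j)))))"
      unfolding prodQ ek_diff by (rule sum.swap)
    finally show ?thesis
      by (simp add: \<alpha>_def c_def sum_distrib_left sum_divide_distrib mult_ac)
  qed
  have f0: "0 \<le> f g" for g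
    unfolding f_def using u0 Q0 by (intro divide_nonneg_nonneg sum_nonneg mult_nonneg_nonneg prod_nonneg) auto
  have perf: "periodic N f"
  proof -
    have "complex_of_real (f (g(i := g i + int N * m))) = complex_of_real (f g)" for g i m
      unfolding fourier ek_grid_pt_periodic[OF Npos] ..
    then show ?thesis by (simp add: periodic_def)
  qed
  obtain F where F: "\<And>i. periodic N (F i)"
    "\<And>g. f g - u = (\<Sum>i\<in>UNIV. F i g - F i (shift (i, False) g))"
    "\<And>i g. \<bar>F i g\<bar> \<le> u * (cb * real N / 4)"
    "(\<Sum>g\<in>grid N. \<Sum>i\<in>UNIV. (F i g)\<^sup>2) / u \<le>
      (real N)\<^sup>2 / 16 * (\<Sum>k\<in>freq_box R - {\<lambda>_. 0}. (norm (\<alpha> k))\<^sup>2 / (\<Sum>i\<in>UNIV. (of_int (k i))\<^sup>2))"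
  proof (rule flux_exists[of R N \<alpha> f])
    show "2 * R < int N" by (rule NR)
    show "R \<ge> 0" by (simp add: R_def)
    show "\<alpha> (\<lambda>_. 0) = 1" by (rule \<alpha>0)
    show "norm (\<alpha> k) \<le> 1" for k using \<alpha>c cnorm order_trans by blast
    show "complex_of_real (f g) = of_real (1 / real N ^ CARD('n)) * (\<Sum>k\<in>freq_box R. \<alpha> k * ek k (($) (grid_pt N g)))" for g
      using fourier by (simp only: u_def)
  qed (unfold u_def[symmetric] cb_def[symmetric], rule that)
  have F4: "(\<Sum>g\<in>grid N. \<Sum>i\<in>UNIV. (F i g)\<^sup>2) / u \<le> (real N)\<^sup>2 / 16 * \<Sigma>"
    unfolding \<Sigma>_def
    by (rule order_trans[OF F(4)]) (intro mult_left_mono sum_mono divide_right_mono power_mono \<alpha>c, auto intro: sum_nonneg)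
  have F1: "(\<Sum>g\<in>grid N. \<Sum>i\<in>UNIV. \<bar>F i g\<bar>) \<le> d * cb * real N / 4"
  proof -
    have "(\<Sum>g\<in>grid N. \<Sum>i\<in>UNIV. \<bar>F i g\<bar>) \<le> (\<Sum>g\<in>(grid N :: ('n \<Rightarrow> int) set). \<Sum>i\<in>(UNIV :: 'n set). u * (cb * real N / 4))"
      by (intro sum_mono F)
    also have "\<dots> = d * cb * real N / 4"
      using Npos by (simp add: card_grid u_def d_def)
    finally show ?thesis .
  qed
  \<comment> \<open>From \<open>k\<^sub>0\<close> on the jump probabilities are admissible. Ending
    the schedule at \<open>k\<^sub>0 * M\<close> gives the uniform law the starting weight s = 1 /
    M^2, and inserting this share at once costs O(1 / M^2), since the torus is bounded.\<close>
  define k\<^sub>0 where "k\<^sub>0 = Suc (nat \<lceil>6 * d * (cb * real N / 4)\<rceil>)"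
  define s where "s = 1 / (real M)\<^sup>2"
  have k0: "6 * real CARD('n) * (u * (cb * real N / 4)) \<le> real k\<^sub>0 * u"
  proof -
    have "6 * d * (cb * real N / 4) \<le> real k\<^sub>0"
      unfolding k\<^sub>0_def by (simp add: le_SucI) linarith
    from mult_right_mono[OF this less_imp_le[OF u0]] show ?thesis by (simp add: d_def mult_ac)
  qed
  have s: "(real k\<^sub>0 / real (k\<^sub>0 * M))\<^sup>2 = s"
  proof -
    have "k\<^sub>0 > 0" by (simp add: k\<^sub>0_def)
    then show ?thesis by (simp add: s_def power_divide power_mult_distrib)
  qed
  have s01: "0 \<le> s" "s \<le> 1" using M by (auto simp: s_def divide_le_eq_1)
  let ?A = "{1..n} \<times> (grid N :: ('n \<Rightarrow> int) set)"
  define K where "K j g = (\<Prod>i\<in>UNIV. Q (of_int (g i) / real N - x j $ i))" for j and g :: "'n \<Rightarrow> int"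
  have K0: "K j g \<ge> 0" for j g unfolding K_def by (intro prod_nonneg) (auto simp: Q0)
  \<comment> \<open>Joint weights of a sample index and a starting grid point: given the index, the
    point follows the kernel around the sample with weight 1 - s and the uniform law with weight
    s.\<close>
  define w where "w a = ((1 - s) * u * K (fst a) (snd a) + s * u) / real n" for a
  have sumQ: "(\<Sum>t\<in>{0..<int N}. Q (of_int t / real N - y)) = real N" for y
  proof -
    have "complex_of_real (\<Sum>t\<in>{0..<int N}. Q (of_int t / real N - y)) = complex_of_real (real N)"
      using sum_trig_poly_grid[OF Q q(3) NR(2), of 0 y] by (simp add: q)
    then show ?thesis by (simp only: of_real_eq_iff)
  qed
  have sumQc: "(\<Sum>t\<in>{0..<int N}. Q (of_int t / real N - y) * (1 - cos (2 * pi * (y - of_int t / real N)))) = real N * (1 - q 1)" for y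
  proof -
    have "(\<Sum>t\<in>{0..<int N}. Q (of_int t / real N - y) * cos (2 * pi * (of_int t / real N - y))) = real N * q 1"
      using arg_cong[OF sum_trig_poly_grid[OF Q q(3) NR(2), of 1 y], of Re] M by simp
    moreover have "cos (2 * pi * (y - of_int t / real N)) = cos (2 * pi * (of_int t / real N - y))" for t :: int
      by (metis cos_minus minus_diff_eq mult_minus_right)
    ultimately show ?thesis using sumQ[of y] by (simp add: algebra_simps sum_subtractf)
  qed
  have sumK: "(\<Sum>g\<in>grid N. u * K j g) = 1" for j
  proof -
    have "(\<Sum>g\<in>grid N. K j g) = (\<Prod>i\<in>(UNIV :: 'n set). real N)"
      unfolding K_def grid_eq_PiE by (subst prod_sum_PiE[symmetric]) (auto simp: sumQ)
    then show ?thesis using Npos by (simp add: sum_divide_distrib[symmetric] u_def)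
  qed
  have sumKc: "(\<Sum>g\<in>grid N. u * K j g * (1 - cos (2 * pi * (x j $ i - grid_pt N g $ i)))) = 1 - q 1" for j i
  proof -
    have "(\<Sum>g\<in>grid N. K j g * (1 - cos (2 * pi * (x j $ i - grid_pt N g $ i))))
       = (\<Sum>g\<in>grid N. \<Prod>l\<in>UNIV. Q (of_int (g l) / real N - x j $ l) * (if l = i then 1 - cos (2 * pi * (x j $ l - of_int (g l) / real N)) else 1))"
      by (simp add: K_def prod.distrib grid_pt_def)
    also have "\<dots> = (\<Prod>l\<in>UNIV. \<Sum>t\<in>{0..<int N}. Q (of_int t / real N - x j $ l) * (if l = i then 1 - cos (2 * pi * (x j $ l - of_int t / real N)) else 1))"
      unfolding grid_eq_PiE by (subst prod_sum_PiE) auto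
    also have "\<dots> = (\<Prod>l\<in>UNIV. real N * (if l = i then 1 - q 1 else 1))"
      by (intro prod.cong refl) (simp add: sumQ sumQc)
    also have "\<dots> = real N ^ CARD('n) * (1 - q 1)"
      by (simp add: prod.distrib)
    finally have "(\<Sum>g\<in>grid N. K j g * (1 - cos (2 * pi * (x j $ i - grid_pt N g $ i)))) = real N ^ CARD('n) * (1 - q 1)" .
    then show ?thesis using Npos by (simp add: sum_divide_distrib[symmetric] u_def)
  qed
  have sumw: "(\<Sum>g\<in>grid N. w (j, g)) = 1 / real n" for j
  proof -
    have "(\<Sum>g\<in>grid N. w (j, g)) = ((1 - s) * (\<Sum>g\<in>grid N. u * K j g) + (\<Sum>g\<in>(grid N :: ('n \<Rightarrow> int) set). s * u)) / real n"
      by (simp add: w_def sum_divide_distrib[symmetric] sum.distrib sum_distrib_left mult.assoc)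
    also have "(\<Sum>g\<in>(grid N :: ('n \<Rightarrow> int) set). s * u) = s" using Npos by (simp add: card_grid u_def)
    finally show ?thesis by (simp add: sumK)
  qed
  have finA: "finite ?A" by (simp add: finite_grid)
  have "\<exists>p. set_pmf p \<subseteq> ?A \<and> (\<forall>a\<in>?A. pmf p a = w a)"
  proof (rule ex_pmf_of_weights[OF finA])
    show "0 \<le> w a" for a using s01 u0 K0 by (simp add: w_def)
    have "sum w ?A = (\<Sum>j = 1..n. \<Sum>g\<in>grid N. w (j, g))" by (simp add: sum.cartesian_product)
    then show "sum w ?A = 1" using n by (simp add: sumw)
  qed
  then obtain p where p: "set_pmf p \<subseteq> ?A" "\<And>a. a \<in> ?A \<Longrightarrow> pmf p a = w a" by blast
  have Ep: "(\<integral>a. h a \<partial>p) = (\<Sum>j = 1..n. \<Sum>g\<in>grid N. h (j, g) * w (j, g))" for h :: "_ \<Rightarrow> real"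
  proof -
    have "(\<integral>a. h a \<partial>p) = (\<Sum>a\<in>?A. h a * pmf p a)"
      using p(1) by (intro integral_measure_pmf_real finA) auto
    also have "\<dots> = (\<Sum>a\<in>?A. h a * w a)" by (intro sum.cong refl) (simp add: p(2))
    finally show ?thesis by (simp add: sum.cartesian_product)
  qed
  have pfst: "map_pmf fst p = pmf_of_set {1..n}"
  proof (rule pmf_eqI)
    fix j
    have "pmf (map_pmf fst p) j = measure (measure_pmf p) (fst -` {j})" by (rule pmf_map)
    also have "\<dots> = (\<integral>a. indicator (fst -` {j}) a \<partial>p)" by simp
    also have "\<dots> = (\<Sum>i = 1..n. if i = j then \<Sum>g\<in>grid N. w (i, g) else 0)"
      unfolding Ep by (intro sum.cong) (auto simp: indicator_def)
    also have "\<dots> = pmf (pmf_of_set {1..n}) j"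
      using n by (simp add: sumw indicator_def)
    finally show "pmf (map_pmf fst p) j = pmf (pmf_of_set {1..n}) j" .
  qed
  \<comment> \<open>The label carried by the chain is the pair of sample index and starting point;
    \<open>snd\<close> of the label recovers the start and plays the role of
    \<open>G\<close>.\<close>
  define \<pi>\<^sub>0 where "\<pi>\<^sub>0 = map_pmf (\<lambda>a. (a, snd a)) p"
  obtain \<pi> where \<pi>: "finite (set_pmf \<pi>)" "map_pmf fst \<pi> = map_pmf fst \<pi>\<^sub>0"
    "\<And>\<psi>. periodic N \<psi> \<Longrightarrow> (\<integral>p. \<psi> (snd p) \<partial>\<pi>) = (\<Sum>x\<in>grid N. u * \<psi> x)"
    "(\<integral>p. (\<Sum>i\<in>UNIV. real_of_int (snd p i - snd (fst p) i)^2) \<partial>\<pi>)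
      \<le> exp 3 * ((\<Sum>x\<in>grid N. \<Sum>i\<in>UNIV. (F i x)\<^sup>2) / u + (\<Sum>x\<in>grid N. \<Sum>i\<in>UNIV. \<bar>F i x\<bar>))"
  proof (rule ex_chain[of N \<pi>\<^sub>0 f F "u * (cb * real N / 4)" k\<^sub>0 "k\<^sub>0 * M" snd])
    show "finite (set_pmf \<pi>\<^sub>0)" using p(1) finA finite_subset by (auto simp: \<pi>\<^sub>0_def)
    show "(\<integral>p. \<psi> (snd p) \<partial>\<pi>\<^sub>0) = (\<Sum>x\<in>grid N. ((1 - (real k\<^sub>0 / real (k\<^sub>0 * M))\<^sup>2) * f x + (real k\<^sub>0 / real (k\<^sub>0 * M))\<^sup>2 * (1 / real N ^ CARD('n))) * \<psi> x)"
      for \<psi>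
    proof -
      have "(\<integral>p. \<psi> (snd p) \<partial>\<pi>\<^sub>0) = (\<Sum>j = 1..n. \<Sum>g\<in>grid N. \<psi> g * w (j, g))"
        by (simp add: \<pi>\<^sub>0_def Ep)
      also have "\<dots> = (\<Sum>g\<in>grid N. (\<Sum>j = 1..n. w (j, g)) * \<psi> g)"
        by (subst sum.swap) (simp add: sum_distrib_left mult.commute)
      also have "(\<lambda>g. \<Sum>j = 1..n. w (j, g)) = (\<lambda>g. (1 - s) * f g + s * u)"
        using n0 by (simp add: fun_eq_iff w_def f_def K_def sum_divide_distrib[symmetric] sum.distrib sum_distrib_left mult.assoc add_divide_distrib)
      finally show ?thesis unfolding s u_def[symmetric] .
    qed
    show "N > 0" by (rule Npos)
    show "periodic N f" by (rule perf)
    show "periodic N (F i)" for i by (rule F)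
    show "0 \<le> f g" for g by (rule f0)
    show "f g - 1 / real N ^ CARD('n) = (\<Sum>i\<in>UNIV. F i g - F i (shift (i, False) g))" for g
      using F(2) by (simp only: u_def)
    show "\<bar>F i g\<bar> \<le> u * (cb * real N / 4)" for i g by (rule F)
    show "6 * real CARD('n) * (u * (cb * real N / 4)) \<le> real k\<^sub>0 * (1 / real N ^ CARD('n))"
      using k0 by (simp only: u_def)
    show "1 \<le> k\<^sub>0" by (simp add: k\<^sub>0_def)
    show "k\<^sub>0 \<le> k\<^sub>0 * M" using M by simp
    show "snd b = snd (fst b)" if "b \<in> set_pmf \<pi>\<^sub>0" for b using that by (auto simp: \<pi>\<^sub>0_def)
  qed (unfold u_def[symmetric], rule that)
  define U where "U = uniform_measure lborel (cell N :: (real ^ 'n) set)"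
  have law: "(\<integral>p. \<psi> (snd p) \<partial>\<pi>) = (\<Sum>x\<in>grid N. 1 / real N ^ CARD('n) * \<psi> x)" if "periodic N \<psi>" for \<psi>
    using \<pi>(3)[OF that] by (simp only: u_def)
  interpret U: prob_space U unfolding U_def by (rule distr_grid_cell(1)[OF Npos law])
  interpret PU: pair_prob_space "measure_pmf \<pi>" U ..
  let ?P = "measure_pmf \<pi> \<Otimes>\<^sub>M U"
  define X where "X w = x (fst (fst (fst w)))" for w :: "((nat \<times> ('n \<Rightarrow> int)) \<times> ('n \<Rightarrow> int)) \<times> (real ^ 'n)"
  define Z where "Z w = grid_pt N (snd (fst w)) + snd w" for w :: "((nat \<times> ('n \<Rightarrow> int)) \<times> ('n \<Rightarrow> int)) \<times> (real ^ 'n)"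
  define e where "e a = (\<Sum>i\<in>UNIV. (1 - cos (2 * pi * (x (fst a) $ i - grid_pt N (snd a) $ i))) / 8)" for a
  define D where "D b = (\<Sum>i\<in>UNIV. (real_of_int (snd b i - snd (fst b) i))\<^sup>2)" for b :: "(nat \<times> ('n \<Rightarrow> int)) \<times> ('n \<Rightarrow> int)"
  define h where "h b = 3 * (e (fst b) + D b / (real N)\<^sup>2 + (d / real N)\<^sup>2)" for b
  have fst_distr: "distr ?P (measure_pmf \<pi>) fst = measure_pmf \<pi>" by (rule U.distr_pair_fst)
  have int: "integrable (measure_pmf \<pi>) k" for k :: "_ \<Rightarrow> real"
    using \<pi>(1) by (rule integrable_measure_pmf_finite)
  have Ee: "(\<integral>b. e (fst b) \<partial>\<pi>) \<le> d / (real M)\<^sup>2"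
  proof -
    have "(\<integral>b. e (fst b) \<partial>\<pi>) = (\<integral>a. e a \<partial>map_pmf fst \<pi>)" by simp
    also have "\<dots> = (\<integral>a. e a \<partial>p)" unfolding \<pi>(2) by (simp add: \<pi>\<^sub>0_def)
    also have "\<dots> = (\<Sum>j = 1..n. \<Sum>g\<in>grid N. e (j, g) * w (j, g))" by (rule Ep)
    also have "\<dots> \<le> (\<Sum>j = 1..n. d / (real M)\<^sup>2 / real n)"
    proof (rule sum_mono)
      fix j
      \<comment> \<open>Boundedness of the trigonometric cost: the uniform share contributes at most
        s d / 4. With 3 d / (8 M^2) from the kernel the total stays below d / M^2.\<close>
      have e_le: "e (j, g) \<le> d / 4" for g
      proof -
        have "e (j, g) \<le> (\<Sum>i\<in>(UNIV :: 'n set). 1 / 4)"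
          unfolding e_def
        proof (intro sum_mono)
          fix i
          have *: "(1 - t) / 8 \<le> 1 / 4" if "- 1 \<le> t" for t :: real using that by simp
          show "(1 - cos (2 * pi * (x (fst (j, g)) $ i - grid_pt N (snd (j, g)) $ i))) / 8 \<le> 1 / 4"
            by (rule *[OF cos_ge_minus_one])
        qed
        then show ?thesis by (simp add: d_def)
      qed
      have "(\<Sum>g\<in>grid N. e (j, g) * w (j, g)) = ((1 - s) * (\<Sum>g\<in>grid N. e (j, g) * (u * K j g)) + s * (\<Sum>g\<in>grid N. e (j, g) * u)) / real n"
        by (simp add: w_def sum_divide_distrib[symmetric] sum_distrib_left distrib_left sum.distrib mult_ac)
      also have "(\<Sum>g\<in>grid N. e (j, g) * (u * K j g)) = (\<Sum>i\<in>UNIV. (\<Sum>g\<in>grid N. u * K j g * (1 - cos (2 * pi * (x j $ i - grid_pt N g $ i)))) / 8)"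
        unfolding e_def sum_distrib_right sum_divide_distrib by (subst sum.swap) (simp add: mult_ac)
      also have "\<dots> = d * ((1 - q 1) / 8)" by (simp add: sumKc d_def)
      also have "((1 - s) * (d * ((1 - q 1) / 8)) + s * (\<Sum>g\<in>grid N. e (j, g) * u)) / real n
          \<le> (d * (3 / (real M)\<^sup>2 / 8) + s * (d / 4)) / real n"
      proof (intro divide_right_mono add_mono)
        have q1: "q 1 \<le> 1" using q(2)[of 1] by simp
        have "(1 - s) * (d * ((1 - q 1) / 8)) \<le> 1 * (d * ((1 - q 1) / 8))"
          using s01 d1 q1 by (intro mult_right_mono) auto
        also have "\<dots> \<le> d * (3 / (real M)\<^sup>2 / 8)"
          unfolding mult_1_left using d1 by (intro mult_left_mono divide_right_mono q(4)) auto
        finally show "(1 - s) * (d * ((1 - q 1) / 8)) \<le> d * (3 / (real M)\<^sup>2 / 8)" .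
        have "(\<Sum>g\<in>grid N. e (j, g) * u) \<le> (\<Sum>g\<in>(grid N :: ('n \<Rightarrow> int) set). d / 4 * u)"
          using u0 by (intro sum_mono mult_right_mono e_le) auto
        also have "\<dots> = d / 4" using Npos by (simp add: card_grid u_def)
        finally show "s * (\<Sum>g\<in>grid N. e (j, g) * u) \<le> s * (d / 4)" using s01 by (intro mult_left_mono) auto
      qed simp
      also have "\<dots> \<le> d / (real M)\<^sup>2 / real n"
        using d1 n0 M by (intro divide_right_mono) (auto simp: s_def field_simps)
      finally show "(\<Sum>g\<in>grid N. e (j, g) * w (j, g)) \<le> d / (real M)\<^sup>2 / real n" .
    qed
    also have "\<dots> = d / (real M)\<^sup>2" using n0 by simp
    finally show ?thesis .
  qed
  \<comment> \<open>The flux energy scales like N^2 and survives the division by N^2, whereas the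
    jump variance is only linear in \<open>N\<close> and is made small by the choice of the
    mesh.\<close>
  have ED: "(\<integral>b. D b \<partial>\<pi>) / (real N)\<^sup>2 \<le> exp 3 * (\<Sigma> + 1 / (real M)\<^sup>2)"
  proof -
    have "(\<integral>b. D b \<partial>\<pi>) \<le> exp 3 * ((real N)\<^sup>2 / 16 * \<Sigma> + d * cb * real N / 4)"
      unfolding D_def by (rule order_trans[OF \<pi>(4)]) (intro mult_left_mono add_mono F4 F1, simp)
    then have "(\<integral>b. D b \<partial>\<pi>) / (real N)\<^sup>2 \<le> exp 3 * ((real N)\<^sup>2 / 16 * \<Sigma> + d * cb * real N / 4) / (real N)\<^sup>2"
      by (rule divide_right_mono) simp
    also have "\<dots> = exp 3 * (\<Sigma> / 16 + d * cb / (4 * real N))"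
      using Npos by (simp add: field_simps power2_eq_square)
    also have "\<dots> \<le> exp 3 * (\<Sigma> + 1 / (real M)\<^sup>2)"
    proof (intro mult_left_mono add_mono)
      show "\<Sigma> / 16 \<le> \<Sigma>" using \<Sigma>0 by simp
      have "d * cb \<ge> 0" using d1 cb0 by simp
      then have "d * cb / (4 * real N) \<le> d * cb / real N"
        using Npos by (intro divide_left_mono) auto
      also have "\<dots> \<le> 1 / (real M)\<^sup>2"
        using N(1) Npos M by (simp add: field_simps)
      finally show "d * cb / (4 * real N) \<le> 1 / (real M)\<^sup>2" .
    qed simp
    finally show ?thesis .
  qed
  have Eh: "(\<integral>w. h (fst w) \<partial>?P) \<le> 3 * (d + exp 3 + 1) * (1 / (real M)\<^sup>2 + \<Sigma>)"
  proof -
    have "(\<integral>w. h (fst w) \<partial>?P) = (\<integral>b. h b \<partial>distr ?P (measure_pmf \<pi>) fst)"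
      by (rule integral_distr[symmetric]) auto
    also have "\<dots> = (\<integral>b. h b \<partial>\<pi>)" unfolding fst_distr ..
    also have "\<dots> = 3 * ((\<integral>b. e (fst b) \<partial>\<pi>) + (\<integral>b. D b \<partial>\<pi>) / (real N)\<^sup>2 + (d / real N)\<^sup>2)"
      unfolding h_def by (simp add: int)
    also have "\<dots> \<le> 3 * (d / (real M)\<^sup>2 + exp 3 * (\<Sigma> + 1 / (real M)\<^sup>2) + 1 / (real M)\<^sup>2)"
    proof (intro mult_left_mono add_mono Ee ED)
      have "d / real N \<le> 1 / real M" using N(2) Npos M by (simp add: field_simps)
      then have "(d / real N)\<^sup>2 \<le> (1 / real M)\<^sup>2" using d1 by (intro power_mono) auto
      then show "(d / real N)\<^sup>2 \<le> 1 / (real M)\<^sup>2" by (simp add: power_divide)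
    qed simp
    also have "\<dots> \<le> 3 * (d + exp 3 + 1) * (1 / (real M)\<^sup>2 + \<Sigma>)"
    proof -
      have "0 \<le> d * \<Sigma>" using d1 \<Sigma>0 by simp
      then show ?thesis using \<Sigma>0 by (simp add: algebra_simps add_divide_distrib)
    qed
    finally show ?thesis .
  qed
  have snd_meas: "snd \<in> borel_measurable ?P"
    using measurable_compose[OF measurable_snd, of "\<lambda>x. x" U borel "measure_pmf \<pi>"] by (simp add: U_def)
  have "W2 (empirical_measure n (\<lambda>j. torus_proj (x j))) torus_uniform \<le> sqrt (3 * (d + exp 3 + 1) * (1 / (real M)\<^sup>2 + \<Sigma>))"
  proof (rule W2_le[where P = ?P and x = X and z = Z and h = "\<lambda>w. h (fst w)"])
    show "prob_space ?P" by (rule PU.prob_space_axioms)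
    show X: "X \<in> borel_measurable ?P"
      unfolding X_def by (rule measurable_compose[OF measurable_fst]) simp
    show "Z \<in> borel_measurable ?P"
      unfolding Z_def
    proof (rule borel_measurable_add)
      show "(\<lambda>w. grid_pt N (snd (fst w))) \<in> borel_measurable ?P"
        by (rule measurable_compose[OF measurable_fst]) simp
      show "snd \<in> borel_measurable ?P" by (rule snd_meas)
    qed
    show "distr ?P borel (\<lambda>w. torus_proj (X w)) = empirical_measure n (\<lambda>j. torus_proj (x j))"
    proof -
      have "distr ?P borel (\<lambda>w. torus_proj (X w)) = distr (distr ?P (measure_pmf \<pi>) fst) borel (\<lambda>b. torus_proj (x (fst (fst b))))"
        by (subst distr_distr) (auto simp: X_def comp_def)
      also have "\<dots> = distr (measure_pmf (map_pmf fst (map_pmf fst \<pi>))) borel (\<lambda>j. torus_proj (x j))"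
        unfolding fst_distr map_pmf_rep_eq by (subst distr_distr; simp add: comp_def)+
      also have "map_pmf fst (map_pmf fst \<pi>) = pmf_of_set {1..n}"
        unfolding \<pi>(2) by (simp add: \<pi>\<^sub>0_def pmf.map_comp comp_def pfst)
      finally show ?thesis by (simp add: empirical_measure_eq_distr[OF n])
    qed
    show "distr ?P borel (\<lambda>w. torus_proj (Z w)) = torus_uniform"
      unfolding Z_def U_def by (rule distr_grid_cell(2)[OF Npos law])
    show "integrable ?P (\<lambda>w. h (fst w))"
      using integrable_distr[of fst ?P "measure_pmf \<pi>" h] unfolding fst_distr by (simp add: int)
    show "(\<integral>w. h (fst w) \<partial>?P) \<le> 3 * (d + exp 3 + 1) * (1 / (real M)\<^sup>2 + \<Sigma>)" by (rule Eh)
    have cellAE: "AE v in U. v \<in> cell N"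
      unfolding U_def by (rule AE_uniform_measureI) auto
    have "AE w in ?P. snd w \<in> cell N"
      using measurable_sets[OF snd_meas borel_cell, of N] cellAE
      by (intro PU.AE_pair_measure) (auto simp: vimage_def Int_def conj_commute)
    then show "AE w in ?P. (dist (torus_proj (X w)) (torus_proj (Z w)))\<^sup>2 \<le> h (fst w)"
    proof eventually_elim
      fix w :: "((nat \<times> ('n \<Rightarrow> int)) \<times> ('n \<Rightarrow> int)) \<times> (real ^ 'n)" assume w: "snd w \<in> cell N"
      let ?start = "snd (fst (fst w))" and ?g = "snd (fst w)"
      let ?a = "dist (torus_proj (X w)) (torus_proj (grid_pt N ?start))"
      let ?b = "dist (torus_proj (grid_pt N ?start)) (torus_proj (grid_pt N ?g))"
      let ?c = "dist (torus_proj (grid_pt N ?g)) (torus_proj (Z w))"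
      have a: "?a\<^sup>2 \<le> e (fst (fst w))"
        unfolding X_def e_def by (rule dist_torus_proj_sq_le_cos)
      have b: "?b\<^sup>2 \<le> D (fst w) / (real N)\<^sup>2"
        using power_mono[OF dist_torus_proj_le[of "grid_pt N ?start" "grid_pt N ?g"], of 2]
        by (simp add: norm_grid_pt_diff[OF Npos] D_def)
      have c: "?c\<^sup>2 \<le> (d / real N)\<^sup>2"
        using dist_torus_proj_le[of "grid_pt N ?g" "Z w"] norm_cell_le[OF w]
        by (intro power_mono) (auto simp: Z_def d_def)
      have sq: "(a + b + c)\<^sup>2 \<le> 3 * (a\<^sup>2 + b\<^sup>2 + c\<^sup>2)" for a b c :: real
        using sum_squares_bound[of a b] sum_squares_bound[of a c] sum_squares_bound[of b c]
        by (simp add: power2_eq_square algebra_simps)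
      have "dist (torus_proj (X w)) (torus_proj (Z w)) \<le> ?a + ?b + ?c"
        using dist_triangle[of "torus_proj (X w)" "torus_proj (Z w)" "torus_proj (grid_pt N ?g)"]
          dist_triangle[of "torus_proj (X w)" "torus_proj (grid_pt N ?g)" "torus_proj (grid_pt N ?start)"]
        by linarith
      then have "(dist (torus_proj (X w)) (torus_proj (Z w)))\<^sup>2 \<le> (?a + ?b + ?c)\<^sup>2"
        by (intro power_mono) auto
      also note sq
      also have "3 * (?a\<^sup>2 + ?b\<^sup>2 + ?c\<^sup>2) \<le> h (fst w)"
        unfolding h_def by (intro mult_left_mono add_mono a b c) simp
      finally show "(dist (torus_proj (X w)) (torus_proj (Z w)))\<^sup>2 \<le> h (fst w)" .
    qed
  qed
  then show ?thesis by (simp only: d_def \<Sigma>_def c_def R_def)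
qed

section \<open>Time-changed fractional Brownian motion\<close>


text \<open>The cosine expectation is the real part of the characteristic function of a centered
  normal law. Constants are treated apart, because \<open>gaussian\<close> admits them and they have
  no density.\<close>

lemma gaussian_moments:
  assumes "prob_space M" and Y: "gaussian M Y"
  shows "integrable M Y" "integrable M (\<lambda>\<omega>. (Y \<omega>)\<^sup>2)"
    "(\<integral>\<omega>. Y \<omega> \<partial>M) = 0 \<Longrightarrow> (\<integral>\<omega>. cos (Y \<omega>) \<partial>M) = exp (- (\<integral>\<omega>. (Y \<omega>)\<^sup>2 \<partial>M) / 2)"
proof -
  interpret prob_space M by fact
  have Ym[measurable]: "Y \<in> borel_measurable M" using Y by (simp add: gaussian_def)
  have "integrable M Y \<and> integrable M (\<lambda>\<omega>. (Y \<omega>)\<^sup>2) \<and> 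
    ((\<integral>\<omega>. Y \<omega> \<partial>M) = 0 \<longrightarrow> (\<integral>\<omega>. cos (Y \<omega>) \<partial>M) = exp (- (\<integral>\<omega>. (Y \<omega>)\<^sup>2 \<partial>M) / 2))"
    using Y unfolding gaussian_def
  proof (elim conjE exE disjE)
    fix m assume ae: "AE \<omega> in M. Y \<omega> = m"
    have 1: "AE \<omega> in M. norm (Y \<omega>) \<le> \<bar>m\<bar>" using ae by eventually_elim simp
    have 2: "AE \<omega> in M. norm ((Y \<omega>)\<^sup>2) \<le> m\<^sup>2" using ae by eventually_elim simp
    have "integrable M Y" by (rule integrable_const_bound[OF 1]) measurable
    moreover have "integrable M (\<lambda>\<omega>. (Y \<omega>)\<^sup>2)" by (rule integrable_const_bound[OF 2]) measurable
    moreover have "(\<integral>\<omega>. k (Y \<omega>) \<partial>M) = (\<integral>\<omega>. k m \<partial>M)" if [measurable]: "k \<in> borel_measurable borel" for k :: "real \<Rightarrow> real"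
    proof (rule integral_cong_AE)
      show "AE \<omega> in M. k (Y \<omega>) = k m" using ae by eventually_elim simp
    qed measurable
    note this[of "\<lambda>x. x"] this[of "\<lambda>x. x\<^sup>2"] this[of cos]
    ultimately show ?thesis by (simp add: prob_space)
  next
    fix m \<sigma> assume \<sigma>: "\<sigma> > 0" and D: "distributed M lborel Y (normal_density m \<sigma>)"
    have E: "expectation Y = m" and V: "variance Y = \<sigma>\<^sup>2"
      using normal_distributed_expectation[OF \<sigma> D] normal_distributed_variance[OF \<sigma> D] by auto
    have int1: "integrable M Y"
      using distributed_integrable[OF D, of "\<lambda>x. x"] integrable_normal_moment_nz_1[OF \<sigma>, of m] by simp
    have "integrable M (\<lambda>\<omega>. (Y \<omega> - m)\<^sup>2)"
      using distributed_integrable[OF D, of "\<lambda>x. (x - m)\<^sup>2"] integrable_normal_moment[OF \<sigma>, of m 2] by simp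
    then have "integrable M (\<lambda>\<omega>. (Y \<omega> - m)\<^sup>2 + 2 * m * Y \<omega> - m\<^sup>2)"
      using int1 by (intro Bochner_Integration.integrable_add Bochner_Integration.integrable_diff) auto
    then have int2: "integrable M (\<lambda>\<omega>. (Y \<omega>)\<^sup>2)"
      by (simp add: power2_eq_square algebra_simps)
    have "(\<integral>\<omega>. cos (Y \<omega>) \<partial>M) = exp (- (\<integral>\<omega>. (Y \<omega>)\<^sup>2 \<partial>M) / 2)" if 0: "(\<integral>\<omega>. Y \<omega> \<partial>M) = 0"
    proof -
      have m: "m = 0" using 0 E by simp
      have sd: "distributed M lborel (\<lambda>\<omega>. Y \<omega> / \<sigma>) std_normal_density"
        using normal_standard_normal_convert[OF \<sigma>, of Y m] D m by simp
      have "(\<integral>\<omega>. cos (Y \<omega>) \<partial>M) = (\<integral>\<omega>. cos (\<sigma> * (Y \<omega> / \<sigma>)) \<partial>M)" using \<sigma> by simp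
      also have "\<dots> = (\<integral>x. cos (\<sigma> * x) \<partial>std_normal_distribution)"
        unfolding distributed_distr_eq_density[OF sd, symmetric] by (subst integral_distr) auto
      also have "\<dots> = Re (char std_normal_distribution \<sigma>)"
      proof -
        interpret N: prob_space std_normal_distribution
          by (rule prob_space_normal_density) simp
        have "integrable std_normal_distribution (\<lambda>x. iexp (\<sigma> * x))"
          by (intro N.integrable_const_bound[where B = 1]) auto
        from integral_Re[OF this] show ?thesis by (simp add: char_def Re_exp)
      qed
      also have "\<dots> = exp (- \<sigma>\<^sup>2 / 2)" by (simp add: char_std_normal_distribution)
      also have "\<sigma>\<^sup>2 = (\<integral>\<omega>. (Y \<omega>)\<^sup>2 \<partial>M)" using V E m by simp
      finally show ?thesis .
    qed
    then show ?thesis using int1 int2 by simp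
  qed
  then show "integrable M Y" "integrable M (\<lambda>\<omega>. (Y \<omega>)\<^sup>2)"
    "(\<integral>\<omega>. Y \<omega> \<partial>M) = 0 \<Longrightarrow> (\<integral>\<omega>. cos (Y \<omega>) \<partial>M) = exp (- (\<integral>\<omega>. (Y \<omega>)\<^sup>2 \<partial>M) / 2)" by auto
qed

text \<open>The projected increment is a centered Gaussian variable. Expanding its square, products
  of different coordinates have mean 0, and the covariance collapses to the variance |c|^2 |a -
  b|^(2 H).\<close>

lemma fbm_expectation_cos:
  fixes X :: "real \<Rightarrow> 'w \<Rightarrow> real ^ 'n::finite" and c :: "real ^ 'n"
  assumes M: "prob_space M" and X: "fractional_brownian_motion M H X" and H: "H > 0"
    and ab: "a \<ge> 0" "b \<ge> 0"
  shows "(\<integral>\<omega>. cos (c \<bullet> (X a \<omega> - X b \<omega>)) \<partial>M) = exp (- (norm c)\<^sup>2 * \<bar>a - b\<bar> powr (2 * H) / 2)"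
\<comment> \<open>The Gaussian property concerns sums over sets of times; for a = b the set
  \<open>{a, b}\<close> has one element and no longer encodes a difference.\<close>
proof (cases "a = b")
  case True
  interpret prob_space M by fact
  show ?thesis using True H by (simp add: prob_space)
next
  case False
  interpret prob_space M by fact
  have gp: "\<And>T A. finite T \<Longrightarrow> T \<subseteq> {0..} \<Longrightarrow> gaussian M (\<lambda>\<omega>. \<Sum>t\<in>T. A t \<bullet> X t \<omega>)"
    and mean: "\<And>t i. t \<ge> 0 \<Longrightarrow> (\<integral>\<omega>. X t \<omega> $ i \<partial>M) = 0"
    and cov: "\<And>s t i j. s \<ge> 0 \<Longrightarrow> t \<ge> 0 \<Longrightarrow> (\<integral>\<omega>. X s \<omega> $ i * X t \<omega> $ j \<partial>M) =
        (if i = j then (s powr (2 * H) + t powr (2 * H) - \<bar>t - s\<bar> powr (2 * H)) / 2 else 0)"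
    using X by (auto simp: fractional_brownian_motion_def gaussian_process_def)
  have comp: "gaussian M (\<lambda>\<omega>. X t \<omega> $ i)" if "t \<ge> 0" for t i
    using gp[of "{t}" "\<lambda>_. axis i 1"] that by (simp add: inner_axis')
  note int1 = gaussian_moments(1)[OF M comp] and int2 = gaussian_moments(2)[OF M comp]
  have [measurable]: "(\<lambda>\<omega>. X t \<omega> $ i) \<in> borel_measurable M" if "t \<ge> 0" for t i
    using comp[OF that] by (simp add: gaussian_def)
  have intp: "integrable M (\<lambda>\<omega>. X s \<omega> $ i * X t \<omega> $ j)" if "s \<ge> 0" "t \<ge> 0" for s t i j
  proof (rule Bochner_Integration.integrable_bound)
    show "integrable M (\<lambda>\<omega>. (X s \<omega> $ i)\<^sup>2 + (X t \<omega> $ j)\<^sup>2)"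
      by (intro Bochner_Integration.integrable_add int2 that)
    show "(\<lambda>\<omega>. X s \<omega> $ i * X t \<omega> $ j) \<in> borel_measurable M"
      using that by measurable
    show "AE \<omega> in M. norm (X s \<omega> $ i * X t \<omega> $ j) \<le> norm ((X s \<omega> $ i)\<^sup>2 + (X t \<omega> $ j)\<^sup>2)"
    proof (rule AE_I2)
      fix \<omega>
      have "2 * \<bar>p * q\<bar> \<le> p\<^sup>2 + q\<^sup>2" for p q :: real
        using sum_squares_bound[of "\<bar>p\<bar>" "\<bar>q\<bar>"] by (simp add: abs_mult)
      from this[of "X s \<omega> $ i" "X t \<omega> $ j"] show "norm (X s \<omega> $ i * X t \<omega> $ j) \<le> norm ((X s \<omega> $ i)\<^sup>2 + (X t \<omega> $ j)\<^sup>2)"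
        by simp
    qed
  qed
  define Y where "Y \<omega> = c \<bullet> (X a \<omega> - X b \<omega>)" for \<omega>
  have Yg: "gaussian M Y"
    using gp[of "{a, b}" "\<lambda>t. if t = a then c else - c"] False ab
    by (simp add: Y_def[abs_def] inner_diff_right)
  have Ysum: "Y \<omega> = (\<Sum>i\<in>UNIV. c $ i * (X a \<omega> $ i - X b \<omega> $ i))" for \<omega>
    by (simp add: Y_def inner_vec_def)
  have EY: "(\<integral>\<omega>. Y \<omega> \<partial>M) = 0"
    unfolding Ysum using ab by (simp add: mean int1)
  have "(\<integral>\<omega>. (Y \<omega>)\<^sup>2 \<partial>M) = (\<integral>\<omega>. (\<Sum>i\<in>UNIV. \<Sum>j\<in>UNIV. c $ i * c $ j * 
      (X a \<omega> $ i * X a \<omega> $ j - X a \<omega> $ i * X b \<omega> $ j - X b \<omega> $ i * X a \<omega> $ j + X b \<omega> $ i * X b \<omega> $ j)) \<partial>M)"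
    unfolding Ysum power2_eq_square sum_product by (simp add: algebra_simps)
  also have "\<dots> = (\<Sum>i\<in>UNIV. \<Sum>j\<in>UNIV. c $ i * c $ j * (if i = j then \<bar>a - b\<bar> powr (2 * H) else 0))"
    using ab by (simp add: intp cov abs_minus_commute[of b a] field_simps)
       (auto intro!: sum.cong simp: abs_minus_commute[of b a] algebra_simps)
  also have "\<dots> = (\<Sum>i\<in>UNIV. (c $ i)\<^sup>2) * \<bar>a - b\<bar> powr (2 * H)"
    by (simp add: if_distrib sum_distrib_right power2_eq_square cong: if_cong)
  also have "(\<Sum>i\<in>UNIV. (c $ i)\<^sup>2) = (norm c)\<^sup>2"
    by (simp add: norm_vec_def L2_set_def sum_nonneg)
  finally show ?thesis
    using gaussian_moments(3)[OF M Yg EY] by (simp add: Y_def)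
qed

section \<open>Freezing independent random times\<close>

lemma measurable_from_subalgebra:
  assumes "f \<in> measurable F N" "sets F \<subseteq> sets M" "space F = space M"
  shows "f \<in> measurable M N"
  using assms measurable_sets[OF assms(1)] measurable_space[OF assms(1)]
  by (intro measurableI) auto

lemma process_events_measurable:
  fixes M :: "'w measure" and X :: "real \<Rightarrow> 'w \<Rightarrow> 'a::topological_space"
  defines "N \<equiv> sigma (space M) {X t -` A \<inter> space M | t A. 0 \<le> t \<and> A \<in> sets borel}"
  shows "space N = space M" "sets N = process_events M X"
    "t \<ge> 0 \<Longrightarrow> X t \<in> borel_measurable N"
proof -
  let ?G = "{X t -` A \<inter> space M | t A. 0 \<le> t \<and> A \<in> sets borel}"
  have G: "?G \<subseteq> Pow (space M)" by auto
  show sp: "space N = space M" unfolding N_def by (rule space_measure_of[OF G])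
  show st: "sets N = process_events M X" unfolding N_def process_events_def by (rule sets_measure_of[OF G])
  show "X t \<in> borel_measurable N" if "t \<ge> 0"
  proof (rule measurableI)
    fix A :: "'a set" assume A: "A \<in> sets borel"
    show "X t -` A \<inter> space N \<in> sets N"
      unfolding sp st process_events_def using that A by (intro sigma_sets.Basic) blast
  qed simp
qed

text \<open>An independent \<open>J\<close> may be frozen under the expectation. With finitely many
  values this is a sum over the events J = j, each independent of \<open>g j\<close>, so joint
  measurability of the process in time and sample does not enter.\<close>

lemma indep_expectation_finite_range:
  fixes M :: "'w measure" and X :: "real \<Rightarrow> 'w \<Rightarrow> 'a::topological_space" and S :: "real \<Rightarrow> 'w \<Rightarrow> 'b::topological_space"
    and g :: "'c \<Rightarrow> 'w \<Rightarrow> real" and J :: "'w \<Rightarrow> 'c"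
  defines "NX \<equiv> sigma (space M) {X t -` A \<inter> space M | t A. 0 \<le> t \<and> A \<in> sets borel}"
    and "NS \<equiv> sigma (space M) {S t -` A \<inter> space M | t A. 0 \<le> t \<and> A \<in> sets borel}"
  assumes M: "prob_space M"
    and indep: "prob_space.indep_set M (process_events M X) (process_events M S)"
    and XS: "\<And>t. t \<ge> 0 \<Longrightarrow> X t \<in> borel_measurable M" "\<And>t. t \<ge> 0 \<Longrightarrow> S t \<in> borel_measurable M"
    and C: "finite C" "\<And>\<omega>. \<omega> \<in> space M \<Longrightarrow> J \<omega> \<in> C"
    and J: "J \<in> measurable NS (count_space UNIV)"
    and g: "\<And>j. g j \<in> borel_measurable NX" "\<And>j \<omega>. \<bar>g j \<omega>\<bar> \<le> K"
  shows "(\<integral>\<omega>. g (J \<omega>) \<omega> \<partial>M) = (\<integral>\<omega>. (\<integral>\<omega>'. g (J \<omega>) \<omega>' \<partial>M) \<partial>M)"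
proof -
  interpret prob_space M by fact
  note NX = process_events_measurable[where M = M and X = X, folded NX_def]
  note NS = process_events_measurable[where M = M and X = S, folded NS_def]
  have sub: "sets NX \<subseteq> events" "sets NS \<subseteq> events"
    unfolding NX NS process_events_def
    by (auto intro!: sets.sigma_sets_subset measurable_sets[OF XS(1)] measurable_sets[OF XS(2)])
  have gm[measurable]: "g j \<in> borel_measurable M" for j
    by (rule measurable_from_subalgebra[OF g(1) sub(1) NX(1)])
  have Jm: "J \<in> measurable M (count_space UNIV)"
    by (rule measurable_from_subalgebra[OF J sub(2) NS(1)])
  define I where "I j \<omega> = (indicator {j} (J \<omega>) :: real)" for j \<omega>
  have Im[measurable]: "I j \<in> borel_measurable M" and Im': "I j \<in> borel_measurable NS" for j
    unfolding I_def by (rule measurable_compose[OF Jm] measurable_compose[OF J]; simp)+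
  have intI: "integrable M (I j)" for j
    by (rule integrable_const_bound[where B = 1]) (auto simp: I_def indicator_def)
  have intg: "integrable M (g j)" for j
    by (rule integrable_const_bound[where B = K]) (auto simp: g)
  have main: "integrable M (\<lambda>\<omega>. g j \<omega> * I j \<omega>)"
    "(\<integral>\<omega>. g j \<omega> * I j \<omega> \<partial>M) = (\<integral>\<omega>. g j \<omega> \<partial>M) * (\<integral>\<omega>. I j \<omega> \<partial>M)" for j
  proof -
    have "sigma_sets (space M) {g j -` A \<inter> space M | A. A \<in> sets borel} \<subseteq> process_events M X"
      using measurable_sets[OF g(1)[of j]] sets.top[of NX]
      unfolding NX(2)[symmetric] by (intro sets.sigma_sets_subset') (auto simp: NX(1))
    moreover have "sigma_sets (space M) {I j -` A \<inter> space M | A. A \<in> sets borel} \<subseteq> process_events M S"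
      using measurable_sets[OF Im'[of j]] sets.top[of NS]
      unfolding NS(2)[symmetric] by (intro sets.sigma_sets_subset') (auto simp: NS(1))
    ultimately have "indep_set (sigma_sets (space M) {g j -` A \<inter> space M | A. A \<in> sets borel})
        (sigma_sets (space M) {I j -` A \<inter> space M | A. A \<in> sets borel})"
      using indep unfolding indep_set_def
      by (elim indep_sets_mono_sets) (auto split: bool.split)
    then have iv: "indep_var borel (g j) borel (I j)"
      unfolding indep_var_eq by (auto simp: gm Im)
    show "integrable M (\<lambda>\<omega>. g j \<omega> * I j \<omega>)" by (rule indep_var_integrable[OF iv intg intI])
    show "(\<integral>\<omega>. g j \<omega> * I j \<omega> \<partial>M) = (\<integral>\<omega>. g j \<omega> \<partial>M) * (\<integral>\<omega>. I j \<omega> \<partial>M)"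
      by (rule indep_var_lebesgue_integral[OF iv intg intI])
  qed
  have "(\<integral>\<omega>. g (J \<omega>) \<omega> \<partial>M) = (\<integral>\<omega>. (\<Sum>j\<in>C. g j \<omega> * I j \<omega>) \<partial>M)"
    using C by (intro Bochner_Integration.integral_cong) (auto simp: I_def indicator_def)
  also have "\<dots> = (\<Sum>j\<in>C. (\<integral>\<omega>. g j \<omega> \<partial>M) * (\<integral>\<omega>. I j \<omega> \<partial>M))"
    by (subst Bochner_Integration.integral_sum) (auto simp: main)
  also have "\<dots> = (\<integral>\<omega>. (\<Sum>j\<in>C. (\<integral>\<omega>'. g j \<omega>' \<partial>M) * I j \<omega>) \<partial>M)"
    by (subst Bochner_Integration.integral_sum) (auto simp: intI)
  also have "\<dots> = (\<integral>\<omega>. (\<integral>\<omega>'. g (J \<omega>) \<omega>' \<partial>M) \<partial>M)"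
    using C by (intro Bochner_Integration.integral_cong) (auto simp: I_def indicator_def)
  finally show ?thesis .
qed

text \<open>Numerator of the dyadic approximation with denominator 2^m; the truncation at m 2^m
  leaves finitely many times at each level.\<close>

definition dyadic_ceiling :: "nat \<Rightarrow> real \<Rightarrow> nat" where
  "dyadic_ceiling m x = min (m * 2 ^ m) (nat \<lceil>2 ^ m * x\<rceil>)"

lemma measurable_dyadic_ceiling [measurable]: "dyadic_ceiling m \<in> measurable borel (count_space UNIV)"
  unfolding dyadic_ceiling_def by measurable

lemma dyadic_ceiling_tendsto:
  assumes "x \<ge> 0"
  shows "(\<lambda>m. real (dyadic_ceiling m x) / 2 ^ m) \<longlonglongrightarrow> x"
proof (rule tendsto_sandwich)
  have *: "x \<le> real (dyadic_ceiling m x) / 2 ^ m \<and> real (dyadic_ceiling m x) / 2 ^ m \<le> x + (1 / 2) ^ m"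
    if m: "m \<ge> nat \<lceil>x\<rceil>" for m
  proof -
    have "x \<le> real m" using m by linarith
    then have "2 ^ m * x \<le> real (m * 2 ^ m)" by (simp add: mult.commute)
    then have "nat \<lceil>2 ^ m * x\<rceil> \<le> m * 2 ^ m" by linarith
    then have "real (dyadic_ceiling m x) = of_int \<lceil>2 ^ m * x\<rceil>"
      using assms by (simp add: dyadic_ceiling_def min_absorb2)
    then have "2 ^ m * x \<le> real (dyadic_ceiling m x)" "real (dyadic_ceiling m x) \<le> 2 ^ m * x + 1"
      by linarith+
    then show ?thesis by (simp add: field_simps power_one_over)
  qed
  show "\<forall>\<^sub>F m in sequentially. x \<le> real (dyadic_ceiling m x) / 2 ^ m"
    using eventually_ge_at_top[of "nat \<lceil>x\<rceil>"] by eventually_elim (use * in blast)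
  show "\<forall>\<^sub>F m in sequentially. real (dyadic_ceiling m x) / 2 ^ m \<le> x + (1 / 2) ^ m"
    using eventually_ge_at_top[of "nat \<lceil>x\<rceil>"] by eventually_elim (use * in blast)
  have "(\<lambda>m. x + (1 / 2) ^ m) \<longlonglongrightarrow> x + 0"
    by (intro tendsto_add tendsto_const LIMSEQ_power_zero) simp
  then show "(\<lambda>m. x + (1 / 2) ^ m) \<longlonglongrightarrow> x" by simp
qed simp

text \<open>The time-changed process need not be measurable, so it is replaced by its limit \<open>Z\<close> along
  dyadic times, with which it agrees almost surely by path continuity.\<close>

lemma fbm_time_change:
  fixes X :: "real \<Rightarrow> 'w \<Rightarrow> real ^ 'n::finite" and S :: "real \<Rightarrow> 'w \<Rightarrow> real"
  assumes M: "prob_space M" and X: "fractional_brownian_motion M H X" and H: "H > 0"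
    and S: "\<And>t. t \<ge> 0 \<Longrightarrow> S t \<in> borel_measurable M" "\<And>t \<omega>. t \<ge> 0 \<Longrightarrow> \<omega> \<in> space M \<Longrightarrow> 0 \<le> S t \<omega>"
    and indep: "prob_space.indep_set M (process_events M X) (process_events M S)"
  obtains Z where "\<And>t. t \<ge> 0 \<Longrightarrow> Z t \<in> borel_measurable M"
    "\<And>t. t \<ge> 0 \<Longrightarrow> AE \<omega> in M. Z t \<omega> = X (S t \<omega>) \<omega>"
    "\<And>s t c. s \<ge> 0 \<Longrightarrow> t \<ge> 0 \<Longrightarrow> (\<integral>\<omega>. cos (c \<bullet> (Z s \<omega> - Z t \<omega>)) \<partial>M) =
       (\<integral>\<omega>. exp (- (norm c)\<^sup>2 * \<bar>S s \<omega> - S t \<omega>\<bar> powr (2 * H) / 2) \<partial>M)"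
proof -
  interpret prob_space M by fact
  define r where "r m x = real (dyadic_ceiling m x) / 2 ^ m" for m x
  define V where "V m t \<omega> = X (r m (S t \<omega>)) \<omega>" for m t \<omega>
  \<comment> \<open>\<open>lim\<close> of a sequence of measurable functions is measurable whether
    or not the sequence converges, so \<open>Z\<close> is defined everywhere without removing an
    exceptional set.\<close>
  define Z where "Z t \<omega> = lim (\<lambda>m. V m t \<omega>)" for t \<omega>
  have r0: "0 \<le> r m x" for m x by (simp add: r_def)
  have Xm: "X t \<in> borel_measurable M" if "t \<ge> 0" for t
    using X that by (simp add: fractional_brownian_motion_def gaussian_process_def)
  have Dm: "(\<lambda>\<omega>. dyadic_ceiling m (S t \<omega>)) \<in> measurable M (count_space UNIV)" if "t \<ge> 0" for m t
    by (rule measurable_compose[OF S(1)[OF that] measurable_dyadic_ceiling])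
  have Vm: "V m t \<in> borel_measurable M" if "t \<ge> 0" for m t
    unfolding V_def r_def by (rule measurable_compose_countable[OF _ Dm[OF that]]) (simp add: Xm)
  have Zm: "Z t \<in> borel_measurable M" if "t \<ge> 0" for t
    unfolding Z_def by (rule borel_measurable_lim_metric) (rule Vm[OF that])
  have lim: "AE \<omega> in M. (\<lambda>m. V m t \<omega>) \<longlonglongrightarrow> X (S t \<omega>) \<omega>" if t: "t \<ge> 0" for t
  proof -
    have "AE \<omega> in M. continuous_on {0..} (\<lambda>t. X t \<omega>)"
      using X by (simp add: fractional_brownian_motion_def)
    then show ?thesis
    proof (rule AE_mp, intro AE_I2 impI)
      fix \<omega> assume w: "\<omega> \<in> space M" and c: "continuous_on {0..} (\<lambda>t. X t \<omega>)"
      show "(\<lambda>m. V m t \<omega>) \<longlonglongrightarrow> X (S t \<omega>) \<omega>"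
        unfolding V_def
        by (rule continuous_on_tendsto_compose[OF c])
          (use S(2)[OF t w] r0 dyadic_ceiling_tendsto[of "S t \<omega>"] in \<open>auto simp: r_def\<close>)
    qed
  qed
  have ZV: "AE \<omega> in M. (\<lambda>m. V m t \<omega>) \<longlonglongrightarrow> Z t \<omega>" if "t \<ge> 0" for t
    using lim[OF that] by eventually_elim (simp add: Z_def limI)
  show ?thesis
  proof (rule that[of Z])
    show "Z t \<in> borel_measurable M" if "t \<ge> 0" for t by (rule Zm[OF that])
    show "AE \<omega> in M. Z t \<omega> = X (S t \<omega>) \<omega>" if "t \<ge> 0" for t
      using lim[OF that] by eventually_elim (simp add: Z_def limI)
    fix s t :: real and c :: "real ^ 'n" assume st: "s \<ge> 0" "t \<ge> 0"
    note [measurable] = S(1)[OF st(1)] S(1)[OF st(2)] Vm[OF st(1)] Vm[OF st(2)] Zm[OF st(1)] Zm[OF st(2)]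
    \<comment> \<open>At level \<open>m\<close> the two random times take finitely many values and
      are determined by \<open>S\<close>, so they can be frozen and the formula for deterministic
      times applies. Both sides then pass to the limit with majorant 1.\<close>
    have eq: "(\<integral>\<omega>. cos (c \<bullet> (V m s \<omega> - V m t \<omega>)) \<partial>M) =
       (\<integral>\<omega>. exp (- (norm c)\<^sup>2 * \<bar>r m (S s \<omega>) - r m (S t \<omega>)\<bar> powr (2 * H) / 2) \<partial>M)" for m
    proof -
      define J where "J \<omega> = (dyadic_ceiling m (S s \<omega>), dyadic_ceiling m (S t \<omega>))" for \<omega>
      define g where "g j \<omega> = cos (c \<bullet> (X (real (fst j) / 2 ^ m) \<omega> - X (real (snd j) / 2 ^ m) \<omega>))" for j \<omega>
      let ?NS = "sigma (space M) {S t -` A \<inter> space M | t A. 0 \<le> t \<and> A \<in> sets borel}"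
      let ?NX = "sigma (space M) {X t -` A \<inter> space M | t A. 0 \<le> t \<and> A \<in> sets borel}"
      have "(\<integral>\<omega>. g (J \<omega>) \<omega> \<partial>M) = (\<integral>\<omega>. (\<integral>\<omega>'. g (J \<omega>) \<omega>' \<partial>M) \<partial>M)"
      proof (rule indep_expectation_finite_range[OF M indep])
        show "X t \<in> borel_measurable M" "S t \<in> borel_measurable M" if "t \<ge> 0" for t
          using that by (simp_all add: Xm S)
        show "finite ({..m * 2 ^ m} \<times> {..m * 2 ^ m})" by simp
        show "J \<omega> \<in> {..m * 2 ^ m} \<times> {..m * 2 ^ m}" for \<omega> by (simp add: J_def dyadic_ceiling_def)
        have D: "(\<lambda>\<omega>. dyadic_ceiling m (S t \<omega>)) \<in> measurable ?NS (count_space UNIV)" if "t \<ge> 0" for t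
          by (rule measurable_compose[OF process_events_measurable(3)[OF that] measurable_dyadic_ceiling])
        show "J \<in> measurable ?NS (count_space UNIV)"
          unfolding measurable_count_space_eq2_countable
        proof (intro conjI ballI)
          fix a :: "nat \<times> nat"
          have "J -` {a} \<inter> space ?NS = ((\<lambda>\<omega>. dyadic_ceiling m (S s \<omega>)) -` {fst a} \<inter> space ?NS)
             \<inter> ((\<lambda>\<omega>. dyadic_ceiling m (S t \<omega>)) -` {snd a} \<inter> space ?NS)"
            by (auto simp: J_def)
          also have "\<dots> \<in> sets ?NS"
            using measurable_sets[OF D[OF st(1)], of "{fst a}"] measurable_sets[OF D[OF st(2)], of "{snd a}"] by simp
          finally show "J -` {a} \<inter> space ?NS \<in> sets ?NS" .
        qed simp
        show "g j \<in> borel_measurable ?NX" for j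
        proof -
          have [measurable]: "X (real (fst j) / 2 ^ m) \<in> borel_measurable ?NX" "X (real (snd j) / 2 ^ m) \<in> borel_measurable ?NX"
            by (rule process_events_measurable(3); simp)+
          show ?thesis unfolding g_def by measurable
        qed
        show "\<bar>g j \<omega>\<bar> \<le> 1" for j \<omega> by (simp add: g_def)
      qed
      also have "\<dots> = (\<integral>\<omega>. exp (- (norm c)\<^sup>2 * \<bar>r m (S s \<omega>) - r m (S t \<omega>)\<bar> powr (2 * H) / 2) \<partial>M)"
        unfolding g_def by (subst fbm_expectation_cos[OF M X H]) (auto simp: J_def r_def)
      finally show ?thesis by (simp add: g_def J_def V_def r_def)
    qed
    have "(\<lambda>m. \<integral>\<omega>. cos (c \<bullet> (V m s \<omega> - V m t \<omega>)) \<partial>M) \<longlonglongrightarrow> (\<integral>\<omega>. cos (c \<bullet> (Z s \<omega> - Z t \<omega>)) \<partial>M)"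
    proof (rule integral_dominated_convergence[where w = "\<lambda>_. 1"])
      show "AE \<omega> in M. (\<lambda>m. cos (c \<bullet> (V m s \<omega> - V m t \<omega>))) \<longlonglongrightarrow> cos (c \<bullet> (Z s \<omega> - Z t \<omega>))"
        using ZV[OF st(1)] ZV[OF st(2)] by eventually_elim (intro tendsto_intros)
    qed auto
    moreover have "(\<lambda>m. \<integral>\<omega>. exp (- (norm c)\<^sup>2 * \<bar>r m (S s \<omega>) - r m (S t \<omega>)\<bar> powr (2 * H) / 2) \<partial>M)
       \<longlonglongrightarrow> (\<integral>\<omega>. exp (- (norm c)\<^sup>2 * \<bar>S s \<omega> - S t \<omega>\<bar> powr (2 * H) / 2) \<partial>M)"
    proof (rule integral_dominated_convergence[where w = "\<lambda>_. 1"])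
      show "AE \<omega> in M. (\<lambda>m. exp (- (norm c)\<^sup>2 * \<bar>r m (S s \<omega>) - r m (S t \<omega>)\<bar> powr (2 * H) / 2))
          \<longlonglongrightarrow> exp (- (norm c)\<^sup>2 * \<bar>S s \<omega> - S t \<omega>\<bar> powr (2 * H) / 2)"
      proof (rule AE_I2)
        fix \<omega> assume w: "\<omega> \<in> space M"
        have "(\<lambda>m. \<bar>r m (S s \<omega>) - r m (S t \<omega>)\<bar>) \<longlonglongrightarrow> \<bar>S s \<omega> - S t \<omega>\<bar>"
          unfolding r_def by (intro tendsto_intros dyadic_ceiling_tendsto S(2) st w)
        then have "(\<lambda>m. \<bar>r m (S s \<omega>) - r m (S t \<omega>)\<bar> powr (2 * H)) \<longlonglongrightarrow> \<bar>S s \<omega> - S t \<omega>\<bar> powr (2 * H)"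
          using H by (intro tendsto_powr2) auto
        then show "(\<lambda>m. exp (- (norm c)\<^sup>2 * \<bar>r m (S s \<omega>) - r m (S t \<omega>)\<bar> powr (2 * H) / 2))
          \<longlonglongrightarrow> exp (- (norm c)\<^sup>2 * \<bar>S s \<omega> - S t \<omega>\<bar> powr (2 * H) / 2)"
          by (intro isCont_tendsto_compose[where g = "\<lambda>p. exp (- (norm c)\<^sup>2 * p / 2)"]) (auto intro!: continuous_intros)
      qed
      show "(\<lambda>\<omega>. exp (- (norm c)\<^sup>2 * \<bar>r m (S s \<omega>) - r m (S t \<omega>)\<bar> powr (2 * H) / 2)) \<in> borel_measurable M" for m
        unfolding r_def by measurable
    qed auto
    ultimately show "(\<integral>\<omega>. cos (c \<bullet> (Z s \<omega> - Z t \<omega>)) \<partial>M) =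
       (\<integral>\<omega>. exp (- (norm c)\<^sup>2 * \<bar>S s \<omega> - S t \<omega>\<bar> powr (2 * H) / 2) \<partial>M)"
      unfolding eq by (rule LIMSEQ_unique)
  qed
qed

section \<open>Laplace transforms of the subordinator\<close>


text \<open>Multiplication by exp x - 1 telescopes the sum, and x \<le> exp x - 1. The bound is
  uniform in \<open>m\<close>.\<close>

lemma sum_exp_neg_le:
  assumes "x > (0::real)"
  shows "(\<Sum>j = 1..m. exp (- (real j * x))) \<le> 1 / x"
proof -
  have "(exp x - 1) * (\<Sum>j = 1..m. exp (- (real j * x))) = 1 - exp (- (real m * x))"
  proof (induction m)
    case (Suc m)
    have "exp x * exp (- (real (Suc m) * x)) = exp (- (real m * x))"
      by (simp add: exp_add[symmetric] algebra_simps)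
    with Suc show ?case by (simp add: algebra_simps)
  qed simp
  also have "\<dots> \<le> 1" by simp
  finally have "(exp x - 1) * (\<Sum>j = 1..m. exp (- (real j * x))) \<le> 1" .
  moreover have "x * (\<Sum>j = 1..m. exp (- (real j * x))) \<le> (exp x - 1) * (\<Sum>j = 1..m. exp (- (real j * x)))"
  proof (rule mult_right_mono)
    show "x \<le> exp x - 1" using exp_ge_add_one_self[of x] by linarith
  qed (simp add: sum_nonneg)
  ultimately show ?thesis using assms by (simp add: field_simps)
qed

text \<open>The lower limit controls \<open>B\<close> for large arguments only. On the remaining
  bounded part of [1, \<infinity>) it suffices that \<open>B\<close> is nondecreasing and B 1 > 0,
  the latter because the slope is positive near 0.\<close>

lemma bernstein_B_lower_bound:
  assumes B: "B \<in> bernstein_B_alpha \<alpha>" and \<alpha>: "\<alpha> \<ge> 0"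
  obtains c where "c > 0" "\<And>x. x \<ge> 1 \<Longrightarrow> c * x powr \<alpha> \<le> B x"
proof -
  have bern: "bernstein B"
    and slope: "\<exists>L::ereal. L > 0 \<and> ((\<lambda>x. ereal (deriv B x)) \<longlongrightarrow> L) (at_right 0)"
    and inf: "Liminf at_top (\<lambda>x. ereal (x powr (- \<alpha>) * B x)) > 0"
    using B by (auto simp: bernstein_B_alpha_def bernstein_B_def)
  have D: "(B has_real_derivative deriv B x) (at x)" if "x > 0" for x
  proof -
    have "\<forall>k. \<forall>x>0. (deriv ^^ k) B differentiable (at x)" using bern unfolding bernstein_def by blast
    from this[rule_format, of x 0] show ?thesis
      using that by (simp add: DERIV_deriv_iff_real_differentiable)
  qed
  have D0: "deriv B x \<ge> 0" if "x > 0" for x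
  proof -
    have "\<forall>k\<ge>1. \<forall>x>0. 0 \<le> (- 1) ^ (k - 1) * (deriv ^^ k) B x" using bern unfolding bernstein_def by blast
    from this[rule_format, of 1 x] show ?thesis using that by simp
  qed
  have B0: "B x \<ge> 0" if "x \<ge> 0" for x using bern that by (simp add: bernstein_def)
  have mono: "B x \<le> B y" if "0 < x" "x \<le> y" for x y
  proof (rule DERIV_nonneg_imp_nondecreasing[OF that(2)])
    fix z assume "x \<le> z"
    then have "z > 0" using that(1) by linarith
    then show "\<exists>y. (B has_real_derivative y) (at z) \<and> 0 \<le> y" using D D0 by blast
  qed
  have Bpos: "B x > 0" if x: "x > 0" for x
  proof -
    obtain L :: ereal where L: "L > 0" "((\<lambda>x. ereal (deriv B x)) \<longlongrightarrow> L) (at_right 0)" using slope by auto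
    from order_tendstoD(1)[OF L(2) L(1)] have "eventually (\<lambda>x. deriv B x > 0) (at_right 0)" by simp
    then obtain \<delta> where \<delta>: "\<delta> > 0" "\<And>x. 0 < x \<Longrightarrow> x < \<delta> \<Longrightarrow> deriv B x > 0"
      unfolding eventually_at_right_field by auto
    define y where "y = min x (\<delta> / 2)"
    have y: "0 < y" "y < \<delta>" "y \<le> x" using x \<delta> by (auto simp: y_def)
    have "B (y / 2) < B y"
    proof (rule DERIV_pos_imp_increasing[of "y / 2" y B])
      fix z assume "y / 2 \<le> z" "z \<le> y"
      then have "z > 0" "z < \<delta>" using y by linarith+
      then show "\<exists>y. (B has_real_derivative y) (at z) \<and> 0 < y" using D \<delta> by blast
    qed (use y in simp)
    moreover have "B (y / 2) \<ge> 0" using B0 y by simp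
    moreover have "B y \<le> B x" using mono y by simp
    ultimately show ?thesis by linarith
  qed
  obtain e where e: "0 < e" "ereal e < Liminf at_top (\<lambda>x. ereal (x powr (- \<alpha>) * B x))"
    using ereal_dense2[OF inf] by (auto simp: zero_ereal_def)
  from less_LiminfD[OF e(2)] obtain x0 where x0: "\<And>x. x \<ge> x0 \<Longrightarrow> e < x powr (- \<alpha>) * B x"
    by (auto simp: eventually_at_top_linorder)
  define z where "z = max 1 x0"
  have z: "z \<ge> 1" "z powr \<alpha> > 0" by (auto simp: z_def)
  show ?thesis
  proof (rule that[of "min e (B 1 / z powr \<alpha>)"])
    show "min e (B 1 / z powr \<alpha>) > 0" using e Bpos z by simp
    fix x :: real assume x: "x \<ge> 1"
    show "min e (B 1 / z powr \<alpha>) * x powr \<alpha> \<le> B x"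
    proof (cases "x \<ge> x0")
      case True
      have "min e (B 1 / z powr \<alpha>) * x powr \<alpha> \<le> (x powr (- \<alpha>) * B x) * x powr \<alpha>"
        using x0[OF True] by (intro mult_right_mono) auto
      also have "\<dots> = B x" using x by (simp add: powr_minus)
      finally show ?thesis .
    next
      case False
      have "min e (B 1 / z powr \<alpha>) * x powr \<alpha> \<le> (B 1 / z powr \<alpha>) * z powr \<alpha>"
        using False x \<alpha> Bpos[of 1] by (intro mult_mono powr_mono2) (auto simp: z_def)
      also have "\<dots> = B 1" using z by simp
      also have "\<dots> \<le> B x" using mono x by simp
      finally show ?thesis .
    qed
  qed
qed

text \<open>Only jump sizes in [1 / x, 2 / x] are kept. There 1 - exp (- x y) is at least 1 - exp (-
  1), and the density is at least its value at the right end; the interval has length 1 / x, which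
  leaves x^\<alpha>.\<close>

lemma levy_lower_bound:
  assumes LK: "levy_khintchine B b \<nu>" and c: "c > 0" and \<alpha>: "\<alpha> > 0"
    and lower: "\<And>A. A \<in> sets \<nu> \<Longrightarrow> (\<integral>\<^sup>+ y\<in>A. ennreal (c * y powr (- 1 - \<alpha>)) \<partial>lborel) \<le> emeasure \<nu> A"
    and x: "x > 0"
  shows "(1 - exp (- 1)) * c * 2 powr (- 1 - \<alpha>) * x powr \<alpha> \<le> B x"
proof -
  have b: "b \<ge> 0" and sets: "sets \<nu> = sets (restrict_space borel {0<..})"
    and cpt: "\<And>K. compact K \<Longrightarrow> K \<subseteq> {0<..} \<Longrightarrow> emeasure \<nu> K < \<infinity>"
    and fin: "(\<integral>\<^sup>+ y. ennreal (y / (1 + y)) \<partial>\<nu>) < \<infinity>"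
    and B: "B x = b * x + (\<integral>y. (1 - exp (- x * y)) \<partial>\<nu>)"
    using LK x by (auto simp: levy_khintchine_def levy_measure_def)
  have space: "space \<nu> = {0<..}" using sets_eq_imp_space_eq[OF sets] by (simp add: space_restrict_space)
  have bm: "f \<in> borel_measurable \<nu>" if "f \<in> borel_measurable borel" for f :: "real \<Rightarrow> real"
    using measurable_restrict_space1[OF that, of "{0<..}"] measurable_cong_sets[OF sets refl] by blast
  have int1: "integrable \<nu> (\<lambda>y. y / (1 + y))"
    by (rule integrableI_nonneg[OF bm]) (use fin in \<open>auto simp: space intro!: AE_I2\<close>)
  \<comment> \<open>The Bochner integral of a non-integrable function defaults to 0, so
    integrability has to be derived first. The majorant comes from bounding 1 - exp (- x y) by both
    1 and x y.\<close>
  have int: "integrable \<nu> (\<lambda>y. 1 - exp (- x * y))"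
  proof (rule Bochner_Integration.integrable_bound)
    show "integrable \<nu> (\<lambda>y. (1 + x) * (y / (1 + y)))" by (intro integrable_mult_right int1)
    show "(\<lambda>y. 1 - exp (- x * y)) \<in> borel_measurable \<nu>" by (rule bm) simp
    show "AE y in \<nu>. norm (1 - exp (- x * y)) \<le> norm ((1 + x) * (y / (1 + y)))"
    proof (rule AE_I2)
      fix y assume "y \<in> space \<nu>"
      then have y: "y > 0" by (simp add: space)
      let ?t = "1 - exp (- x * y)"
      have t: "0 \<le> ?t" "?t \<le> 1" "?t \<le> x * y"
        using x y exp_ge_add_one_self[of "- x * y"] by auto
      have "?t * (1 + y) \<le> x * y + y"
      proof -
        have "?t * y \<le> y" using mult_right_mono[OF t(2), of y] y by simp
        then show ?thesis using t(3) by (simp only: distrib_left mult_1_right)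
      qed
      then have "?t \<le> (1 + x) * (y / (1 + y))" using y by (simp add: field_simps)
      then show "norm (1 - exp (- x * y)) \<le> norm ((1 + x) * (y / (1 + y)))"
        using t x y by simp
    qed
  qed
  let ?A = "{1 / x..2 / x}"
  have Asub: "?A \<subseteq> {0<..}" using x by (auto intro: less_le_trans[of 0 "1 / x"])
  have A: "?A \<in> sets \<nu>"
    unfolding sets using Asub by (auto simp: sets_restrict_space image_iff intro!: bexI[of _ ?A])
  have Afin: "emeasure \<nu> ?A < \<infinity>" by (rule cpt[OF _ Asub]) simp
  have "ennreal (c * (2 / x) powr (- 1 - \<alpha>) * (1 / x)) = (\<integral>\<^sup>+ y. ennreal (c * (2 / x) powr (- 1 - \<alpha>)) * indicator ?A y \<partial>lborel)"
  proof -
    have "emeasure lborel ?A = ennreal (1 / x)" using x by (simp add: field_simps)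
    then show ?thesis using x c by (subst nn_integral_cmult_indicator) (auto simp: ennreal_mult''[symmetric])
  qed
  also have "\<dots> \<le> (\<integral>\<^sup>+ y\<in>?A. ennreal (c * y powr (- 1 - \<alpha>)) \<partial>lborel)"
  proof (rule nn_integral_mono)
    fix y :: real
    show "ennreal (c * (2 / x) powr (- 1 - \<alpha>)) * indicator ?A y \<le> ennreal (c * y powr (- 1 - \<alpha>)) * indicator ?A y"
    proof (cases "y \<in> ?A")
      case True
      then have "0 < y" "y \<le> 2 / x" using Asub by auto
      then have "(2 / x) powr (- 1 - \<alpha>) \<le> y powr (- 1 - \<alpha>)"
        using \<alpha> by (intro powr_mono2') auto
      then show ?thesis using True c by (simp add: ennreal_leI)
    qed simp
  qed
  also have "\<dots> \<le> emeasure \<nu> ?A" by (rule lower[OF A])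
  also have "\<dots> = ennreal (measure \<nu> ?A)" using Afin by (simp add: emeasure_eq_ennreal_measure)
  finally have m: "c * (2 / x) powr (- 1 - \<alpha>) * (1 / x) \<le> measure \<nu> ?A" by simp
  have "(1 - exp (- 1)) * measure \<nu> ?A = (\<integral>y. (1 - exp (- 1)) * indicator ?A y \<partial>\<nu>)"
    using A Asub by (simp add: space Int_absorb2)
  also have "\<dots> \<le> (\<integral>y. (1 - exp (- x * y)) \<partial>\<nu>)"
  proof (rule integral_mono[OF _ int])
    show "integrable \<nu> (\<lambda>y. (1 - exp (- 1)) * indicator ?A y :: real)"
      by (intro integrable_mult_right integrable_real_indicator A Afin)
    fix y assume "y \<in> space \<nu>"
    then show "(1 - exp (- 1)) * indicator ?A y \<le> 1 - exp (- x * y)"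
      using x by (auto simp: space indicator_def field_simps)
  qed
  also have "\<dots> \<le> B x" using B b x by simp
  finally have "(1 - exp (- 1)) * measure \<nu> ?A \<le> B x" .
  moreover have "(1 - exp (- 1)) * (c * (2 / x) powr (- 1 - \<alpha>) * (1 / x)) \<le> (1 - exp (- 1)) * measure \<nu> ?A"
    by (rule mult_left_mono[OF m]) simp
  ultimately have le: "(1 - exp (- 1)) * (c * (2 / x) powr (- 1 - \<alpha>) * (1 / x)) \<le> B x" by linarith
  have "(2 / x) powr (- 1 - \<alpha>) * (1 / x) = 2 powr (- 1 - \<alpha>) * x powr \<alpha>"
  proof -
    have "x powr (- 1 - \<alpha>) = inverse (x powr (1 + \<alpha>))" using powr_minus[of x "1 + \<alpha>"] by simp
    then have "(2 / x) powr (- 1 - \<alpha>) = 2 powr (- 1 - \<alpha>) * x powr (1 + \<alpha>)"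
      using x by (subst powr_divide) (simp_all add: divide_inverse)
    then show ?thesis using x by (simp add: powr_add)
  qed
  with le show ?thesis by (simp only: mult.assoc)
qed

text \<open>For z > 1 a single term of the exponential series suffices: y^p / p! \<le> exp y with y
  = z^h, and z \<le> y^p since p h \<ge> 1.\<close>

lemma exp_neg_powr_le:
  assumes p: "real p * h \<ge> 1" and h: "h > 0" and z: "z \<ge> 0"
  shows "exp (- (z powr h)) \<le> 2 * fact p / (1 + z)"
proof (cases "z \<le> 1")
  case True
  have "exp (- (z powr h)) \<le> 1" by simp
  also have "\<dots> \<le> 2 / (1 + z)" using True z by (simp add: field_simps)
  also have "\<dots> \<le> 2 * fact p / (1 + z)" using z fact_ge_1[of p, where 'a = real] by (intro divide_right_mono) auto
  finally show ?thesis .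
next
  case False
  define y where "y = z powr h"
  have y: "y \<ge> 0" by (simp add: y_def)
  have "z \<le> z powr (h * real p)" using False p powr_mono[of 1 "h * real p" z] by (simp add: mult.commute)
  also have "\<dots> = y ^ p" using False by (simp add: y_def powr_powr[symmetric] powr_realpow)
  finally have zy: "z \<le> y ^ p" .
  have "y ^ p / fact p \<le> exp y"
    using sum_le_suminf[OF summable_exp_generic[of y], of "{p}"] y
    by (simp add: exp_def divide_inverse mult.commute)
  then have "z \<le> fact p * exp y" using zy by (simp add: field_simps)
  then have "exp (- y) * z \<le> fact p" by (simp add: exp_minus field_simps)
  moreover have "exp (- y) * (1 + z) \<le> exp (- y) * (2 * z)" using False by (intro mult_left_mono) auto
  ultimately have "exp (- y) * (1 + z) \<le> 2 * fact p" by linarith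
  then show ?thesis using z by (simp add: y_def field_simps)
qed

lemma subordinator_process:
  assumes "subordinator M B S" "t \<ge> 0"
  shows "S t \<in> borel_measurable M" "\<And>\<omega>. \<omega> \<in> space M \<Longrightarrow> 0 \<le> S t \<omega>"
  using assms by (auto simp: subordinator_def)

lemma subordinator_laplace:
  assumes "subordinator M B S" "t \<ge> 0" "x \<ge> 0"
  shows "(\<integral>\<omega>. exp (- x * S t \<omega>) \<partial>M) = exp (- t * B x)"
  using assms by (simp add: subordinator_def)

lemma subordinator_sum_laplace_le:
  assumes S: "subordinator M B S" and x: "x \<ge> 0" "B x > 0" and \<tau>: "\<tau> > 0"
  shows "(\<Sum>j = 1..m. \<integral>\<omega>. exp (- x * S (real j * \<tau>) \<omega>) \<partial>M) \<le> 1 / (\<tau> * B x)"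
proof -
  have "(\<Sum>j = 1..m. \<integral>\<omega>. exp (- x * S (real j * \<tau>) \<omega>) \<partial>M) = (\<Sum>j = 1..m. exp (- (real j * (\<tau> * B x))))"
    using subordinator_laplace[OF S _ x(1)] \<tau> by (intro sum.cong) (auto simp: mult.assoc)
  also have "\<dots> \<le> 1 / (\<tau> * B x)" using x \<tau> by (intro sum_exp_neg_le) simp
  finally show ?thesis .
qed

text \<open>For a general exponent the function \<open>exp (- z\<^sup>h)\<close> is dominated by a multiple of
  \<open>1 / (1 + z)\<close>, which is a mixture of the exponentials \<open>exp (- l * z)\<close>.\<close>

lemma subordinator_sum_stretched_le:
  assumes M: "prob_space M" and S: "subordinator M B S" and h: "h > 0"
    and \<alpha>: "0 < \<alpha>" "\<alpha> < 1" and c: "c > 0" "\<And>x. x > 0 \<Longrightarrow> c * x powr \<alpha> \<le> B x"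
  obtains C where "C > 0" "\<And>\<tau> \<kappa> m. \<tau> > 0 \<Longrightarrow> \<kappa> > 0 \<Longrightarrow>
    (\<Sum>j = 1..m. \<integral>\<omega>. exp (- \<kappa> * S (real j * \<tau>) \<omega> powr h) \<partial>M) \<le> C * \<kappa> powr (- (\<alpha> / h)) / \<tau>"
proof -
  interpret prob_space M by fact
  obtain p :: nat where "real p \<ge> 1 / h" using real_arch_simple by blast
  then have p: "real p * h \<ge> 1" using h by (simp add: field_simps)
  define A :: real where "A = 2 * fact p"
  have A: "A > 0" by (simp add: A_def)
  \<comment> \<open>The integral of l^(- \<alpha>) exp (- l) over the half-line, finite because
    \<alpha> < 1. The factor l^(- \<alpha>) will come from the sum of Laplace transforms at l times
    a.\<close>
  define G where "G = Gamma (1 - \<alpha>)"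
  have G: "G > 0" using \<alpha> by (simp add: G_def Gamma_real_pos)
  let ?I = "\<lambda>l. indicator {0..} l :: ennreal"
  have mix: "(\<integral>\<^sup>+l. ennreal (exp (- (l * d))) * ?I l \<partial>lborel) = ennreal (1 / d)" if d: "d > 0" for d :: real
  proof -
    have "(\<integral>\<^sup>+l. ennreal (exp (- (l * d))) * ?I l \<partial>lborel) = ennreal (0 - (- exp (- (0 * d)) / d))"
    proof (rule nn_integral_FTC_atLeast)
      show "((\<lambda>l. - exp (- (l * d)) / d) \<longlongrightarrow> 0) at_top"
      proof -
        have "filterlim (\<lambda>l. l * d) at_top at_top"
          using d by (intro filterlim_at_top_mult_tendsto_pos[OF tendsto_const _ filterlim_ident])
        then have "((\<lambda>l. exp (- (l * d))) \<longlongrightarrow> 0) at_top"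
          by (intro filterlim_compose[OF exp_at_bot] filterlim_compose[OF filterlim_uminus_at_bot_at_top])
        from tendsto_divide[OF tendsto_minus[OF this] tendsto_const[of d]] show ?thesis using d by simp
      qed
    qed (use d in \<open>auto intro!: derivative_eq_intros\<close>)
    then show ?thesis by simp
  qed
  have Gam: "(\<integral>\<^sup>+l. ennreal (l powr (- \<alpha>) * exp (- l)) * ?I l \<partial>lborel) = ennreal G"
  proof -
    have "((\<lambda>l. l powr (- \<alpha>) * exp (- l)) has_integral G) {0..}"
      using Gamma_integral_real[of "1 - \<alpha>"] \<alpha> by (simp add: G_def exp_minus divide_inverse)
    from nn_integral_has_integral_lebesgue'[OF _ this] show ?thesis by simp
  qed
  show ?thesis
  proof (rule that[of "A * G / c"])
    show "A * G / c > 0" using A G c by simp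
    fix \<tau> \<kappa> :: real and m :: nat assume \<tau>: "\<tau> > 0" and \<kappa>: "\<kappa> > 0"
    \<comment> \<open>Chosen so that \<kappa> s^h = (a s)^h; then \<open>\<kappa>\<close> enters the
      result through a^(- \<alpha>) = \<kappa>^(- \<alpha> / h).\<close>
    define a where "a = \<kappa> powr (1 / h)"
    have a: "a > 0" using \<kappa> by (simp add: a_def)
    have Sm[measurable]: "S (real j * \<tau>) \<in> borel_measurable M" and S0: "\<omega> \<in> space M \<Longrightarrow> 0 \<le> S (real j * \<tau>) \<omega>" for j \<omega>
      using subordinator_process[OF S, of "real j * \<tau>"] \<tau> by auto
    define L where "L j l = (\<integral>\<^sup>+\<omega>. ennreal (exp (- (l * a) * S (real j * \<tau>) \<omega>)) \<partial>M)" for j l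
    have Lm[measurable]: "L j \<in> borel_measurable borel" for j
      unfolding L_def by measurable
    have one: "ennreal (\<integral>\<omega>. exp (- \<kappa> * S (real j * \<tau>) \<omega> powr h) \<partial>M)
       \<le> ennreal A * (\<integral>\<^sup>+l. ennreal (exp (- l)) * ?I l * L j l \<partial>lborel)" for j
    proof -
      have "ennreal (\<integral>\<omega>. exp (- \<kappa> * S (real j * \<tau>) \<omega> powr h) \<partial>M) = (\<integral>\<^sup>+\<omega>. ennreal (exp (- \<kappa> * S (real j * \<tau>) \<omega> powr h)) \<partial>M)"
        by (intro nn_integral_eq_integral[symmetric] integrable_const_bound[where B = 1]) (auto simp: \<kappa> less_imp_le)
      also have "\<dots> \<le> (\<integral>\<^sup>+\<omega>. ennreal A * (\<integral>\<^sup>+l. ennreal (exp (- (l * (1 + a * S (real j * \<tau>) \<omega>)))) * ?I l \<partial>lborel) \<partial>M)"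
      proof (rule nn_integral_mono)
        fix \<omega> assume w: "\<omega> \<in> space M"
        define s where "s = S (real j * \<tau>) \<omega>"
        have s: "s \<ge> 0" using S0[OF w] by (simp add: s_def)
        have "\<kappa> * s powr h = (a * s) powr h"
          using \<kappa> s h by (simp add: a_def powr_mult powr_powr)
        then have "exp (- \<kappa> * s powr h) \<le> A / (1 + a * s)"
          using exp_neg_powr_le[OF p h, of "a * s"] a s by (simp add: A_def)
        then have "ennreal (exp (- \<kappa> * s powr h)) \<le> ennreal (A / (1 + a * s))" by (rule ennreal_leI)
        also have "\<dots> = ennreal A * ennreal (1 / (1 + a * s))"
          using A a s by (simp add: ennreal_mult'[symmetric])
        also have "\<dots> = ennreal A * (\<integral>\<^sup>+l. ennreal (exp (- (l * (1 + a * s)))) * ?I l \<partial>lborel)"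
          using mix[of "1 + a * s"] a s by (simp add: add_pos_nonneg)
        finally show "ennreal (exp (- \<kappa> * S (real j * \<tau>) \<omega> powr h)) \<le>
            ennreal A * (\<integral>\<^sup>+l. ennreal (exp (- (l * (1 + a * S (real j * \<tau>) \<omega>)))) * ?I l \<partial>lborel)"
          by (simp add: s_def)
      qed
      also have "\<dots> = ennreal A * (\<integral>\<^sup>+\<omega>. (\<integral>\<^sup>+l. ennreal (exp (- (l * (1 + a * S (real j * \<tau>) \<omega>)))) * ?I l \<partial>lborel) \<partial>M)"
        by (rule nn_integral_cmult) measurable
      also have "(\<integral>\<^sup>+\<omega>. (\<integral>\<^sup>+l. ennreal (exp (- (l * (1 + a * S (real j * \<tau>) \<omega>)))) * ?I l \<partial>lborel) \<partial>M)
          = (\<integral>\<^sup>+l. (\<integral>\<^sup>+\<omega>. ennreal (exp (- (l * (1 + a * S (real j * \<tau>) \<omega>)))) * ?I l \<partial>M) \<partial>lborel)"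
      proof -
        interpret P: pair_sigma_finite M "lborel :: real measure" ..
        show ?thesis by (rule P.Fubini'[symmetric]) measurable
      qed
      also have "\<dots> = (\<integral>\<^sup>+l. ennreal (exp (- l)) * ?I l * L j l \<partial>lborel)"
      proof (rule nn_integral_cong)
        fix l :: real
        have "(\<integral>\<^sup>+\<omega>. ennreal (exp (- (l * (1 + a * S (real j * \<tau>) \<omega>)))) * ?I l \<partial>M)
            = (\<integral>\<^sup>+\<omega>. (ennreal (exp (- l)) * ?I l) * ennreal (exp (- (l * a) * S (real j * \<tau>) \<omega>)) \<partial>M)"
          by (intro nn_integral_cong) (simp add: ennreal_mult'[symmetric] exp_add[symmetric] algebra_simps indicator_def)
        also have "\<dots> = ennreal (exp (- l)) * ?I l * L j l"
          unfolding L_def by (rule nn_integral_cmult) measurable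
        finally show "(\<integral>\<^sup>+\<omega>. ennreal (exp (- (l * (1 + a * S (real j * \<tau>) \<omega>)))) * ?I l \<partial>M) = \<dots>" .
      qed
      finally show ?thesis .
    qed
    \<comment> \<open>The mixing variable runs through all positive values, so \<open>l * a\<close>
      may be close to 0 and the lower bound on \<open>B\<close> is used on the whole
      half-line.\<close>
    have sumL: "(\<Sum>j = 1..m. L j l) \<le> ennreal (1 / (\<tau> * c * a powr \<alpha>) * l powr (- \<alpha>))" if l: "l > 0" for l
    proof -
      have la: "l * a > 0" using l a by simp
      have Bla: "c * (l * a) powr \<alpha> \<le> B (l * a)" by (rule c(2)[OF la])
      have clap: "0 < c * (l * a) powr \<alpha>" using c(1) l a by simp
      then have Bpos: "B (l * a) > 0" using Bla by linarith
      have "L j l = ennreal (\<integral>\<omega>. exp (- (l * a) * S (real j * \<tau>) \<omega>) \<partial>M)" for j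
        unfolding L_def using S0 l a
        by (intro nn_integral_eq_integral integrable_const_bound[where B = 1] AE_I2) auto
      then have "(\<Sum>j = 1..m. L j l) = ennreal (\<Sum>j = 1..m. \<integral>\<omega>. exp (- (l * a) * S (real j * \<tau>) \<omega>) \<partial>M)"
        by (simp add: sum_ennreal)
      also have "\<dots> \<le> ennreal (1 / (\<tau> * B (l * a)))"
        using la by (intro ennreal_leI subordinator_sum_laplace_le S Bpos \<tau>) auto
      also have "\<dots> \<le> ennreal (1 / (\<tau> * (c * (l * a) powr \<alpha>)))"
        using Bla \<tau> Bpos clap by (intro ennreal_leI divide_left_mono mult_left_mono mult_pos_pos[OF \<tau>]) auto
      also have "1 / (\<tau> * (c * (l * a) powr \<alpha>)) = 1 / (\<tau> * c * a powr \<alpha>) * l powr (- \<alpha>)"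
        using l a by (simp add: powr_mult powr_minus field_simps)
      finally show ?thesis .
    qed
    have "ennreal (\<Sum>j = 1..m. \<integral>\<omega>. exp (- \<kappa> * S (real j * \<tau>) \<omega> powr h) \<partial>M)
       = (\<Sum>j = 1..m. ennreal (\<integral>\<omega>. exp (- \<kappa> * S (real j * \<tau>) \<omega> powr h) \<partial>M))"
      by (simp add: sum_ennreal)
    also have "\<dots> \<le> (\<Sum>j = 1..m. ennreal A * (\<integral>\<^sup>+l. ennreal (exp (- l)) * ?I l * L j l \<partial>lborel))"
      by (intro sum_mono one)
    also have "\<dots> = ennreal A * (\<integral>\<^sup>+l. ennreal (exp (- l)) * ?I l * (\<Sum>j = 1..m. L j l) \<partial>lborel)"
      by (simp add: sum_distrib_left nn_integral_sum)
    also have "\<dots> \<le> ennreal A * (\<integral>\<^sup>+l. ennreal (1 / (\<tau> * c * a powr \<alpha>)) * (ennreal (l powr (- \<alpha>) * exp (- l)) * ?I l) \<partial>lborel)"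
    proof (intro mult_left_mono nn_integral_mono_AE)
      show "AE l in lborel. ennreal (exp (- l)) * ?I l * (\<Sum>j = 1..m. L j l) \<le>
          ennreal (1 / (\<tau> * c * a powr \<alpha>)) * (ennreal (l powr (- \<alpha>) * exp (- l)) * ?I l)"
        using AE_lborel_singleton[of "0::real"]
      proof eventually_elim
        fix l :: real assume "l \<noteq> 0"
        show "ennreal (exp (- l)) * ?I l * (\<Sum>j = 1..m. L j l) \<le>
          ennreal (1 / (\<tau> * c * a powr \<alpha>)) * (ennreal (l powr (- \<alpha>) * exp (- l)) * ?I l)"
        proof (cases "l > 0")
          case True
          have "ennreal (exp (- l)) * (\<Sum>j = 1..m. L j l) \<le> ennreal (exp (- l)) * ennreal (1 / (\<tau> * c * a powr \<alpha>) * l powr (- \<alpha>))"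
            by (intro mult_left_mono sumL True) simp
          also have "\<dots> = ennreal (1 / (\<tau> * c * a powr \<alpha>)) * ennreal (l powr (- \<alpha>) * exp (- l))"
            using \<tau> c(1) by (simp add: ennreal_mult'[symmetric] mult_ac)
          finally show ?thesis using True by simp
        qed (use \<open>l \<noteq> 0\<close> in simp)
      qed
    qed simp
    also have "\<dots> = ennreal A * (ennreal (1 / (\<tau> * c * a powr \<alpha>)) * ennreal G)"
      by (subst nn_integral_cmult) (simp_all add: Gam)
    also have "\<dots> = ennreal (A * (1 / (\<tau> * c * a powr \<alpha>) * G))"
      using A G c(1) \<tau> by (simp add: ennreal_mult'[symmetric])
    finally have "(\<Sum>j = 1..m. \<integral>\<omega>. exp (- \<kappa> * S (real j * \<tau>) \<omega> powr h) \<partial>M) \<le> A * (1 / (\<tau> * c * a powr \<alpha>) * G)"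
      using A G c(1) \<tau> by (subst (asm) ennreal_le_iff) auto
    also have "\<dots> = A * G / c * \<kappa> powr (- (\<alpha> / h)) / \<tau>"
      using \<kappa> by (simp add: a_def powr_powr powr_minus field_simps)
    finally show "(\<Sum>j = 1..m. \<integral>\<omega>. exp (- \<kappa> * S (real j * \<tau>) \<omega> powr h) \<partial>M) \<le> A * G / c * \<kappa> powr (- (\<alpha> / h)) / \<tau>" .
  qed
qed

text \<open>For H = 1 / 2 the exponent 2 H is 1 and the Laplace transform applies directly; the
  restriction \<kappa> \<ge> 1 stems from this case, where the power lower bound on \<open>B\<close>
  is available from 1 on. In the other case \<open>B\<close> dominates a power on the whole
  half-line and the mixture argument applies.\<close>

lemma subordinator_sum_le:
  assumes M: "prob_space M" and S: "subordinator M B S" and H: "0 < H"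
    and cond:
      "(H = 1 / 2 \<and> 0 \<le> \<alpha> \<and> \<alpha> \<le> 1 \<and> B \<in> bernstein_B_alpha \<alpha>) \<or>
       (H \<noteq> 1 / 2 \<and> 0 < \<alpha> \<and> \<alpha> < 1 \<and> bernstein B \<and> B 0 = 0 \<and>
        (\<exists>b \<nu>. levy_khintchine B b \<nu> \<and>
           (\<exists>c>0. \<forall>A\<in>sets \<nu>.
              (\<integral>\<^sup>+ y\<in>A. ennreal (c * y powr (- 1 - \<alpha>)) \<partial>lborel) \<le> emeasure \<nu> A)))"
  obtains C where "C > 0" "\<And>\<tau> \<kappa> m. \<tau> > 0 \<Longrightarrow> \<kappa> \<ge> 1 \<Longrightarrow>
    (\<Sum>j = 1..m. \<integral>\<omega>. exp (- \<kappa> * S (real j * \<tau>) \<omega> powr (2 * H)) \<partial>M) \<le> C * \<kappa> powr (- (\<alpha> / (2 * H))) / \<tau>"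
  using cond
proof (elim disjE conjE exE bexE)
  assume h: "H = 1 / 2" and \<alpha>: "0 \<le> \<alpha>" and B: "B \<in> bernstein_B_alpha \<alpha>"
  obtain c where c: "c > 0" "\<And>x. x \<ge> 1 \<Longrightarrow> c * x powr \<alpha> \<le> B x"
    using bernstein_B_lower_bound[OF B \<alpha>] by blast
  show thesis
  proof (rule that[of "1 / c"])
    show "1 / c > 0" using c by simp
    fix \<tau> \<kappa> :: real and m :: nat assume \<tau>: "\<tau> > 0" and \<kappa>: "\<kappa> \<ge> 1"
    have pos: "0 < c * \<kappa> powr \<alpha>" using c \<kappa> by simp
    then have B0: "B \<kappa> > 0" using c(2)[OF \<kappa>] by linarith
    have "(\<Sum>j = 1..m. \<integral>\<omega>. exp (- \<kappa> * S (real j * \<tau>) \<omega> powr (2 * H)) \<partial>M)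
        = (\<Sum>j = 1..m. \<integral>\<omega>. exp (- \<kappa> * S (real j * \<tau>) \<omega>) \<partial>M)"
    proof -
      have h1: "2 * H = 1" using h by simp
      show ?thesis
        unfolding h1 using subordinator_process(2)[OF S] \<tau>
        by (intro sum.cong refl Bochner_Integration.integral_cong) auto
    qed
    also have "\<dots> \<le> 1 / (\<tau> * B \<kappa>)"
      using \<kappa> by (intro subordinator_sum_laplace_le S B0 \<tau>) auto
    also have "\<dots> \<le> 1 / (\<tau> * (c * \<kappa> powr \<alpha>))"
      using \<tau> c(2)[OF \<kappa>] pos B0 by (intro divide_left_mono mult_left_mono) auto
    also have "\<dots> = 1 / c * \<kappa> powr (- (\<alpha> / (2 * H))) / \<tau>"
      using h \<kappa> by (simp add: powr_minus field_simps)
    finally show "(\<Sum>j = 1..m. \<integral>\<omega>. exp (- \<kappa> * S (real j * \<tau>) \<omega> powr (2 * H)) \<partial>M)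
        \<le> 1 / c * \<kappa> powr (- (\<alpha> / (2 * H))) / \<tau>" .
  qed
next
  fix b \<nu> c
  assume \<alpha>: "0 < \<alpha>" "\<alpha> < 1" and LK: "levy_khintchine B b \<nu>" and c: "c > 0"
    and lower: "\<forall>A\<in>sets \<nu>. (\<integral>\<^sup>+ y\<in>A. ennreal (c * y powr (- 1 - \<alpha>)) \<partial>lborel) \<le> emeasure \<nu> A"
  have c': "(1 - exp (- 1)) * c * 2 powr (- 1 - \<alpha>) > 0" using c by simp
  have h: "2 * H > 0" using H by simp
  have lb: "(1 - exp (- 1)) * c * 2 powr (- 1 - \<alpha>) * x powr \<alpha> \<le> B x" if "x > 0" for x
    by (rule levy_lower_bound[OF LK c \<alpha>(1) _ that]) (use lower in blast)
  show thesis
  proof (rule subordinator_sum_stretched_le[OF M S h \<alpha> c' lb])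
    fix C :: real
    assume C: "C > 0" "\<And>\<tau> \<kappa> m. \<tau> > 0 \<Longrightarrow> \<kappa> > 0 \<Longrightarrow>
      (\<Sum>j = 1..m. \<integral>\<omega>. exp (- \<kappa> * S (real j * \<tau>) \<omega> powr (2 * H)) \<partial>M) \<le> C * \<kappa> powr (- (\<alpha> / (2 * H))) / \<tau>"
    show thesis
    proof (rule that[OF C(1)])
      fix \<tau> \<kappa> :: real and m :: nat assume "\<tau> > 0" "\<kappa> \<ge> 1"
      then show "(\<Sum>j = 1..m. \<integral>\<omega>. exp (- \<kappa> * S (real j * \<tau>) \<omega> powr (2 * H)) \<partial>M)
          \<le> C * \<kappa> powr (- (\<alpha> / (2 * H))) / \<tau>"
        by (intro C(2)) auto
    qed
  qed
qed

section \<open>Mean squares of the Fourier coefficients\<close>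


text \<open>Stationarity of increments. The absolute value covers both orders of the two times and
  disappears because \<open>S\<close> is nonnegative.\<close>

lemma subordinator_increment:
  assumes S: "subordinator M B S" and st: "s \<ge> 0" "t \<ge> 0" and [measurable]: "f \<in> borel_measurable borel"
  shows "(\<integral>\<omega>. f \<bar>S s \<omega> - S t \<omega>\<bar> \<partial>M) = (\<integral>\<omega>. (f (S \<bar>s - t\<bar> \<omega>) :: real) \<partial>M)"
proof -
  have *: "(\<integral>\<omega>. f \<bar>S t \<omega> - S s \<omega>\<bar> \<partial>M) = (\<integral>\<omega>. f (S (t - s) \<omega>) \<partial>M)" if "0 \<le> s" "s \<le> t" for s t
  proof -
    have [measurable]: "S s \<in> borel_measurable M" "S t \<in> borel_measurable M" "S (t - s) \<in> borel_measurable M"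
      using that by (intro subordinator_process[OF S]; simp)+
    have "\<forall>s\<ge>0. \<forall>h\<ge>0. distr M borel (\<lambda>\<omega>. S (s + h) \<omega> - S s \<omega>) = distr M borel (S h)"
      using S unfolding subordinator_def by blast
    from this[rule_format, of s "t - s"] have d: "distr M borel (\<lambda>\<omega>. S t \<omega> - S s \<omega>) = distr M borel (S (t - s))"
      using that by simp
    have "(\<integral>\<omega>. f \<bar>S t \<omega> - S s \<omega>\<bar> \<partial>M) = (\<integral>x. f \<bar>x\<bar> \<partial>distr M borel (\<lambda>\<omega>. S t \<omega> - S s \<omega>))"
      by (subst integral_distr) auto
    also have "\<dots> = (\<integral>\<omega>. f \<bar>S (t - s) \<omega>\<bar> \<partial>M)" unfolding d by (subst integral_distr) auto
    also have "\<dots> = (\<integral>\<omega>. f (S (t - s) \<omega>) \<partial>M)"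
      using subordinator_process(2)[OF S, of "t - s"] that by (intro Bochner_Integration.integral_cong) auto
    finally show ?thesis .
  qed
  show ?thesis
  proof (cases "s \<le> t")
    case True
    then show ?thesis using *[of s t] st by (simp add: abs_minus_commute)
  next
    case False
    then show ?thesis using *[of t s] st by simp
  qed
qed

text \<open>Each row of this symmetric Toeplitz matrix consists of the diagonal entry and two
  one-sided sums, each at most the full sum. The case distinction keeps natural subtraction
  exact.\<close>

lemma sum_dist_le:
  fixes g :: "nat \<Rightarrow> real"
  assumes g: "\<And>h. g h \<ge> 0" "g 0 \<le> 1"
  shows "(\<Sum>j = 1..n. \<Sum>l = 1..n. g (if l \<le> j then j - l else l - j)) \<le> real n * (1 + 2 * (\<Sum>h = 1..n. g h))"
proof -
  have "(\<Sum>l = 1..n. g (if l \<le> j then j - l else l - j)) \<le> 1 + 2 * (\<Sum>h = 1..n. g h)" if j: "j \<in> {1..n}" for j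
  proof -
    have "{1..n} = {1..<j} \<union> ({j} \<union> {j<..n})" using j by auto
    then have "(\<Sum>l = 1..n. g (if l \<le> j then j - l else l - j)) = 
       (\<Sum>l\<in>{1..<j} \<union> ({j} \<union> {j<..n}). g (if l \<le> j then j - l else l - j))" by simp
    also have "\<dots> = (\<Sum>l\<in>{1..<j}. g (if l \<le> j then j - l else l - j)) + (g 0 + (\<Sum>l\<in>{j<..n}. g (if l \<le> j then j - l else l - j)))"
      by (subst sum.union_disjoint; auto)+
    also have "(\<Sum>l\<in>{1..<j}. g (if l \<le> j then j - l else l - j)) = (\<Sum>h\<in>{1..<j}. g h)"
      by (rule sum.reindex_bij_witness[where i = "\<lambda>h. j - h" and j = "\<lambda>l. j - l"]) auto
    also have "(\<Sum>l\<in>{j<..n}. g (if l \<le> j then j - l else l - j)) = (\<Sum>h\<in>{1..n - j}. g h)"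
      by (rule sum.reindex_bij_witness[where i = "\<lambda>h. j + h" and j = "\<lambda>l. l - j"]) auto
    also have "(\<Sum>h\<in>{1..<j}. g h) + (g 0 + (\<Sum>h\<in>{1..n - j}. g h)) \<le> (\<Sum>h = 1..n. g h) + (1 + (\<Sum>h = 1..n. g h))"
      using j by (intro add_mono g sum_mono2) auto
    finally show ?thesis by simp
  qed
  then have "(\<Sum>j = 1..n. \<Sum>l = 1..n. g (if l \<le> j then j - l else l - j)) \<le> (\<Sum>j = 1..n. 1 + 2 * (\<Sum>h = 1..n. g h))"
    by (intro sum_mono)
  then show ?thesis by simp
qed

lemma norm_sum_ek_sq:
  fixes z :: "nat \<Rightarrow> real ^ 'n::finite"
  shows "(norm (\<Sum>j = 1..n. ek k (($) (z j))))\<^sup>2 =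
    (\<Sum>j = 1..n. \<Sum>l = 1..n. cos ((\<chi> i. 2 * pi * of_int (k i)) \<bullet> (z j - z l)))"
proof -
  have Re: "Re (ek k (($) x) * cnj (ek k (($) y))) = cos ((\<chi> i. 2 * pi * of_int (k i)) \<bullet> (x - y))" for x y :: "real ^ 'n"
    unfolding ek_diff[symmetric] by (simp add: ek_def inner_vec_def sum_distrib_left mult.assoc)
  have "(norm (\<Sum>j = 1..n. ek k (($) (z j))))\<^sup>2 = Re (of_real ((norm (\<Sum>j = 1..n. ek k (($) (z j))))\<^sup>2))" by simp
  also have "\<dots> = Re (\<Sum>j = 1..n. \<Sum>l = 1..n. ek k (($) (z j)) * cnj (ek k (($) (z l))))"
    unfolding complex_norm_square by (simp add: sum_product)
  finally show ?thesis by (simp only: Re_sum Re)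
qed

text \<open>The squared modulus is a double sum of cosines of differences, whose expectations depend
  on |j - l| only. The diagonal produces 1 / n; the off-diagonal terms are summed by the Laplace
  estimate.\<close>

lemma fourier_second_moment:
  fixes Z :: "real \<Rightarrow> 'w \<Rightarrow> real ^ 'n::finite"
  assumes M: "prob_space M" and S: "subordinator M B S" and n: "n \<ge> 1" and \<tau>: "\<tau> > 0" and k: "k \<noteq> (\<lambda>_. 0)"
    and Z: "\<And>t. t \<ge> 0 \<Longrightarrow> Z t \<in> borel_measurable M"
      "\<And>s t c. s \<ge> 0 \<Longrightarrow> t \<ge> 0 \<Longrightarrow> (\<integral>\<omega>. cos (c \<bullet> (Z s \<omega> - Z t \<omega>)) \<partial>M) =
         (\<integral>\<omega>. exp (- (norm c)\<^sup>2 * \<bar>S s \<omega> - S t \<omega>\<bar> powr (2 * H) / 2) \<partial>M)"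
    and C: "C \<ge> 0" "a \<ge> 0" "\<And>\<kappa> m. \<kappa> \<ge> 1 \<Longrightarrow>
      (\<Sum>j = 1..m. \<integral>\<omega>. exp (- \<kappa> * S (real j * \<tau>) \<omega> powr (2 * H)) \<partial>M) \<le> C * \<kappa> powr (- a) / \<tau>"
  shows "integrable M (\<lambda>\<omega>. (norm (1 / of_nat n * (\<Sum>j = 1..n. ek k (($) (Z (real j * \<tau>) \<omega>)))))\<^sup>2)"
    "(\<integral>\<omega>. (norm (1 / of_nat n * (\<Sum>j = 1..n. ek k (($) (Z (real j * \<tau>) \<omega>)))))\<^sup>2 \<partial>M)
      \<le> 1 / real n + 2 * C / (real n * \<tau>) * (\<Sum>i\<in>UNIV. (of_int (k i))\<^sup>2) powr (- a)"
proof -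
  interpret prob_space M by fact
  define c :: "real ^ 'n" where "c = (\<chi> i. 2 * pi * of_int (k i))"
  define K where "K = (\<Sum>i\<in>UNIV. (real_of_int (k i))\<^sup>2)"
  have K1: "K \<ge> 1" unfolding K_def by (rule sum_squares_int_ge_1[OF k])
  \<comment> \<open>This equals 2 \<pi>^2 |k|^2 and is thus at least |k|^2 \<ge> 1. Hence the
    hypothesis on \<kappa> applies, and as the exponent - a is at most 0, \<open>\<kappa>\<close>
    may afterwards be replaced by |k|^2.\<close>
  define \<kappa> where "\<kappa> = (norm c)\<^sup>2 / 2"
  have "(norm c)\<^sup>2 = 4 * pi\<^sup>2 * K"
    by (simp add: norm_vec_def L2_set_def sum_nonneg c_def K_def sum_distrib_left power_mult_distrib)
  then have \<kappa>: "\<kappa> = 2 * pi\<^sup>2 * K" by (simp add: \<kappa>_def)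
  have pi1: "2 * pi\<^sup>2 \<ge> 1" using pi_ge_two one_le_power[of pi 2] by linarith
  have \<kappa>K: "\<kappa> \<ge> K" using mult_right_mono[OF pi1, of K] K1 by (simp add: \<kappa>)
  then have \<kappa>1: "\<kappa> \<ge> 1" using K1 by linarith
  define g where "g h = (\<integral>\<omega>. exp (- \<kappa> * S (real h * \<tau>) \<omega> powr (2 * H)) \<partial>M)" for h
  have [measurable]: "Z (real j * \<tau>) \<in> borel_measurable M" for j using \<tau> by (intro Z) simp
  have intc: "integrable M (\<lambda>\<omega>. cos (c \<bullet> (Z (real j * \<tau>) \<omega> - Z (real l * \<tau>) \<omega>)))" for j l
    by (rule integrable_const_bound[where B = 1]) auto
  have Ecos: "(\<integral>\<omega>. cos (c \<bullet> (Z (real j * \<tau>) \<omega> - Z (real l * \<tau>) \<omega>)) \<partial>M) = g (if l \<le> j then j - l else l - j)" for j l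
  proof -
    have "(\<integral>\<omega>. cos (c \<bullet> (Z (real j * \<tau>) \<omega> - Z (real l * \<tau>) \<omega>)) \<partial>M)
       = (\<integral>\<omega>. exp (- \<kappa> * \<bar>S (real j * \<tau>) \<omega> - S (real l * \<tau>) \<omega>\<bar> powr (2 * H)) \<partial>M)"
      using \<tau> by (subst Z(2)) (auto simp: \<kappa>_def)
    also have "\<dots> = (\<integral>\<omega>. exp (- \<kappa> * S \<bar>real j * \<tau> - real l * \<tau>\<bar> \<omega> powr (2 * H)) \<partial>M)"
      using \<tau> by (intro subordinator_increment[OF S, where f = "\<lambda>x. exp (- \<kappa> * x powr (2 * H))"]) auto
    also have "\<bar>real j * \<tau> - real l * \<tau>\<bar> = real (if l \<le> j then j - l else l - j) * \<tau>"
      using \<tau> by (auto simp: left_diff_distrib[symmetric] abs_mult of_nat_diff)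
    finally show ?thesis by (simp only: g_def)
  qed
  have expand: "(norm (1 / of_nat n * (\<Sum>j = 1..n. ek k (($) (Z (real j * \<tau>) \<omega>)))))\<^sup>2 =
    1 / (real n)\<^sup>2 * (\<Sum>j = 1..n. \<Sum>l = 1..n. cos (c \<bullet> (Z (real j * \<tau>) \<omega> - Z (real l * \<tau>) \<omega>)))" for \<omega>
    unfolding c_def norm_sum_ek_sq[symmetric] by (simp add: norm_mult norm_divide power_mult_distrib power_divide)
  show "integrable M (\<lambda>\<omega>. (norm (1 / of_nat n * (\<Sum>j = 1..n. ek k (($) (Z (real j * \<tau>) \<omega>)))))\<^sup>2)"
    unfolding expand by (intro integrable_mult_right Bochner_Integration.integrable_sum intc)
  have "(\<integral>\<omega>. (norm (1 / of_nat n * (\<Sum>j = 1..n. ek k (($) (Z (real j * \<tau>) \<omega>)))))\<^sup>2 \<partial>M)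
     = 1 / (real n)\<^sup>2 * (\<Sum>j = 1..n. \<Sum>l = 1..n. g (if l \<le> j then j - l else l - j))"
    unfolding expand Ecos[symmetric] by (simp add: intc)
  also have "\<dots> \<le> 1 / (real n)\<^sup>2 * (real n * (1 + 2 * (\<Sum>h = 1..n. g h)))"
  proof (intro mult_left_mono sum_dist_le)
    show "g h \<ge> 0" for h by (simp add: g_def)
    have "g 0 \<le> (\<integral>\<omega>. 1 \<partial>M)"
      unfolding g_def using \<kappa>1 by (intro integral_mono') auto
    then show "g 0 \<le> 1" by (simp add: prob_space)
  qed simp
  also have "\<dots> \<le> 1 / (real n)\<^sup>2 * (real n * (1 + 2 * (C * K powr (- a) / \<tau>)))"
  proof (intro mult_left_mono add_left_mono)
    have "(\<Sum>h = 1..n. g h) \<le> C * \<kappa> powr (- a) / \<tau>"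
      unfolding g_def by (rule C(3)[OF \<kappa>1])
    also have "\<dots> \<le> C * K powr (- a) / \<tau>"
      using C(1,2) \<tau> K1 \<kappa>K by (intro divide_right_mono mult_left_mono powr_mono2') auto
    finally show "(\<Sum>h = 1..n. g h) \<le> C * K powr (- a) / \<tau>" .
  qed simp_all
  also have "\<dots> = 1 / real n + 2 * C / (real n * \<tau>) * K powr (- a)"
    using n \<tau> by (simp add: field_simps power2_eq_square)
  finally show "(\<integral>\<omega>. (norm (1 / of_nat n * (\<Sum>j = 1..n. ek k (($) (Z (real j * \<tau>) \<omega>)))))\<^sup>2 \<partial>M)
      \<le> 1 / real n + 2 * C / (real n * \<tau>) * (\<Sum>i\<in>UNIV. (of_int (k i))\<^sup>2) powr (- a)"
    by (simp add: K_def)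
qed

section \<open>Rates\<close>


lemma power_diff_le:
  fixes a b :: real
  assumes "0 \<le> b" "b \<le> a"
  shows "a ^ n - b ^ n \<le> real n * (a - b) * a ^ (n - 1)"
proof -
  have "a ^ n - b ^ n = (a - b) * (\<Sum>i<n. b ^ (n - Suc i) * a ^ i)" by (rule power_diff_sumr2)
  also have "\<dots> \<le> (a - b) * (\<Sum>i<n. a ^ (n - 1))"
  proof (intro mult_left_mono sum_mono)
    fix i assume i: "i \<in> {..<n}"
    have "b ^ (n - Suc i) * a ^ i \<le> a ^ (n - Suc i) * a ^ i"
      using assms by (intro mult_right_mono power_mono) auto
    also have "\<dots> = a ^ (n - 1)" using i by (simp add: power_add[symmetric])
    finally show "b ^ (n - Suc i) * a ^ i \<le> a ^ (n - 1)" .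
  qed (use assms in simp)
  finally show ?thesis by (simp add: mult_ac)
qed

lemma card_freq_box: "card (freq_box (int R) :: ('n::finite \<Rightarrow> int) set) = (2 * R + 1) ^ CARD('n)"
  unfolding freq_box_eq_PiE by (subst card_PiE) (auto simp: nat_eq_iff intro!: arg_cong2[where f = power])

text \<open>Induction on \<open>R\<close> peels off shells of constant maximum norm. The shell at m
  has at most 2 d 3^(d - 1) m^(d - 1) points, by a difference of d-th powers, and each point has
  Euclidean norm at least m.\<close>

lemma sum_freq_box_le:
  assumes s: "s \<ge> 0"
  shows "(\<Sum>k\<in>freq_box (int R) - {\<lambda>_. 0 :: int}. (\<Sum>i\<in>(UNIV :: 'n::finite set). (real_of_int (k i))\<^sup>2) powr (- (s / 2)))
    \<le> 2 * real CARD('n) * 3 ^ (CARD('n) - 1) * (\<Sum>m = 1..R. real m powr (real CARD('n) - s - 1))"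
proof (induction R)
  case 0
  have "freq_box (int 0) - {\<lambda>_. 0} = ({} :: ('n \<Rightarrow> int) set)" by (auto simp: freq_box_def)
  then show ?case by (simp only: sum.empty) simp
next
  case (Suc R)
  let ?d = "CARD('n)"
  let ?f = "\<lambda>k :: 'n \<Rightarrow> int. (\<Sum>i\<in>UNIV. (real_of_int (k i))\<^sup>2) powr (- (s / 2))"
  let ?m = "real (Suc R)"
  define Sh where "Sh = (freq_box (int (Suc R)) - freq_box (int R) :: ('n \<Rightarrow> int) set)"
  have sub: "freq_box (int R) \<subseteq> (freq_box (int (Suc R)) :: ('n \<Rightarrow> int) set)"
    by (auto simp: freq_box_def intro: order_trans)
  have "freq_box (int (Suc R)) - {\<lambda>_. 0 :: int} = (freq_box (int R) - {\<lambda>_. 0 :: int}) \<union> Sh"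
    using sub by (auto simp: Sh_def freq_box_def)
  then have "sum ?f (freq_box (int (Suc R)) - {\<lambda>_. 0}) = sum ?f ((freq_box (int R) - {\<lambda>_. 0}) \<union> Sh)" by simp
  also have "\<dots> = sum ?f (freq_box (int R) - {\<lambda>_. 0}) + sum ?f Sh"
    by (intro sum.union_disjoint) (auto simp: Sh_def finite_freq_box)
  also have "sum ?f Sh \<le> (\<Sum>k\<in>Sh. ?m powr (- s))"
  proof (rule sum_mono)
    fix k assume "k \<in> Sh"
    then obtain i where "int R < \<bar>k i\<bar>" by (auto simp: Sh_def freq_box_def not_le)
    then have "?m \<le> \<bar>real_of_int (k i)\<bar>" by linarith
    then have "?m\<^sup>2 \<le> (real_of_int (k i))\<^sup>2" using power_mono[of ?m "\<bar>real_of_int (k i)\<bar>" 2] by simp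
    also have "\<dots> \<le> (\<Sum>i\<in>UNIV. (real_of_int (k i))\<^sup>2)" by (rule member_le_sum) auto
    finally have "?f k \<le> (?m\<^sup>2) powr (- (s / 2))" using s by (intro powr_mono2') auto
    also have "\<dots> = ?m powr (- s)"
    proof -
      have "?m\<^sup>2 = ?m powr 2" by simp
      then show ?thesis by (simp only: powr_powr) simp
    qed
    finally show "?f k \<le> ?m powr (- s)" .
  qed
  also have "\<dots> = real (card Sh) * ?m powr (- s)" by simp
  also have "\<dots> \<le> (2 * real ?d * 3 ^ (?d - 1) * ?m powr (real ?d - 1)) * ?m powr (- s)"
  proof (rule mult_right_mono)
    have "card Sh = (2 * Suc R + 1) ^ ?d - (2 * R + 1) ^ ?d"
      unfolding Sh_def by (subst card_Diff_subset[OF finite_freq_box sub]) (simp only: card_freq_box)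
    then have "real (card Sh) = (2 * real R + 3) ^ ?d - (2 * real R + 1) ^ ?d"
      by (simp add: of_nat_diff power_mono algebra_simps)
    also have "\<dots> \<le> real ?d * ((2 * real R + 3) - (2 * real R + 1)) * (2 * real R + 3) ^ (?d - 1)"
      by (rule power_diff_le) auto
    also have "\<dots> \<le> real ?d * ((2 * real R + 3) - (2 * real R + 1)) * (3 * ?m) ^ (?d - 1)"
      by (intro mult_left_mono power_mono) auto
    also have "(3 * ?m) ^ (?d - 1) = 3 ^ (?d - 1) * ?m powr (real ?d - 1)"
    proof -
      have "?m powr (real ?d - 1) = ?m ^ (?d - 1)"
        using powr_realpow[of ?m "?d - 1"] one_le_card_finite[where 'a = 'n] by (simp add: of_nat_diff)
      then show ?thesis by (simp only: power_mult_distrib)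
    qed
    finally show "real (card Sh) \<le> 2 * real ?d * 3 ^ (?d - 1) * ?m powr (real ?d - 1)" by (simp add: mult_ac)
  qed simp
  also have "\<dots> = 2 * real ?d * 3 ^ (?d - 1) * ?m powr (real ?d - s - 1)"
    by (simp add: powr_add[symmetric] algebra_simps del: of_nat_Suc)
  finally show ?case using Suc.IH by (simp add: distrib_left del: of_nat_Suc)
qed

text \<open>Order of the sum of m^(q - 1) over m up to x: a power, a logarithm, or bounded. The
  summand 1 beside the logarithm keeps the value positive at x = 1.\<close>

definition growth :: "real \<Rightarrow> real \<Rightarrow> real" where
  "growth q x = (if q > 0 then x powr q else if q = 0 then 1 + ln x else 1)"

text \<open>Mean value theorem on [m - 1, m]: for q \<le> 1 the derivative is nonincreasing, so its
  value at m is a lower bound. For m = 1 the left end is 0, where continuity holds because q >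
  0.\<close>

lemma powr_diff_ge:
  fixes q m :: real
  assumes q: "0 < q" "q \<le> 1" and m: "m \<ge> 1"
  shows "q * m powr (q - 1) \<le> m powr q - (m - 1) powr q"
proof -
  have "\<exists>l z. m - 1 < z \<and> z < m \<and> ((\<lambda>x. x powr q) has_real_derivative l) (at z) \<and> m powr q - (m - 1) powr q = (m - (m - 1)) * l"
  proof (rule MVT)
    show "continuous_on {m - 1..m} (\<lambda>x. x powr q)"
      using q m by (intro continuous_on_powr' continuous_intros) auto
    fix x assume "m - 1 < x"
    then have "x > 0" using m by linarith
    then have "((\<lambda>x. x powr q) has_real_derivative q * x powr (q - 1)) (at x)" by (rule has_real_derivative_powr)
    then show "(\<lambda>x. x powr q) differentiable at x" by (auto simp: real_differentiable_def)
  qed simp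
  then obtain l z where z: "m - 1 < z" "z < m" "((\<lambda>x. x powr q) has_real_derivative l) (at z)" "m powr q - (m - 1) powr q = l" by auto
  have z0: "z > 0" using z m by linarith
  have "l = q * z powr (q - 1)"
    using DERIV_unique[OF z(3) has_real_derivative_powr[OF z0, of q]] .
  moreover have "m powr (q - 1) \<le> z powr (q - 1)" using q z z0 by (intro powr_mono2') auto
  ultimately show ?thesis using z q by simp
qed

text \<open>A convergent series for q < 0, telescoping of the logarithm for q = 0 and of m^q for 0 <
  q \<le> 1. For q > 1 the last summand is the largest, and counting terms already gives the right
  order.\<close>

lemma sum_powr_le:
  obtains C where "C > 0" "\<And>R. R \<ge> 1 \<Longrightarrow> (\<Sum>m = 1..R. real m powr (q - 1)) \<le> C * growth q (real R)"
proof -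
  consider "q < 0" | "q = 0" | "0 < q" "q \<le> 1" | "1 < q" by linarith
  then show ?thesis
  proof cases
    case 1
    then have sm: "summable (\<lambda>m. real m powr (q - 1))" by (simp add: summable_real_powr_iff)
    show ?thesis
    proof (rule that[of "1 + (\<Sum>m. real m powr (q - 1))"])
      show "0 < 1 + (\<Sum>m. real m powr (q - 1))" using suminf_nonneg[OF sm] by auto
      have "(\<Sum>m = 1..R. real m powr (q - 1)) \<le> (\<Sum>m. real m powr (q - 1))" for R
        by (intro sum_le_suminf sm) auto
      then show "(\<Sum>m = 1..R. real m powr (q - 1)) \<le> (1 + (\<Sum>m. real m powr (q - 1))) * growth q (real R)" for R
        using 1 by (simp add: growth_def add_increasing)
    qed
  next
    case 2
    have "(\<Sum>m = 1..R. real m powr (q - 1)) \<le> 1 + ln (real R)" if "R \<ge> 1" for R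
      using that
    proof (induction R rule: dec_induct)
      case (step R)
      have R: "real R \<ge> 1" using step by simp
      have "ln (real R / (real R + 1)) \<le> real R / (real R + 1) - 1"
        using R by (intro ln_le_minus_one) simp
      also have "\<dots> = - (1 / (real R + 1))" using R by (simp add: field_simps)
      finally have "1 / (real R + 1) \<le> ln (real R + 1) - ln (real R)" using R by (simp add: ln_div)
      then show ?case using step.IH 2 R by (simp add: powr_minus_divide add.commute)
    qed (use 2 in simp)
    then show ?thesis using 2 by (intro that[of 1]) (auto simp: growth_def)
  next
    case 3
    have "(\<Sum>m = 1..R. real m powr (q - 1)) \<le> real R powr q / q" for R
    proof (induction R)
      case (Suc R)
      have "real (Suc R) powr (q - 1) \<le> (real (Suc R) powr q - real R powr q) / q"
        using powr_diff_ge[OF 3, of "real (Suc R)"] 3 by (simp add: field_simps)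
      then show ?case using Suc by (simp add: diff_divide_distrib del: of_nat_Suc)
    qed simp
    then show ?thesis using 3 by (intro that[of "1 / q"]) (auto simp: growth_def)
  next
    case 4
    have "(\<Sum>m = 1..R. real m powr (q - 1)) \<le> real R powr q" if R: "R \<ge> 1" for R
    proof -
      have "(\<Sum>m = 1..R. real m powr (q - 1)) \<le> (\<Sum>m = 1..R. real R powr (q - 1))"
        using 4 by (intro sum_mono powr_mono2) auto
      also have "\<dots> = real R powr q" using R by (simp add: powr_mult_base)
      finally show ?thesis .
    qed
    then show ?thesis using 4 by (intro that[of 1]) (auto simp: growth_def)
  qed
qed

section \<open>Balancing the errors against the claimed rate\<close>

lemma ln_ge_1: "t \<ge> 3 \<Longrightarrow> 1 \<le> ln (t :: real)"
  using exp_le by (subst ln_ge_iff) auto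

text \<open>Confines the case distinction of \<open>W2_rate\<close>: afterwards the rate is used
  through these inequalities alone. For t \<ge> 3 the logarithm is at least 1, so the critical rate
  dominates t^(- 1 / 2).\<close>

lemma W2_rate_bounds:
  assumes d: "d \<ge> 1" and \<gamma>: "\<alpha> / H \<ge> 0" and \<beta>: "\<beta> > 0" and t: "t \<ge> 3"
  defines "\<rho> \<equiv> W2_rate d H \<alpha> \<beta> t"
  shows "\<rho> > 0" "\<rho> \<le> 1" "1 / t \<le> \<rho>\<^sup>2" "d \<ge> 2 \<Longrightarrow> t powr (- ((1 + \<beta>) / d)) \<le> \<rho>"
    "d = 2 + \<alpha> / H \<Longrightarrow> ln t / t \<le> \<rho>\<^sup>2"
    "d > 2 + \<alpha> / H \<Longrightarrow> t powr (- (1 / (d - \<alpha> / H))) \<le> \<rho>"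
proof -
  have ln1: "ln t \<ge> 1" by (rule ln_ge_1[OF t])
  have mono: "t powr (- a) \<le> t powr (- b)" if "b \<le> a" for a b using t that by (intro powr_mono) auto
  have le1: "t powr (- a) \<le> 1" if "a \<ge> 0" for a using mono[of 0 a] that t by simp
  have ht: "1 / t = (t powr (- (1 / 2)))\<^sup>2"
    using t by (subst powr_power) (simp_all add: powr_minus_divide)
  have sq: "x \<le> \<rho>\<^sup>2" if "sqrt x \<le> \<rho>" "x \<ge> 0" for x
    using power_mono[OF that(1), of 2] that(2) by simp
  have half: "1 / t \<le> \<rho>\<^sup>2" if "t powr (- (1 / 2)) \<le> \<rho>"
    unfolding ht using that by (intro power_mono) auto
  consider (a) "d = 2 + \<alpha> / H" | (b) "d \<noteq> 2 + \<alpha> / H" "d \<le> 2" | (c) "2 < d" "d < 2 + \<alpha> / H" | (e) "2 < d" "2 + \<alpha> / H < d"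
    using \<gamma> by linarith
  then have "\<rho> > 0 \<and> \<rho> \<le> 1 \<and> 1 / t \<le> \<rho>\<^sup>2 \<and> (d \<ge> 2 \<longrightarrow> t powr (- ((1 + \<beta>) / d)) \<le> \<rho>) \<and>
    (d = 2 + \<alpha> / H \<longrightarrow> ln t / t \<le> \<rho>\<^sup>2) \<and> (d > 2 + \<alpha> / H \<longrightarrow> t powr (- (1 / (d - \<alpha> / H))) \<le> \<rho>)"
  proof cases
    case a
    have \<rho>: "\<rho> = max (sqrt (ln t / t)) (t powr (- ((1 + \<beta>) / d)))" using a by (simp add: \<rho>_def W2_rate_def)
    have "ln t / t \<le> 1" using ln_le_minus_one[of t] t by (simp add: divide_le_eq_1)
    then have "\<rho> \<le> 1" using le1[of "(1 + \<beta>) / d"] d \<beta> by (simp add: \<rho>)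
    moreover have l: "ln t / t \<le> \<rho>\<^sup>2" using ln1 t by (intro sq) (auto simp: \<rho>)
    moreover have "1 / t \<le> ln t / t" using ln1 t by (simp add: divide_right_mono)
    moreover have "\<rho> > 0" using t by (simp add: \<rho> less_max_iff_disj)
    ultimately show ?thesis using a by (auto simp: \<rho>)
  next
    case b
    have \<rho>: "\<rho> = t powr (- (1 / 2))" using b by (simp add: \<rho>_def W2_rate_def)
    have "t powr (- ((1 + \<beta>) / d)) \<le> \<rho>" if "d \<ge> 2" unfolding \<rho> using b that \<beta> by (intro mono) (auto simp: field_simps)
    then show ?thesis using b \<gamma> t half le1[of "1 / 2"] by (auto simp: \<rho>)
  next
    case c
    have \<rho>: "\<rho> = t powr (- min (1 / 2) ((1 + \<beta>) / d))" using c by (simp add: \<rho>_def W2_rate_def)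
    have "\<rho> \<le> 1" unfolding \<rho> using c \<beta> by (intro le1) auto
    moreover have "t powr (- ((1 + \<beta>) / d)) \<le> \<rho>" "t powr (- (1 / 2)) \<le> \<rho>" unfolding \<rho> by (rule mono, rule min.cobounded1 min.cobounded2)+
    ultimately show ?thesis using c half t by (auto simp: \<rho>)
  next
    case e
    have \<rho>: "\<rho> = t powr (- min (1 / (d - \<alpha> / H)) ((1 + \<beta>) / d))" using e by (simp add: \<rho>_def W2_rate_def)
    have "\<rho> \<le> 1" unfolding \<rho> using e \<beta> \<gamma> by (intro le1) auto
    moreover have "1 / (d - \<alpha> / H) \<le> 1 / 2"
    proof -
      have "1 / y \<le> 1 / 2" if "y > 2" for y :: real using that by (simp add: field_simps)
      then show ?thesis using e by simp
    qed
    then have "t powr (- (1 / 2)) \<le> \<rho>" unfolding \<rho> by (intro mono order_trans[OF min.cobounded1])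
    moreover have "t powr (- ((1 + \<beta>) / d)) \<le> \<rho>" "t powr (- (1 / (d - \<alpha> / H))) \<le> \<rho>" unfolding \<rho> by (rule mono, rule min.cobounded1 min.cobounded2)+
    ultimately show ?thesis using e half t by (auto simp: \<rho>)
  qed
  then show "\<rho> > 0" "\<rho> \<le> 1" "1 / t \<le> \<rho>\<^sup>2" "d \<ge> 2 \<Longrightarrow> t powr (- ((1 + \<beta>) / d)) \<le> \<rho>"
    "d = 2 + \<alpha> / H \<Longrightarrow> ln t / t \<le> \<rho>\<^sup>2"
    "d > 2 + \<alpha> / H \<Longrightarrow> t powr (- (1 / (d - \<alpha> / H))) \<le> \<rho>" by blast+
qed

text \<open>Here \<open>n\<close> is the sample size, \<open>u\<close> the observation time n
  \<tau>, and \<open>x\<close> the largest frequency 2 M, at most 4 / \<rho>. Substituting the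
  latter leaves a negative power of \<rho>, which the matching lower bound on \<rho> turns into
  \<rho>^2.\<close>

lemma growth_rate_bound:
  assumes d: "d \<ge> 1" and \<gamma>: "\<alpha> / H \<ge> 0" and \<beta>: "\<beta> > 0" and c: "c > 0" and t: "t \<ge> 3"
  defines "\<rho> \<equiv> W2_rate d H \<alpha> \<beta> t"
  assumes x: "x \<ge> 1" "x \<le> 4 / \<rho>" and n: "n \<ge> c * t powr (1 + \<beta>)" and u: "u \<ge> t / 2"
  shows "growth (d - 2) x / n \<le> (1 + 4 / \<beta> + 4 powr (d - 2)) / c * \<rho>\<^sup>2"
    "growth (d - (2 + \<alpha> / H)) x / u \<le> (8 + 2 * 4 powr (d - (2 + \<alpha> / H))) * \<rho>\<^sup>2"
proof -
  note \<rho> = W2_rate_bounds[OF d \<gamma> \<beta> t, folded \<rho>_def]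
  have ln1: "ln t \<ge> 1" by (rule ln_ge_1[OF t])
  have tp: "t powr (1 + \<beta>) > 0" using t by simp
  have n0: "n > 0" using n c tp by (meson less_le_trans mult_pos_pos)
  have u0: "u > 0" using u t by linarith
  have inv_n: "1 / n \<le> 1 / (c * t powr (1 + \<beta>))" using n n0 c tp by (intro divide_left_mono mult_pos_pos) auto
  have inv_u: "1 / u \<le> 2 / t" using u u0 t by (simp add: field_simps)
  \<comment> \<open>As \<rho>^2 \<ge> 1 / t, the square of x is at most 16 t; then ln 2 \<le> 1
    \<le> ln t absorbs all constants into the factor 4.\<close>
  have lnx: "1 + ln x \<le> 4 * ln t"
  proof -
    have "(1 / \<rho>)\<^sup>2 \<le> t" using \<rho>(1,3) t by (simp add: power_divide field_simps)
    then have "x\<^sup>2 \<le> 16 * t" using x power_mono[OF x(2), of 2] by (simp add: power_divide)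
    then have "ln (x\<^sup>2) \<le> ln (16 * t)" using x by (intro ln_mono) auto
    also have "ln (16 * t) = 4 * ln 2 + ln t" using t ln_realpow[of 2 4] by (simp add: ln_mult)
    finally have "2 * ln x \<le> 4 * ln 2 + ln t" using x by (simp add: ln_realpow)
    moreover have "ln 2 \<le> (1 :: real)" using ln_le_minus_one[of 2] by simp
    ultimately show ?thesis using ln1 by linarith
  qed
  have xp: "x powr q \<le> 4 powr q * \<rho> powr (- q)" if "q \<ge> 0" for q
  proof -
    have "x powr q \<le> (4 / \<rho>) powr q" using x that by (intro powr_mono2) auto
    also have "\<dots> = 4 powr q * \<rho> powr (- q)" using \<rho>(1) by (simp add: powr_divide powr_minus_divide)
    finally show ?thesis .
  qed
  have t1: "t powr (- (1 + \<beta>)) \<le> 1 / t"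
    using powr_mono[of "- (1 + \<beta>)" "- 1" t] \<beta> t by (simp add: powr_minus_divide)
  have K: "a / c * \<rho>\<^sup>2 \<le> (1 + 4 / \<beta> + 4 powr (d - 2)) / c * \<rho>\<^sup>2" if "a \<le> 1 + 4 / \<beta> + 4 powr (d - 2)" for a
    using that c by (intro mult_right_mono divide_right_mono) auto
  have \<beta>4: "4 / \<beta> > 0" using \<beta> by simp
  consider "d < 2" | "d = 2" | "d > 2" by linarith
  then show "growth (d - 2) x / n \<le> (1 + 4 / \<beta> + 4 powr (d - 2)) / c * \<rho>\<^sup>2"
  proof cases
    case 1
    then have "growth (d - 2) x / n \<le> 1 / (c * t powr (1 + \<beta>))" using inv_n by (simp add: growth_def)
    also have "\<dots> = 1 / c * t powr (- (1 + \<beta>))" unfolding powr_minus_divide[of t "1 + \<beta>"] by simp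
    also have "\<dots> \<le> 1 / c * \<rho>\<^sup>2" using t1 \<rho>(3) c by (intro mult_left_mono) auto
    also have "\<dots> \<le> (1 + 4 / \<beta> + 4 powr (d - 2)) / c * \<rho>\<^sup>2" using \<beta>4 by (intro K) simp
    finally show ?thesis .
  next
    case 2
    have "growth (d - 2) x / n \<le> 4 * ln t * (1 / n)" using 2 lnx n0 by (simp add: growth_def divide_right_mono)
    \<comment> \<open>The logarithm of dimension 2 is absorbed by the factor t^\<beta> by which
      \<open>n\<close> exceeds t; this is the origin of 4 / \<beta>.\<close>
    also have "\<dots> \<le> 4 * (t powr \<beta> / \<beta>) * (1 / (c * t powr (1 + \<beta>)))"
      using ln_powr_bound[of t \<beta>] t \<beta> inv_n n0 by (intro mult_mono) auto
    also have "\<dots> = 4 / \<beta> / c * (1 / t)" using t by (simp add: powr_add)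
    also have "\<dots> \<le> 4 / \<beta> / c * \<rho>\<^sup>2" using \<rho>(3) \<beta> c by (intro mult_left_mono) auto
    also have "\<dots> \<le> (1 + 4 / \<beta> + 4 powr (d - 2)) / c * \<rho>\<^sup>2" by (intro K) simp
    finally show ?thesis .
  next
    case 3
    have "t powr (- (1 + \<beta>)) = (t powr (- ((1 + \<beta>) / d))) powr d" using 3 by (simp add: powr_powr)
    also have "\<dots> \<le> \<rho> powr d" using 3 \<rho>(4) by (intro powr_mono2) auto
    finally have td: "t powr (- (1 + \<beta>)) \<le> \<rho> powr d" .
    have "growth (d - 2) x / n = x powr (d - 2) * (1 / n)" using 3 by (simp add: growth_def)
    also have "\<dots> \<le> (4 powr (d - 2) * \<rho> powr (- (d - 2))) * (1 / (c * t powr (1 + \<beta>)))"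
      using 3 n0 by (intro mult_mono xp inv_n) auto
    also have "\<dots> = 4 powr (d - 2) / c * (\<rho> powr (- (d - 2)) * t powr (- (1 + \<beta>)))"
      unfolding powr_minus_divide[of t "1 + \<beta>"] by simp
    also have "\<dots> \<le> 4 powr (d - 2) / c * (\<rho> powr (- (d - 2)) * \<rho> powr d)"
      using td c by (intro mult_left_mono) auto
    also have "\<rho> powr (- (d - 2)) * \<rho> powr d = \<rho>\<^sup>2"
      using \<rho>(1) by (simp add: powr_add[symmetric])
    also have "4 powr (d - 2) / c * \<rho>\<^sup>2 \<le> (1 + 4 / \<beta> + 4 powr (d - 2)) / c * \<rho>\<^sup>2" using \<beta>4 by (intro K) simp
    finally show ?thesis .
  qed
  define q where "q = d - (2 + \<alpha> / H)"
  have K': "a * \<rho>\<^sup>2 \<le> (8 + 2 * 4 powr q) * \<rho>\<^sup>2" if "a \<le> 8 + 2 * 4 powr q" for a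
    using that by (intro mult_right_mono) auto
  have "growth q x / u \<le> (8 + 2 * 4 powr q) * \<rho>\<^sup>2"
  proof -
    consider "q < 0" | "q = 0" | "q > 0" by linarith
    then show ?thesis
    proof cases
      case 1
      then have "growth q x / u \<le> 2 * (1 / t)" using inv_u by (simp add: growth_def)
      also have "\<dots> \<le> 2 * \<rho>\<^sup>2" using \<rho>(3) by simp
      also have "\<dots> \<le> (8 + 2 * 4 powr q) * \<rho>\<^sup>2" by (rule K') simp
      finally show ?thesis .
    next
      case 2
      have "growth q x / u \<le> 4 * ln t * (1 / u)" using 2 lnx u0 by (simp add: growth_def divide_right_mono)
      also have "\<dots> \<le> 4 * ln t * (2 / t)" using inv_u ln1 by (intro mult_left_mono) auto
      also have "\<dots> = 8 * (ln t / t)" by simp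
      also have "\<dots> \<le> 8 * \<rho>\<^sup>2" using \<rho>(5) 2 by (simp add: q_def)
      also have "\<dots> \<le> (8 + 2 * 4 powr q) * \<rho>\<^sup>2" by (rule K') simp
      finally show ?thesis .
    next
      case 3
      have q2: "d - \<alpha> / H = q + 2" by (simp add: q_def)
      have "1 / t = (t powr (- (1 / (q + 2)))) powr (q + 2)"
      proof -
        have "- (1 / (q + 2)) * (q + 2) = - 1" using 3 by simp
        then show ?thesis using t by (simp only: powr_powr) (simp add: powr_minus_divide)
      qed
      also have "\<dots> \<le> \<rho> powr (q + 2)" using 3 \<rho>(6) by (intro powr_mono2) (auto simp: q2[symmetric] q_def)
      finally have td: "1 / t \<le> \<rho> powr (q + 2)" .
      have "growth q x / u = x powr q * (1 / u)" using 3 by (simp add: growth_def)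
      also have "\<dots> \<le> (4 powr q * \<rho> powr (- q)) * (2 / t)"
        using 3 u0 by (intro mult_mono xp inv_u) auto
      also have "\<dots> = 2 * 4 powr q * (\<rho> powr (- q) * (1 / t))" by simp
      also have "\<dots> \<le> 2 * 4 powr q * (\<rho> powr (- q) * \<rho> powr (q + 2))"
        using td by (intro mult_left_mono) auto
      also have "\<rho> powr (- q) * \<rho> powr (q + 2) = \<rho>\<^sup>2"
        using \<rho>(1) by (simp add: powr_add[symmetric])
      also have "2 * 4 powr q * \<rho>\<^sup>2 \<le> (8 + 2 * 4 powr q) * \<rho>\<^sup>2" by (rule K') simp
      finally show ?thesis .
    qed
  qed
  then show "growth (d - (2 + \<alpha> / H)) x / u \<le> (8 + 2 * 4 powr (d - (2 + \<alpha> / H))) * \<rho>\<^sup>2"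
    by (simp only: q_def)
qed

theorem theorem1p5:
  fixes H \<alpha> \<beta> c\<^sub>1 c\<^sub>2 :: real
    and B :: "real \<Rightarrow> real"
    and M :: "'w measure"
    and Y :: "real \<Rightarrow> 'w \<Rightarrow> ('n::finite) torus"
    and \<tau> :: "real \<Rightarrow> real"
  assumes H: "0 < H" "H < 1"
    and cond:
      "(H = 1 / 2 \<and> 0 \<le> \<alpha> \<and> \<alpha> \<le> 1 \<and> B \<in> bernstein_B_alpha \<alpha>) \<or>
       (H \<noteq> 1 / 2 \<and> 0 < \<alpha> \<and> \<alpha> < 1 \<and> bernstein B \<and> B 0 = 0 \<and>
        (\<exists>b \<nu>. levy_khintchine B b \<nu> \<and>
           (\<exists>c>0. \<forall>A\<in>sets \<nu>.
              (\<integral>\<^sup>+ y\<in>A. ennreal (c * y powr (- 1 - \<alpha>)) \<partial>lborel) \<le> emeasure \<nu> A)))"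
    and Y: "torus_subordinated_fbm M H B Y"
    and beta: "\<beta> > 0"
    and c: "c\<^sub>1 > 0" "c\<^sub>2 > 0"
    and tau: "\<And>t. t > 0 \<Longrightarrow>
      \<tau> t > 0 \<and> c\<^sub>1 * t powr (- \<beta>) \<le> \<tau> t \<and> \<tau> t \<le> c\<^sub>2 * t powr (- \<beta>)"
  shows "\<exists>C>0. \<exists>t\<^sub>0>1. \<forall>t\<ge>t\<^sub>0.
    (\<integral>\<^sup>+ \<omega>. ennreal (W2 (empirical_measure (nat \<lfloor>t / \<tau> t\<rfloor>) (\<lambda>k. Y (real k * \<tau> t) \<omega>))
                       torus_uniform) \<partial>M)
      \<le> ennreal (C * W2_rate (real CARD('n)) H \<alpha> \<beta> t)"
proof -
  from Y obtain X S where M: "prob_space M"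
    and X: "fractional_brownian_motion M H (X :: real \<Rightarrow> 'w \<Rightarrow> real ^ 'n)" and S: "subordinator M B S"
    and indep: "prob_space.indep_set M (process_events M X) (process_events M S)"
    and YX: "\<And>t \<omega>. t \<ge> 0 \<Longrightarrow> \<omega> \<in> space M \<Longrightarrow> Y t \<omega> = torus_proj (X (S t \<omega>) \<omega>)"
    unfolding torus_subordinated_fbm_def by blast
  interpret prob_space M by (rule M)
  have \<alpha>: "\<alpha> \<ge> 0" using cond by auto
  then have \<gamma>: "\<alpha> / H \<ge> 0" using H by simp
  let ?d = "real CARD('n)"
  have d: "?d \<ge> 1" using one_le_card_finite[where 'a = 'n] by linarith
  obtain Z where Zm: "\<And>t. t \<ge> 0 \<Longrightarrow> Z t \<in> borel_measurable M"
    and ZX: "\<And>t. t \<ge> 0 \<Longrightarrow> AE \<omega> in M. Z t \<omega> = X (S t \<omega>) \<omega>"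
    and Zcos: "\<And>s t c. s \<ge> 0 \<Longrightarrow> t \<ge> 0 \<Longrightarrow> (\<integral>\<omega>. cos (c \<bullet> (Z s \<omega> - Z t \<omega>)) \<partial>M) =
       (\<integral>\<omega>. exp (- (norm c)\<^sup>2 * \<bar>S s \<omega> - S t \<omega>\<bar> powr (2 * H) / 2) \<partial>M)"
    by (rule fbm_time_change[OF M X H(1) subordinator_process[OF S] indep]) (assumption | rule that; assumption)+
  obtain C where C: "C > 0" "\<And>\<tau> \<kappa> m. \<tau> > 0 \<Longrightarrow> \<kappa> \<ge> 1 \<Longrightarrow>
    (\<Sum>j = 1..m. \<integral>\<omega>. exp (- \<kappa> * S (real j * \<tau>) \<omega> powr (2 * H)) \<partial>M) \<le> C * \<kappa> powr (- (\<alpha> / (2 * H))) / \<tau>"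
    by (rule subordinator_sum_le[OF M S H(1) cond]) (rule that; assumption)
  obtain C\<^sub>3 where C\<^sub>3: "C\<^sub>3 > 0" "\<And>R. R \<ge> 1 \<Longrightarrow> (\<Sum>m = 1..R. real m powr ((?d - 2) - 1)) \<le> C\<^sub>3 * growth (?d - 2) (real R)"
    by (rule sum_powr_le[of "?d - 2"]) (rule that; assumption)
  obtain C\<^sub>4 where C\<^sub>4: "C\<^sub>4 > 0" "\<And>R. R \<ge> 1 \<Longrightarrow> (\<Sum>m = 1..R. real m powr ((?d - (2 + \<alpha> / H)) - 1)) \<le> C\<^sub>4 * growth (?d - (2 + \<alpha> / H)) (real R)"
    by (rule sum_powr_le[of "?d - (2 + \<alpha> / H)"]) (rule that; assumption)
  define A where "A = 3 * (?d + exp 3 + 1)"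
  define L where "L = 2 * ?d * 3 ^ (CARD('n) - 1)"
  \<comment> \<open>From n \<ge> t / (2 \<tau>) and the upper bound on \<tau>, this is the constant
    in n \<ge> c t^(1 + \<beta>).\<close>
  define c where "c = 1 / (2 * c\<^sub>2)"
  define D\<^sub>1 where "D\<^sub>1 = (1 + 4 / \<beta> + 4 powr (?d - 2)) / c"
  define D\<^sub>2 where "D\<^sub>2 = 8 + 2 * 4 powr (?d - (2 + \<alpha> / H))"
  define E where "E = 1 + L * C\<^sub>3 * D\<^sub>1 + 2 * C * (L * C\<^sub>4) * D\<^sub>2"
  have A0: "A > 0" using d by (simp add: A_def add_pos_pos)
  have L0: "L > 0" using d by (simp add: L_def)
  have c0: "c > 0" using assms by (simp add: c_def)
  have D0: "D\<^sub>1 > 0" "D\<^sub>2 > 0" using c0 beta by (auto simp: D\<^sub>1_def D\<^sub>2_def intro!: divide_pos_pos add_pos_pos)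
  have E0: "E > 0" using L0 C(1) C\<^sub>3(1) C\<^sub>4(1) D0 by (simp add: E_def add_pos_pos)
  show ?thesis
  proof (intro exI conjI allI impI)
    show "(A * E + 1) / 2 > 0" using A0 E0 by (simp add: add_pos_pos)
    \<comment> \<open>The 3 gives ln t \<ge> 1. The term \<open>2 * c\<^sub>2\<close> gives t \<ge>
      2 \<tau>, so the floor of t / \<tau> loses at most a factor 2.\<close>
    show "3 + 2 * c\<^sub>2 > 1" using c by simp
    fix t assume t: "t \<ge> 3 + 2 * c\<^sub>2"
    have t3: "t \<ge> 3" using t c by simp
    define \<rho> where "\<rho> = W2_rate ?d H \<alpha> \<beta> t"
    note \<rho> = W2_rate_bounds[OF d \<gamma> beta t3, folded \<rho>_def]
    define T where "T = \<tau> t"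
    have T: "T > 0" "T \<le> c\<^sub>2 * t powr (- \<beta>)" using tau[of t] t3 by (auto simp: T_def)
    define n where "n = nat \<lfloor>t / T\<rfloor>"
    have "t powr (- \<beta>) \<le> 1" using powr_mono[of "- \<beta>" 0 t] t3 beta by simp
    then have "c\<^sub>2 * t powr (- \<beta>) \<le> c\<^sub>2" using c by simp
    then have T2: "2 * T \<le> t" using T t by linarith
    then have tT2: "t / T \<ge> 2" using T by (simp add: field_simps)
    have "y / 2 \<le> real (nat \<lfloor>y\<rfloor>)" if "y \<ge> 2" for y :: real
      using that of_nat_nat[of "\<lfloor>y\<rfloor>"] by linarith
    from this[OF tT2] have n_ge: "real n \<ge> t / T / 2" unfolding n_def .
    then have n1: "n \<ge> 1" using tT2 by (simp add: Suc_le_eq)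
    have nT: "real n * T \<ge> t / 2" using mult_right_mono[OF n_ge less_imp_le[OF T(1)]] T by simp
    have nt: "real n \<ge> c * t powr (1 + \<beta>)"
    proof -
      have "c * t powr (1 + \<beta>) = t / (c\<^sub>2 * t powr (- \<beta>)) / 2"
        using t3 by (simp add: c_def powr_add powr_minus_divide)
      also have "\<dots> \<le> t / T / 2" using T t3 by (intro divide_right_mono divide_left_mono) auto
      finally show ?thesis using n_ge by linarith
    qed
    \<comment> \<open>The cutoff is the inverse rate rounded up; since \<rho> \<le> 1, rounding at
      most doubles it.\<close>
    define m where "m = nat \<lceil>1 / \<rho>\<rceil>"
    have \<rho>1: "1 / \<rho> \<ge> 1" using \<rho>(1,2) by simp
    then have m: "real m \<ge> 1 / \<rho>" "real m \<le> 2 / \<rho>" "m \<ge> 1" unfolding m_def by linarith+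
    have m2: "1 / (real m)\<^sup>2 \<le> \<rho>\<^sup>2"
    proof -
      have "1 / real m \<le> \<rho>" using m \<rho>(1) by (simp add: field_simps)
      from power_mono[OF this, of 2] show ?thesis by (simp add: power_divide)
    qed
    have x: "real (2 * m) \<ge> 1" "real (2 * m) \<le> 4 / \<rho>" using m by auto
    note grow = growth_rate_bound[OF d \<gamma> beta c0 t3, folded \<rho>_def, OF x nt nT, folded D\<^sub>1_def D\<^sub>2_def]
    define Bx where "Bx = (freq_box (2 * int m) - {\<lambda>_. 0} :: ('n \<Rightarrow> int) set)"
    define K where "K k = (\<Sum>i\<in>UNIV. (real_of_int (k i))\<^sup>2)" for k :: "'n \<Rightarrow> int"
    define F where "F k \<omega> = (norm (1 / of_nat n * (\<Sum>j = 1..n. ek k (($) (Z (real j * T) \<omega>)))))\<^sup>2" for k \<omega>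
    define G where "G \<omega> = 1 / (real m)\<^sup>2 + (\<Sum>k\<in>Bx. F k \<omega> / K k)" for \<omega>
    have K0: "K k \<ge> 0" for k by (simp add: K_def sum_nonneg)
    have KB: "K k > 0" if "k \<in> Bx" for k
      using that sum_squares_int_ge_1[of k] by (simp add: Bx_def K_def)
    have intF: "integrable M (F k)"
      and EF: "(\<integral>\<omega>. F k \<omega> \<partial>M) \<le> 1 / real n + 2 * C / (real n * T) * K k powr (- (\<alpha> / (2 * H)))" if "k \<in> Bx" for k
    proof -
      have k: "k \<noteq> (\<lambda>_. 0)" using that by (simp add: Bx_def)
      have a: "\<alpha> / (2 * H) \<ge> 0" using \<alpha> H by simp
      note fsm = fourier_second_moment[OF M S n1 T(1) k Zm Zcos less_imp_le[OF C(1)] a C(2)[OF T(1)]]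
      show "integrable M (F k)" unfolding F_def by (rule fsm(1))
      show "(\<integral>\<omega>. F k \<omega> \<partial>M) \<le> 1 / real n + 2 * C / (real n * T) * K k powr (- (\<alpha> / (2 * H)))"
        unfolding F_def K_def by (rule fsm(2))
    qed
    have G0: "G \<omega> \<ge> 0" for \<omega> by (auto simp: G_def F_def intro!: add_nonneg_nonneg sum_nonneg divide_nonneg_nonneg K0)
    have intG: "integrable M G" unfolding G_def by (auto intro!: Bochner_Integration.integrable_sum intF)
    have EG: "(\<integral>\<omega>. G \<omega> \<partial>M) \<le> E * \<rho>\<^sup>2"
    proof -
      have "(\<integral>\<omega>. G \<omega> \<partial>M) = 1 / (real m)\<^sup>2 + (\<Sum>k\<in>Bx. (\<integral>\<omega>. F k \<omega> \<partial>M) / K k)"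
        unfolding G_def by (simp add: intF prob_space)
      also have "(\<Sum>k\<in>Bx. (\<integral>\<omega>. F k \<omega> \<partial>M) / K k) \<le>
          (\<Sum>k\<in>Bx. (1 / real n + 2 * C / (real n * T) * K k powr (- (\<alpha> / (2 * H)))) / K k)"
        by (intro sum_mono divide_right_mono EF K0)
      \<comment> \<open>Exponents are written as halves because \<open>K k\<close> is the square of
        the Euclidean norm: the two sums have weights |k|^(- 2) and |k|^(- 2 - \<alpha> /
        H).\<close>
      also have "\<dots> = (\<Sum>k\<in>Bx. 1 / real n * K k powr (- (2 / 2)) + 2 * C / (real n * T) * K k powr (- ((2 + \<alpha> / H) / 2)))"
      proof (rule sum.cong[OF refl])
        fix k assume "k \<in> Bx"
        from KB[OF this] have Kp: "K k > 0" .
        have "K k powr (- ((2 + \<alpha> / H) / 2)) = K k powr (- (\<alpha> / (2 * H))) / K k"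
        proof -
          have "- ((2 + \<alpha> / H) / 2) = - (\<alpha> / (2 * H)) - 1" by (simp add: field_simps)
          then show ?thesis using Kp by (simp only: powr_diff powr_one)
        qed
        then show "(1 / real n + 2 * C / (real n * T) * K k powr (- (\<alpha> / (2 * H)))) / K k =
            1 / real n * K k powr (- (2 / 2)) + 2 * C / (real n * T) * K k powr (- ((2 + \<alpha> / H) / 2))"
          using Kp by (simp add: powr_minus_divide add_divide_distrib)
      qed
      also have "\<dots> = 1 / real n * (\<Sum>k\<in>Bx. K k powr (- (2 / 2))) + 2 * C / (real n * T) * (\<Sum>k\<in>Bx. K k powr (- ((2 + \<alpha> / H) / 2)))"
        by (simp add: sum.distrib sum_distrib_left)
      also have "\<dots> \<le> 1 / real n * (L * (C\<^sub>3 * growth (?d - 2) (real (2 * m)))) + 2 * C / (real n * T) * (L * (C\<^sub>4 * growth (?d - (2 + \<alpha> / H)) (real (2 * m))))"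
      proof (intro add_mono mult_left_mono)
        have m21: "2 * m \<ge> 1" using m by simp
        have B2: "Bx = freq_box (int (2 * m)) - {\<lambda>_. 0}" by (simp add: Bx_def)
        have "(\<Sum>k\<in>Bx. K k powr (- (2 / 2))) \<le> L * (\<Sum>i = 1..2 * m. real i powr (?d - 2 - 1))"
          unfolding B2 K_def L_def by (rule sum_freq_box_le) simp
        also have "\<dots> \<le> L * (C\<^sub>3 * growth (?d - 2) (real (2 * m)))"
          using L0 by (intro mult_left_mono C\<^sub>3(2) m21) simp
        finally show "(\<Sum>k\<in>Bx. K k powr (- (2 / 2))) \<le> L * (C\<^sub>3 * growth (?d - 2) (real (2 * m)))" .
        have "(\<Sum>k\<in>Bx. K k powr (- ((2 + \<alpha> / H) / 2))) \<le> L * (\<Sum>i = 1..2 * m. real i powr (?d - (2 + \<alpha> / H) - 1))"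
          unfolding B2 K_def L_def using \<gamma> by (intro sum_freq_box_le) simp
        also have "\<dots> \<le> L * (C\<^sub>4 * growth (?d - (2 + \<alpha> / H)) (real (2 * m)))"
          using L0 by (intro mult_left_mono C\<^sub>4(2) m21) simp
        finally show "(\<Sum>k\<in>Bx. K k powr (- ((2 + \<alpha> / H) / 2))) \<le> L * (C\<^sub>4 * growth (?d - (2 + \<alpha> / H)) (real (2 * m)))" .
      qed (use C(1) T in auto)
      also have "\<dots> = L * C\<^sub>3 * (growth (?d - 2) (real (2 * m)) / real n) + 2 * C * (L * C\<^sub>4) * (growth (?d - (2 + \<alpha> / H)) (real (2 * m)) / (real n * T))"
        by simp
      also have "\<dots> \<le> L * C\<^sub>3 * (D\<^sub>1 * \<rho>\<^sup>2) + 2 * C * (L * C\<^sub>4) * (D\<^sub>2 * \<rho>\<^sup>2)"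
        using L0 C(1) C\<^sub>3(1) C\<^sub>4(1) by (intro add_mono mult_left_mono grow) auto
      finally show ?thesis using m2 by (simp add: E_def algebra_simps)
    qed
    \<comment> \<open>The weighted inequality sqrt (A G) \<le> (A G / \<rho> + \<rho>) / 2 makes the
      bound linear in \<open>G\<close>, so the mean of \<open>G\<close> enters directly; the weight
      is balanced since that mean is of order \<rho>^2. The bound holds almost everywhere because
      the lifts \<open>Z\<close> agree with the time-changed process only almost surely.\<close>
    have bound: "AE \<omega> in M. W2 (empirical_measure n (\<lambda>k. Y (real k * T) \<omega>)) torus_uniform \<le> (A * G \<omega> / \<rho> + \<rho>) / 2"
    proof -
      have "AE \<omega> in M. \<forall>k\<in>{1..n}. Z (real k * T) \<omega> = X (S (real k * T) \<omega>) \<omega>"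
        using T by (intro AE_finite_allI ZX) auto
      then show ?thesis
      proof (rule AE_mp, intro AE_I2 impI)
        fix \<omega> assume w: "\<omega> \<in> space M" and Z: "\<forall>k\<in>{1..n}. Z (real k * T) \<omega> = X (S (real k * T) \<omega>) \<omega>"
        have "empirical_measure n (\<lambda>k. Y (real k * T) \<omega>) = empirical_measure n (\<lambda>k. torus_proj (Z (real k * T) \<omega>))"
          unfolding empirical_measure_def using w Z T by (intro arg_cong[where f = "measure_of UNIV (sets borel)"] ext arg_cong2[where f = "(*)"] refl sum.cong) (simp_all add: YX)
        then have "W2 (empirical_measure n (\<lambda>k. Y (real k * T) \<omega>)) torus_uniform \<le> sqrt (A * G \<omega>)"
          using W2_empirical_le[OF n1 m(3), of "\<lambda>k. Z (real k * T) \<omega>"]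
          by (simp only: A_def G_def F_def K_def Bx_def)
        also have "\<dots> \<le> (A * G \<omega> / \<rho> + \<rho>) / 2"
        proof -
          have "sqrt (A * G \<omega> / \<rho> * \<rho>) \<le> (A * G \<omega> / \<rho> + \<rho>) / 2"
            using A0 G0[of \<omega>] \<rho>(1) by (intro arith_geo_mean_sqrt) auto
          then show ?thesis using \<rho>(1) by simp
        qed
        finally show "W2 (empirical_measure n (\<lambda>k. Y (real k * T) \<omega>)) torus_uniform \<le> (A * G \<omega> / \<rho> + \<rho>) / 2" .
      qed
    qed
    have "(\<integral>\<^sup>+ \<omega>. ennreal (W2 (empirical_measure n (\<lambda>k. Y (real k * T) \<omega>)) torus_uniform) \<partial>M)
      \<le> (\<integral>\<^sup>+ \<omega>. ennreal ((A * G \<omega> / \<rho> + \<rho>) / 2) \<partial>M)"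
      by (rule nn_integral_mono_AE) (use bound in \<open>eventually_elim, auto intro: ennreal_leI\<close>)
    also have "\<dots> = ennreal (\<integral>\<omega>. (A * G \<omega> / \<rho> + \<rho>) / 2 \<partial>M)"
      using A0 G0 \<rho>(1) intG by (intro nn_integral_eq_integral AE_I2) auto
    also have "(\<integral>\<omega>. (A * G \<omega> / \<rho> + \<rho>) / 2 \<partial>M) = (A * (\<integral>\<omega>. G \<omega> \<partial>M) / \<rho> + \<rho>) / 2"
      using intG by (simp add: prob_space)
    also have "\<dots> \<le> (A * (E * \<rho>\<^sup>2) / \<rho> + \<rho>) / 2"
      using A0 \<rho>(1) by (intro divide_right_mono add_right_mono mult_left_mono EG) auto
    also have "\<dots> = (A * E + 1) / 2 * \<rho>"
      using \<rho>(1) by (simp add: power2_eq_square field_simps)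
    finally show "(\<integral>\<^sup>+ \<omega>. ennreal (W2 (empirical_measure (nat \<lfloor>t / \<tau> t\<rfloor>) (\<lambda>k. Y (real k * \<tau> t) \<omega>))
                       torus_uniform) \<partial>M) \<le> ennreal ((A * E + 1) / 2 * W2_rate ?d H \<alpha> \<beta> t)"
      by (simp add: n_def T_def \<rho>_def ennreal_leI)
  qed
qed

end
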